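(* Let $\operatorname{St}(3,3)$ be the real vector space of third order three dimensional symmetric and traceless tensors, with the natural action of the orthogonal group $\operatorname{O}(3,\mathbb{R})$. Then each minimal integrity basis of $\operatorname{St}(3,3)$ under the action of $\operatorname{O}(3,\mathbb{R})$ is an irreducible function basis of $\operatorname{St}(3,3)$ under the action of $\operatorname{O}(3,\mathbb{R})$.
   Context: $\operatorname{St}(3,3)$ is the space of real arrays $\mathcal{T}=(t_{i_1i_2i_3})_{i_1,i_2,i_3\in\{1,2,3\}}$ that are symmetric (invariant under all permutations of the three indices) and traceless: $\sum_{i=1}^3 t_{iij}=0$ for all $j\in\{1,2,3\}$. The group $G=\operatorname{O}(3,\mathbb{R})$ acts on it by $$(g\cdot\mathcal{T})_{j_1j_2j_3}=\sum_{i_1=1}^3\sum_{i_2=1}^3\sum_{i_3=1}^3 g_{j_1i_1}g_{j_2i_2}g_{j_3i_3}\,t_{i_1i_2i_3}.$$ Write $V=\operatorname{St}(3,3)$. $\mathbb{R}[V]$ is the algebra of real polynomial functions on $V$, and $\mathbb{R}[V]^G$ is the subring of polynomial invariants, i.e. those $f$ with $f(g\cdot v)=f(v)$ for all $g\in G$, $v\in V$. An integrity basis is a set of generators of $\mathbb{R}[V]^G$ as an $\mathbb{R}$-algebra. A minimal integrity basis is an integrity basis, consisting of homogeneous polynomials, in which none of the generators is a polynomial of the others. A function invariant is any function $f\colon V\to\mathbb{R}$ (not necessarily polynomial or continuous) with $f(g\cdot v)=f(v)$ for all $g\in G$, $v\in V$. A function basis is a set of function invariants such that every function invariant can be expressed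 as a function of the members of the set (that is, as a function of the tuple of values of the members). An irreducible function basis is a function basis in which none of the members is a function of the others. *)

theory Defs
  imports "HOL-Analysis.Analysis"
begin

section \<open>Polynomial invariants and integrity bases\<close>

text \<open>
  Throughout, \<open>V\<close> is a linear subspace of a Euclidean space, stable under the action \<open>act\<close> of a group \<open>G\<close>.
  Functions on \<open>V\<close> are represented by members of \<^term>\<open>extensional V\<close>, so that two of them are
  equal if and only if they agree on \<open>V\<close>. Every polynomial function on \<open>V\<close> extends to the ambient
  space (compose it with a linear projection onto \<open>V\<close>), and likewise for homogeneous ones, so both
  notions are obtained by restriction.
\<close>

definition poly_fun_on :: "'a::euclidean_space set \<Rightarrow> ('a \<Rightarrow> real) set" where
  "poly_fun_on V = {restrict p V |p. real_polynomial_function p}"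

text \<open>Sums of products of \<open>d\<close> linear forms:\<close>

inductive hom_poly_fun :: "nat \<Rightarrow> ('a::real_normed_vector \<Rightarrow> real) \<Rightarrow> bool" where
  const: "hom_poly_fun 0 (\<lambda>x. c)"
| linear: "bounded_linear f \<Longrightarrow> hom_poly_fun 1 f"
| add: "hom_poly_fun d f \<Longrightarrow> hom_poly_fun d g \<Longrightarrow> hom_poly_fun d (\<lambda>x. f x + g x)"
| mult: "hom_poly_fun d f \<Longrightarrow> hom_poly_fun e g \<Longrightarrow> hom_poly_fun (d + e) (\<lambda>x. f x * g x)"

definition homogeneous_on :: "'a::euclidean_space set \<Rightarrow> ('a \<Rightarrow> real) \<Rightarrow> bool" where
  "homogeneous_on V f \<longleftrightarrow> (\<exists>d p. hom_poly_fun d p \<and> f = restrict p V)"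

definition function_invariants ::
    "'a set \<Rightarrow> 'g set \<Rightarrow> ('g \<Rightarrow> 'a \<Rightarrow> 'a) \<Rightarrow> ('a \<Rightarrow> real) set" where
  "function_invariants V G act = {f \<in> extensional V. \<forall>g\<in>G. \<forall>v\<in>V. f (act g v) = f v}"

definition polynomial_invariants ::
    "'a::euclidean_space set \<Rightarrow> 'g set \<Rightarrow> ('g \<Rightarrow> 'a \<Rightarrow> 'a) \<Rightarrow> ('a \<Rightarrow> real) set" where
  "polynomial_invariants V G act = {f \<in> poly_fun_on V. \<forall>g\<in>G. \<forall>v\<in>V. f (act g v) = f v}"

text \<open>The \<open>\<real>\<close>-algebra of functions on \<open>V\<close> generated by \<open>B\<close>, i.e. all polynomials in members of \<open>B\<close>:\<close>

inductive_set generated_algebra :: "'a set \<Rightarrow> ('a \<Rightarrow> real) set \<Rightarrow> ('a \<Rightarrow> real) set"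
  for V :: "'a set" and B :: "('a \<Rightarrow> real) set" where
  gen: "f \<in> B \<Longrightarrow> f \<in> generated_algebra V B"
| const: "(\<lambda>v\<in>V. c) \<in> generated_algebra V B"
| add: "f \<in> generated_algebra V B \<Longrightarrow> g \<in> generated_algebra V B
    \<Longrightarrow> (\<lambda>v\<in>V. f v + g v) \<in> generated_algebra V B"
| mult: "f \<in> generated_algebra V B \<Longrightarrow> g \<in> generated_algebra V B
    \<Longrightarrow> (\<lambda>v\<in>V. f v * g v) \<in> generated_algebra V B"

definition integrity_basis ::
    "'a::euclidean_space set \<Rightarrow> 'g set \<Rightarrow> ('g \<Rightarrow> 'a \<Rightarrow> 'a) \<Rightarrow> ('a \<Rightarrow> real) set \<Rightarrow> bool" where
  "integrity_basis V G act B \<longleftrightarrow>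
     B \<subseteq> polynomial_invariants V G act \<and> generated_algebra V B = polynomial_invariants V G act"

definition minimal_integrity_basis ::
    "'a::euclidean_space set \<Rightarrow> 'g set \<Rightarrow> ('g \<Rightarrow> 'a \<Rightarrow> 'a) \<Rightarrow> ('a \<Rightarrow> real) set \<Rightarrow> bool" where
  "minimal_integrity_basis V G act B \<longleftrightarrow>
     integrity_basis V G act B \<and>
     (\<forall>f\<in>B. homogeneous_on V f) \<and>
     (\<forall>f\<in>B. f \<notin> generated_algebra V (B - {f}))"

section \<open>Function bases\<close>

text \<open>\<open>h\<close> is a function of the tuple of values of the members of \<open>F\<close>; the tuple is indexed by \<open>F\<close> itself.\<close>

definition function_of :: "'a set \<Rightarrow> ('a \<Rightarrow> real) set \<Rightarrow> ('a \<Rightarrow> real) \<Rightarrow> bool" where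
  "function_of V F h \<longleftrightarrow>
     (\<exists>\<phi> :: (('a \<Rightarrow> real) \<Rightarrow> real) \<Rightarrow> real. \<forall>v\<in>V. h v = \<phi> (\<lambda>f\<in>F. f v))"

definition function_basis ::
    "'a set \<Rightarrow> 'g set \<Rightarrow> ('g \<Rightarrow> 'a \<Rightarrow> 'a) \<Rightarrow> ('a \<Rightarrow> real) set \<Rightarrow> bool" where
  "function_basis V G act F \<longleftrightarrow>
     F \<subseteq> function_invariants V G act \<and>
     (\<forall>h\<in>function_invariants V G act. function_of V F h)"

definition irreducible_function_basis ::
    "'a set \<Rightarrow> 'g set \<Rightarrow> ('g \<Rightarrow> 'a \<Rightarrow> 'a) \<Rightarrow> ('a \<Rightarrow> real) set \<Rightarrow> bool" where
  "irreducible_function_basis V G act F \<longleftrightarrow>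
     function_basis V G act F \<and> (\<forall>f\<in>F. \<not> function_of V (F - {f}) f)"

section \<open>Third order three dimensional symmetric traceless tensors\<close>

type_synonym tensor333 = "real ^ 3 ^ 3 ^ 3"

definition St33 :: "tensor333 set" where
  "St33 = {T. (\<forall>i j k. T$i$j$k = T$i$k$j \<and> T$i$j$k = T$j$i$k \<and> T$i$j$k = T$j$k$i \<and>
                 T$i$j$k = T$k$i$j \<and> T$i$j$k = T$k$j$i) \<and>
              (\<forall>j. (\<Sum>i\<in>UNIV. T$i$i$j) = 0)}"

definition O3 :: "(real ^ 3 ^ 3) set" where
  "O3 = {g. orthogonal_matrix g}"

definition tensor_act :: "real ^ 3 ^ 3 \<Rightarrow> tensor333 \<Rightarrow> tensor333" where
  "tensor_act g T = (\<chi> j1 j2 j3. \<Sum>i1\<in>UNIV. \<Sum>i2\<in>UNIV. \<Sum>i3\<in>UNIV.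
      g$j1$i1 * g$j2$i2 * g$j3$i3 * T$i1$i2$i3)"

lemma subspace_St33: "subspace St33"
  unfolding subspace_def St33_def
  by (auto simp: sum.distrib simp flip: sum_distrib_left)

lemma tensor_act_St33:
  assumes g: "g \<in> O3" and T: "T \<in> St33"
  shows "tensor_act g T \<in> St33"
proof -
  have s1: "T$i$j$k = T$j$i$k" and s2: "T$i$j$k = T$i$k$j" for i j k
    using T by (auto simp: St33_def)
  have tr: "(\<Sum>i\<in>UNIV. T$i$i$j) = 0" for j
    using T by (auto simp: St33_def)
  let ?A = "tensor_act g T"
  have a1: "?A$i$j$k = ?A$j$i$k" for i j k
  proof -
    have "?A$i$j$k = (\<Sum>b\<in>UNIV. \<Sum>a\<in>UNIV. \<Sum>c\<in>UNIV. g$i$a * g$j$b * g$k$c * T$a$b$c)"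
      unfolding tensor_act_def by (simp, rule sum.swap)
    also have "\<dots> = ?A$j$i$k"
      unfolding tensor_act_def by (simp, intro sum.cong refl) (simp add: s1 mult_ac)
    finally show ?thesis .
  qed
  have a2: "?A$i$j$k = ?A$i$k$j" for i j k
  proof -
    have "?A$i$j$k = (\<Sum>a\<in>UNIV. \<Sum>c\<in>UNIV. \<Sum>b\<in>UNIV. g$i$a * g$j$b * g$k$c * T$a$b$c)"
      unfolding tensor_act_def by (simp, rule sum.cong[OF refl], rule sum.swap)
    also have "\<dots> = ?A$i$k$j"
      unfolding tensor_act_def by (simp, intro sum.cong refl) (simp add: s2 mult_ac)
    finally show ?thesis .
  qed
  have orth: "(\<Sum>i\<in>UNIV. g$i$a * g$i$b) = (if a = b then 1 else 0)" for a b
  proof -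
    have "(transpose g ** g)$a$b = mat 1$a$b"
      using g by (simp add: O3_def orthogonal_matrix)
    then show ?thesis by (simp add: matrix_matrix_mult_def transpose_def mat_def)
  qed
  have "(\<Sum>i\<in>UNIV. ?A$i$i$j) = 0" for j
  proof -
    have "(\<Sum>i\<in>UNIV. ?A$i$i$j) =
        (\<Sum>a\<in>UNIV. \<Sum>i\<in>UNIV. \<Sum>b\<in>UNIV. \<Sum>c\<in>UNIV. g$i$a * g$i$b * g$j$c * T$a$b$c)"
      unfolding tensor_act_def by (simp, rule sum.swap)
    also have "\<dots> = (\<Sum>a\<in>UNIV. \<Sum>b\<in>UNIV. \<Sum>i\<in>UNIV. \<Sum>c\<in>UNIV. g$i$a * g$i$b * g$j$c * T$a$b$c)"
      by (rule sum.cong[OF refl], rule sum.swap)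
    also have "\<dots> = (\<Sum>a\<in>UNIV. \<Sum>b\<in>UNIV. \<Sum>c\<in>UNIV. \<Sum>i\<in>UNIV. g$i$a * g$i$b * g$j$c * T$a$b$c)"
      by (rule sum.cong[OF refl], rule sum.cong[OF refl], rule sum.swap)
    also have "\<dots> = (\<Sum>a\<in>UNIV. \<Sum>b\<in>UNIV. \<Sum>c\<in>UNIV.
        (\<Sum>i\<in>UNIV. g$i$a * g$i$b) * (g$j$c * T$a$b$c))"
      by (simp add: sum_distrib_right mult.assoc)
    also have "\<dots> = (\<Sum>a\<in>UNIV. \<Sum>c\<in>UNIV. \<Sum>b\<in>UNIV.
        (\<Sum>i\<in>UNIV. g$i$a * g$i$b) * (g$j$c * T$a$b$c))"
      by (rule sum.cong[OF refl], rule sum.swap)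
    also have "\<dots> = (\<Sum>a\<in>UNIV. \<Sum>c\<in>UNIV. g$j$c * T$a$a$c)"
      by (simp add: orth if_distrib[of "\<lambda>x. x * _"] cong: if_cong)
    also have "\<dots> = (\<Sum>c\<in>UNIV. \<Sum>a\<in>UNIV. g$j$c * T$a$a$c)"
      by (rule sum.swap)
    also have "\<dots> = 0"
      by (simp add: tr flip: sum_distrib_left)
    finally show ?thesis .
  qed
  moreover have "?A$i$j$k = ?A$j$k$i" "?A$i$j$k = ?A$k$i$j" "?A$i$j$k = ?A$k$j$i" for i j k
    using a1 a2 by metis+
  ultimately show ?thesis
    using a1 a2 by (auto simp: St33_def)
qed

end

(*
  Restricting a harmonic cubic to the isotropic cone turns St(3,3) into binary sextics, with weight
  coordinates x_0, ..., x_6. An invariant of degree d has weight 0 and is killed by the raising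
  operator, which is surjective from weight 0 to weight 1; so the invariants of even degree d span at
  most as many dimensions as there are monomials of degree d in I2, I4, I6, I10, by a partial fraction
  expansion of the weight generating function. Odd invariants vanish because of -1. The map
  (I2, I4, I6, I10) has an invertible differential in some directions, hence an image with
  interior points, the four invariants are algebraically independent, and they generate.

  A minimal integrity basis must then consist of one element c_k I_k + q_k(I_j, j < k) in each of the
  four degrees. As this change of variables is invertible, one member can be varied inside the open
  part of the image while the others stay fixed, which gives irreducibility. That the invariants
  separate orbits follows from Stone-Weierstrass and averaging.
*)
theory Submission
  imports Defs "HOL-Computational_Algebra.Formal_Laurent_Series"
begin

unbundle no Formal_Power_Series.fps_syntax

section \<open>Counting monomials by degree and weight\<close>

text \<open>A generator that is no polynomial of the others may still be a function of them, so in
  general a minimal integrity basis can be redundant as a function basis. What excludes this here is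
  that the basic invariants satisfy no relation and that their values contain an open subset of
  4-space: one fact then serves both for generation and for irreducibility. The counting gives an
  upper bound for the invariants of a degree, and the independent monomials in I2, I4, I6, I10
  attain it; adding one more invariant therefore forces a linear relation that involves it. The
  count itself sees rotations only, through the infinitesimal rotations about two axes. The summand
  t^15 in its numerator comes from a rotation invariant of odd degree, which changes sign under -1.
  Diagonalising a rotation requires complex coordinates on a real space. Hence polynomials vanishing
  on real tensors must be shown to have zero complex coefficients, and real parts are taken at the
  end.\<close>

text \<open>
  Partial fractions in \<open>z\<close> of \<open>(1 - z) / ((1 - t) S R')\<close>, where \<open>S\<close> is the product of the
  \<open>1 - t z\<^sup>k\<close> and \<open>R'\<close> that of the \<open>1 - t z\<^bsup>-k\<^esup>\<close> for \<open>k = 1, 2, 3\<close>, multiplied out. The two long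
  brackets contribute only positive and only negative powers of \<open>z\<close>, so the constant term in \<open>z\<close>
  is \<open>(1 + t\<^bsup>15\<^esup>) / ((1 - t\<^sup>2) (1 - t\<^sup>4) (1 - t\<^sup>6) (1 - t\<^bsup>10\<^esup>))\<close>.
\<close>

lemma sextic_partial_fractions:
  fixes t z :: "'a::idom"
  shows "(1 + t) * (1 - t^4) * (1 - t^6) * (1 - t^10) * (1 - z) * z^6 =
    (1 + t^15) * ((1 - t*z) * (1 - t*z^2) * (1 - t*z^3)) * ((z - t) * (z^2 - t) * (z^3 - t))
    + ((-(1) - t^15) * z^1 + (t - t^3 - t^5 - t^7 - t^8 - t^10 - t^12 + t^16) * z^2 + (t - t^2 - t^5 - t^7 - t^10 + t^16) * z^3 + (-(t^2) + t^8 + t^11 + t^13 + t^16 - t^17) * z^4 + (-(t^2) + t^6 + t^8 + t^10 + t^11 + t^13 + t^15 - t^17) * z^5 + (t^3 + t^18) * z^6) * ((z - t) * (z^2 - t) * (z^3 - t))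
    + ((t^3 + t^18) + (-(t^2) - t^3 - t^17 - t^18) * z^1 + (-(t^6) - t^8 - t^10 - t^11 - t^13 - t^15) * z^2 + (t - t^8 - t^11 - t^13) * z^3 + (t^2 + t^5 + t^7 + t^10) * z^4 + (t^3 + t^5 + t^7 + t^8 + t^10 + t^12) * z^5) * ((1 - t*z) * (1 - t*z^2) * (1 - t*z^3))"
  by algebra

definition wexps :: "(nat \<Rightarrow> nat) \<Rightarrow> (nat \<Rightarrow> int) \<Rightarrow> nat \<Rightarrow> nat \<Rightarrow> int \<Rightarrow> (nat \<Rightarrow> nat) set" where
  "wexps deg wt n d w = {\<alpha>. (\<forall>j\<ge>n. \<alpha> j = 0) \<and> (\<Sum>j<n. deg j * \<alpha> j) = d \<and> (\<Sum>j<n. wt j * int (\<alpha> j)) = w}"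

lemma finite_exps_degree:
  assumes "\<And>j. j < n \<Longrightarrow> deg j > 0"
  shows "finite {\<alpha>::nat \<Rightarrow> nat. (\<forall>j\<ge>n. \<alpha> j = 0) \<and> (\<Sum>j<n. deg j * \<alpha> j) = d}"
proof (rule finite_subset)
  show "{\<alpha>::nat \<Rightarrow> nat. (\<forall>j\<ge>n. \<alpha> j = 0) \<and> (\<Sum>j<n. deg j * \<alpha> j) = d} \<subseteq>
      {\<alpha>. \<forall>j. (j \<in> {..<n} \<longrightarrow> \<alpha> j \<in> {..d}) \<and> (j \<notin> {..<n} \<longrightarrow> \<alpha> j = 0)}"
  proof clarsimp
    fix \<alpha> :: "nat \<Rightarrow> nat" and j assume "j < n"
    have "\<alpha> j \<le> deg j * \<alpha> j" using assms[OF \<open>j < n\<close>] by simp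
    also have "\<dots> \<le> (\<Sum>j<n. deg j * \<alpha> j)"
      using \<open>j < n\<close> by (intro member_le_sum) auto
    finally show "\<alpha> j \<le> (\<Sum>j<n. deg j * \<alpha> j)" .
  qed
  show "finite {\<alpha>::nat \<Rightarrow> nat. \<forall>j. (j \<in> {..<n} \<longrightarrow> \<alpha> j \<in> {..d}) \<and> (j \<notin> {..<n} \<longrightarrow> \<alpha> j = 0)}"
    by (rule finite_set_of_finite_funs) auto
qed

lemma finite_wexps:
  assumes "\<And>j. j < n \<Longrightarrow> deg j > 0"
  shows "finite (wexps deg wt n d w)"
  by (rule finite_subset[OF _ finite_exps_degree[of n deg d]]) (use assms in \<open>auto simp: wexps_def\<close>)

text \<open>A monomial either omits the last variable or is that variable times a monomial of
  smaller degree. In generating functions this is the factor 1/(1 - t^deg z^wt).\<close>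

lemma card_wexps_Suc:
  assumes pos: "\<And>j. j < Suc n \<Longrightarrow> deg j > 0"
  shows "card (wexps deg wt (Suc n) d w) = card (wexps deg wt n d w) +
    (if deg n \<le> d then card (wexps deg wt (Suc n) (d - deg n) (w - wt n)) else 0)"
proof -
  let ?W = "wexps deg wt (Suc n) d w"
  let ?Z = "{\<alpha> \<in> ?W. \<alpha> n = 0}" and ?P = "{\<alpha> \<in> ?W. \<alpha> n > 0}"
  have fin: "finite ?W" using pos by (rule finite_wexps)
  have "?W = ?Z \<union> ?P" by auto
  then have "card ?W = card ?Z + card ?P"
    using fin by (subst card_Un_disjoint[symmetric]) auto
  moreover have "?Z = wexps deg wt n d w"
    by (auto simp: wexps_def) (metis Suc_leI le_neq_implies_less)
  moreover have "card ?P = (if deg n \<le> d then card (wexps deg wt (Suc n) (d - deg n) (w - wt n)) else 0)"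
  proof (cases "deg n \<le> d")
    case True
    have "bij_betw (\<lambda>\<alpha>. \<alpha>(n := \<alpha> n + 1)) (wexps deg wt (Suc n) (d - deg n) (w - wt n)) ?P"
      by (rule bij_betw_byWitness[where f' = "\<lambda>\<alpha>. \<alpha>(n := \<alpha> n - 1)"])
        (use True in \<open>auto simp: wexps_def algebra_simps fun_eq_iff
          of_nat_diff diff_mult_distrib2\<close>)
    then show ?thesis using True bij_betw_same_card by fastforce
  next
    case False
    have "deg n \<le> d" if "\<alpha> \<in> ?P" for \<alpha>
    proof -
      have "deg n \<le> deg n * \<alpha> n" using that by auto
      also have "\<dots> \<le> d" using that by (auto simp: wexps_def)
      finally show ?thesis .
    qed
    then show ?thesis using False by (simp only: if_False) (metis (no_types, lifting) card.empty ex_in_conv)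
  qed
  ultimately show ?thesis by simp
qed

text \<open>Power series in t (degree) over Laurent series in z (weight). With positive
  \<open>deg\<close> each degree has finitely many monomials, so its weights are bounded below and
  the coefficients are genuine Laurent series although both signs of weight may occur.\<close>

definition wexps_series :: "(nat \<Rightarrow> nat) \<Rightarrow> (nat \<Rightarrow> int) \<Rightarrow> nat \<Rightarrow> rat fls fps" where
  "wexps_series deg wt n = Abs_fps (\<lambda>d. Abs_fls (\<lambda>w. of_nat (card (wexps deg wt n d w))))"

lemma wexps_series_nth:
  assumes "\<And>j. j < n \<Longrightarrow> deg j > 0"
  shows "fls_nth (fps_nth (wexps_series deg wt n) d) w = of_nat (card (wexps deg wt n d w))"
proof -
  let ?F = "{\<alpha>::nat \<Rightarrow> nat. (\<forall>j\<ge>n. \<alpha> j = 0) \<and> (\<Sum>j<n. deg j * \<alpha> j) = d}"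
  let ?v = "\<lambda>\<alpha>. \<Sum>j<n. wt j * int (\<alpha> j)"
  have fin: "finite ?F" using assms by (rule finite_exps_degree)
  have "card (wexps deg wt n d w) = 0" if "w < - (\<Sum>\<alpha>\<in>?F. \<bar>?v \<alpha>\<bar>)" for w
  proof -
    have *: "?v \<alpha> \<noteq> w" if "\<alpha> \<in> ?F" for \<alpha>
      using member_le_sum[of \<alpha> ?F "\<lambda>\<alpha>. \<bar>?v \<alpha>\<bar>"] fin that \<open>w < _\<close> by force
    have "wexps deg wt n d w = {}" unfolding wexps_def using * by blast
    then show ?thesis by simp
  qed
  then show ?thesis unfolding wexps_series_def
    by (simp, intro nth_Abs_fls_lower_bound) auto
qed

lemma wexps_series_0: "wexps_series deg wt 0 = 1"
proof (intro fps_ext fls_eqI)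
  fix d w
  have "wexps deg wt 0 d w = (if d = 0 \<and> w = 0 then {\<lambda>_. 0} else {})"
    by (auto simp: wexps_def)
  then show "fls_nth (fps_nth (wexps_series deg wt 0) d) w = fls_nth (fps_nth 1 d) w"
    by (auto simp: wexps_series_nth)
qed

lemma wexps_series_Suc:
  assumes pos: "\<And>j. j < Suc n \<Longrightarrow> deg j > 0"
  shows "(1 - fps_const (fls_X_intpow (wt n)) * fps_X ^ deg n) * wexps_series deg wt (Suc n)
    = wexps_series deg wt n"
proof (intro fps_ext fls_eqI)
  fix d w
  have n: "\<And>j. j < n \<Longrightarrow> deg j > 0" using pos by simp
  show "fls_nth (fps_nth ((1 - fps_const (fls_X_intpow (wt n)) * fps_X ^ deg n) * wexps_series deg wt (Suc n)) d) w
    = fls_nth (fps_nth (wexps_series deg wt n) d) w"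
    by (simp add: left_diff_distrib mult.assoc fps_X_power_mult_nth wexps_series_nth[OF pos]
        wexps_series_nth[OF n] card_wexps_Suc[OF pos] fls_X_intpow_times_conv_shift)
qed

section \<open>Weight bounds for reading off the constant term in z\<close>

lemma fls_times_nth_below:
  fixes f g :: "'a::comm_semiring_1 fls"
  assumes "\<And>w. w < a \<Longrightarrow> fls_nth f w = 0" "\<And>w. w < b \<Longrightarrow> fls_nth g w = 0" "w < a + b"
  shows "fls_nth (f * g) w = 0"
  unfolding fls_times_nth(2)
proof (intro sum.neutral ballI)
  fix i show "fls_nth f i * fls_nth g (w - i) = 0"
    using assms(1)[of i] assms(2)[of "w - i"] assms(3) by (cases "i < a") auto
qed

lemma fls_times_nth_above:
  fixes f g :: "'a::comm_semiring_1 fls"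
  assumes "\<And>w. w > a \<Longrightarrow> fls_nth f w = 0" "\<And>w. w > b \<Longrightarrow> fls_nth g w = 0" "w > a + b"
  shows "fls_nth (f * g) w = 0"
  unfolding fls_times_nth(2)
proof (intro sum.neutral ballI)
  fix i show "fls_nth f i * fls_nth g (w - i) = 0"
    using assms(1)[of i] assms(2)[of "w - i"] assms(3) by (cases "i > a") auto
qed

text \<open>One bound for all powers of t. Members of \<open>weights_ge 1\<close> and of
  \<open>weights_le (-1)\<close> have no constant term in z; this is how the two long brackets of
  the partial fractions drop out.\<close>

definition weights_ge :: "int \<Rightarrow> rat fls fps set" where
  "weights_ge a = {f. \<forall>d w. w < a \<longrightarrow> fls_nth (fps_nth f d) w = 0}"

definition weights_le :: "int \<Rightarrow> rat fls fps set" where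
  "weights_le a = {f. \<forall>d w. w > a \<longrightarrow> fls_nth (fps_nth f d) w = 0}"

lemma fls_sum_nth: "fls_nth (\<Sum>i\<in>A. f i) w = (\<Sum>i\<in>A. fls_nth (f i) w)"
  by (induction A rule: infinite_finite_induct) auto

lemma weights_ge_mult:
  assumes "f \<in> weights_ge a" "g \<in> weights_ge b"
  shows "f * g \<in> weights_ge (a + b)"
  using assms unfolding weights_ge_def
  by (auto simp: fps_mult_nth fls_sum_nth intro!: sum.neutral fls_times_nth_below)

lemma weights_le_mult:
  assumes "f \<in> weights_le a" "g \<in> weights_le b"
  shows "f * g \<in> weights_le (a + b)"
  using assms unfolding weights_le_def
  by (auto simp: fps_mult_nth fls_sum_nth intro!: sum.neutral fls_times_nth_above)

lemma weights_ge_simple [intro!]: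
  "f \<in> weights_ge a \<Longrightarrow> g \<in> weights_ge a \<Longrightarrow> f + g \<in> weights_ge a"
  "f \<in> weights_ge a \<Longrightarrow> g \<in> weights_ge a \<Longrightarrow> f - g \<in> weights_ge a"
  "f \<in> weights_ge a \<Longrightarrow> - f \<in> weights_ge a"
  by (auto simp: weights_ge_def)

lemma weights_le_simple [intro!]:
  "f \<in> weights_le a \<Longrightarrow> g \<in> weights_le a \<Longrightarrow> f + g \<in> weights_le a"
  "f \<in> weights_le a \<Longrightarrow> g \<in> weights_le a \<Longrightarrow> f - g \<in> weights_le a"
  "f \<in> weights_le a \<Longrightarrow> - f \<in> weights_le a"
  by (auto simp: weights_le_def)

lemma zero_weight_series [simp]:
  "1 \<in> weights_ge 0" "1 \<in> weights_le 0" "fps_X \<in> weights_ge 0" "fps_X \<in> weights_le 0"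
  "fps_X ^ k \<in> weights_ge 0" "fps_X ^ k \<in> weights_le 0"
  by (auto simp: weights_ge_def weights_le_def fps_X_nth fps_X_power_nth)

lemma weight_shift:
  "fps_const (fls_X_intpow k) \<in> weights_ge k" "fps_const (fls_X_intpow k) \<in> weights_le k"
  by (auto simp: weights_ge_def weights_le_def fps_const_def)

lemma wexps_series_weights_ge:
  assumes "\<And>j. j < n \<Longrightarrow> deg j > 0" "\<And>j. j < n \<Longrightarrow> wt j \<ge> 0"
  shows "wexps_series deg wt n \<in> weights_ge 0"
proof -
  have "wexps deg wt n d w = {}" if "w < 0" for d w
  proof -
    have "(\<Sum>j<n. wt j * int (\<alpha> j)) \<ge> 0" for \<alpha>
      by (rule sum_nonneg) (use assms(2) in auto)
    then show ?thesis using that by (simp add: wexps_def set_eq_iff) (metis linorder_not_le)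
  qed
  then show ?thesis by (auto simp: weights_ge_def wexps_series_nth[OF assms(1)])
qed

lemma wexps_series_weights_le:
  assumes "\<And>j. j < n \<Longrightarrow> deg j > 0" "\<And>j. j < n \<Longrightarrow> wt j \<le> 0"
  shows "wexps_series deg wt n \<in> weights_le 0"
proof -
  have "wexps deg wt n d w = {}" if "w > 0" for d w
  proof -
    have "(\<Sum>j<n. wt j * int (\<alpha> j)) \<le> 0" for \<alpha>
      by (rule sum_nonpos) (use assms(2) in \<open>auto simp: mult_nonpos_nonneg\<close>)
    then show ?thesis using that by (simp add: wexps_def set_eq_iff) (metis linorder_not_le)
  qed
  then show ?thesis by (auto simp: weights_le_def wexps_series_nth[OF assms(1)])
qed

text \<open>Multiplying the series \<open>C\<close> of all monomials by 1 - z turns its constant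
  term in z into the count at weight 0 minus that at weight -1. By the partial fractions this is the
  constant term of (1 + t^15) \<open>M\<close>, where \<open>M\<close> counts monomials in variables
  of degrees 2, 4, 6, 10.\<close>

lemma card_invariant_weights:
  "int (card (wexps (\<lambda>_. 1) (\<lambda>j. 3 - int j) 7 d 0)) - int (card (wexps (\<lambda>_. 1) (\<lambda>j. 3 - int j) 7 d (-1))) =
     int (card (wexps (\<lambda>j. [2,4,6,10] ! j) (\<lambda>_. 0) 4 d 0)) +
     (if 15 \<le> d then int (card (wexps (\<lambda>j. [2,4,6,10] ! j) (\<lambda>_. 0) 4 (d - 15) 0)) else 0)"
proof -
  define t :: "rat fls fps" where "t = fps_X"
  define z :: "rat fls fps" where "z = fps_const (fls_X_intpow 1)"
  define y :: "rat fls fps" where "y = fps_const (fls_X_intpow (-1))"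
  let ?deg = "\<lambda>j::nat. [2,4,6,10::nat] ! j"
  have zy: "z * y = 1"
    by (simp add: z_def y_def fls_X_intpow_times_conv_shift fps_const_mult[symmetric] del: fps_const_mult)
  have zpow: "fps_const (fls_X_intpow (int k)) = z ^ k" for k
    by (simp add: z_def fps_const_power fls_shifted_pow)
  have ypow: "fps_const (fls_X_intpow (- int k)) = y ^ k" for k
    by (simp add: y_def fps_const_power fls_shifted_pow)
  define C where "C = wexps_series (\<lambda>_. 1) (\<lambda>j. 3 - int j) 7"
  define Gp where "Gp = wexps_series (\<lambda>_. 1) (\<lambda>j. int j + 1) 3"
  define Gm where "Gm = wexps_series (\<lambda>_. 1) (\<lambda>j. - (int j + 1)) 3"
  define M where "M = wexps_series ?deg (\<lambda>_. 0) 4"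
  have c: "(1 - fps_const (fls_X_intpow (3 - int n)) * t) * wexps_series (\<lambda>_. 1) (\<lambda>j. 3 - int j) (Suc n)
      = wexps_series (\<lambda>_. 1) (\<lambda>j. 3 - int j) n" for n
    using wexps_series_Suc[of n "\<lambda>_. 1" "\<lambda>j. 3 - int j"] by (simp add: t_def)
  have C: "(1 - z^3*t) * ((1 - z^2*t) * ((1 - z*t) * ((1 - t) * ((1 - y*t) * ((1 - y^2*t) * ((1 - y^3*t) * C)))))) = 1"
    using c[of 0] c[of 1] c[of 2] c[of 3] c[of 4] c[of 5] c[of 6] zpow[of 3] zpow[of 2] zpow[of 1] ypow[of 1] ypow[of 2] ypow[of 3]
    by (simp add: C_def wexps_series_0 flip: numeral_2_eq_2)
  have gp: "(1 - z ^ Suc n * t) * wexps_series (\<lambda>_. 1) (\<lambda>j. int j + 1) (Suc n)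
      = wexps_series (\<lambda>_. 1) (\<lambda>j. int j + 1) n" for n
    using wexps_series_Suc[of n "\<lambda>_. 1" "\<lambda>j. int j + 1"] zpow[of "Suc n"]
    by (simp add: t_def add.commute)
  have Gp: "(1 - z*t) * ((1 - z^2*t) * ((1 - z^3*t) * Gp)) = 1"
    using gp[of 0] gp[of 1] gp[of 2] by (simp add: Gp_def wexps_series_0 numeral_2_eq_2 numeral_3_eq_3)
  have gm: "(1 - y ^ Suc n * t) * wexps_series (\<lambda>_. 1) (\<lambda>j. - (int j + 1)) (Suc n)
      = wexps_series (\<lambda>_. 1) (\<lambda>j. - (int j + 1)) n" for n
    using wexps_series_Suc[of n "\<lambda>_. 1" "\<lambda>j. - (int j + 1)"] ypow[of "Suc n"]
    by (simp add: t_def add.commute)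
  have Gm: "(1 - y*t) * ((1 - y^2*t) * ((1 - y^3*t) * Gm)) = 1"
    using gm[of 0] gm[of 1] gm[of 2] by (simp add: Gm_def wexps_series_0 numeral_2_eq_2 numeral_3_eq_3)
  have pos: "?deg j > 0" if "j < 4" for j
    using that by (auto simp: less_Suc_eq numeral_eq_Suc)
  have m: "(1 - t ^ ?deg n) * wexps_series ?deg (\<lambda>_. 0) (Suc n) = wexps_series ?deg (\<lambda>_. 0) n" if "n < 4" for n
    using wexps_series_Suc[of n ?deg "\<lambda>_. 0"] pos that by (simp add: t_def)
  have M: "(1 - t^2) * ((1 - t^4) * ((1 - t^6) * ((1 - t^10) * M))) = 1"
    using m[of 0] m[of 1] m[of 2] m[of 3] by (simp add: M_def wexps_series_0 flip: numeral_2_eq_2)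
  define P where "P = (-(1) - t^15) * z^1 + (t - t^3 - t^5 - t^7 - t^8 - t^10 - t^12 + t^16) * z^2 + (t - t^2 - t^5 - t^7 - t^10 + t^16) * z^3 + (-(t^2) + t^8 + t^11 + t^13 + t^16 - t^17) * z^4 + (-(t^2) + t^6 + t^8 + t^10 + t^11 + t^13 + t^15 - t^17) * z^5 + (t^3 + t^18) * z^6"
  \<comment> \<open>The second bracket of the partial fractions divided by z^6, hence written in
    \<open>y\<close>, the inverse of \<open>z\<close>: only negative powers of z, as
    \<open>P\<close> has only positive ones.\<close>
  define Q where "Q = (t^3 + t^18) * y^6 + (-(t^2) - t^3 - t^17 - t^18) * y^5 + (-(t^6) - t^8 - t^10 - t^11 - t^13 - t^15) * y^4 + (t - t^8 - t^11 - t^13) * y^3 + (t^2 + t^5 + t^7 + t^10) * y^2 + (t^3 + t^5 + t^7 + t^8 + t^10 + t^12) * y^1"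
  have main: "(1 - z) * C = (1 + t^15) * M + P * Gp * M + Q * Gm * M"
  proof -
    define S where "S = (1 - t*z) * (1 - t*z^2) * (1 - t*z^3)"
    define R where "R = (1 - t*y) * (1 - t*y^2) * (1 - t*y^3)"
    have 1: "z^6 * R = (z - t) * (z^2 - t) * (z^3 - t)"
      using zy unfolding R_def by algebra
    have 2: "z^6 * Q = (t^3 + t^18) + (-(t^2) - t^3 - t^17 - t^18) * z^1 + (-(t^6) - t^8 - t^10 - t^11 - t^13 - t^15) * z^2 + (t - t^8 - t^11 - t^13) * z^3 + (t^2 + t^5 + t^7 + t^10) * z^4 + (t^3 + t^5 + t^7 + t^8 + t^10 + t^12) * z^5"
      using zy unfolding Q_def by algebra
    \<comment> \<open>The polynomial identity is the desired one multiplied by z^6, which clears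
      \<open>y\<close>; the factor is cancelled afterwards.\<close>
    have "z^6 * ((1 + t) * (1 - t^4) * (1 - t^6) * (1 - t^10) * (1 - z)) =
        z^6 * ((1 + t^15) * S * R + P * R + Q * S)"
      using sextic_partial_fractions[of t z]
      unfolding 1[symmetric] 2[symmetric] S_def[symmetric] P_def[symmetric] by (simp add: algebra_simps)
    then have id: "(1 + t) * (1 - t^4) * (1 - t^6) * (1 - t^10) * (1 - z) = (1 + t^15) * S * R + P * R + Q * S"
      using zy by (metis mult_cancel_left mult_zero_left power_not_zero zero_neq_one)
    have SG: "S * Gp = 1" and RG: "R * Gm = 1" and SRC: "S * R * (1 - t) * C = 1"
      using Gp Gm C unfolding S_def R_def by (simp_all add: mult_ac)
    \<comment> \<open>Here (1 - t)(1 + t) = 1 - t^2 completes the denominator that \<open>M\<close>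
      cancels.\<close>
    have "(1 - z) * C = (1 + t) * (1 - t^4) * (1 - t^6) * (1 - t^10) * (1 - z) * ((1 - t) * C * M)"
      using M by algebra
    also have "\<dots> = (1 + t^15) * (S * R * (1 - t) * C) * M + P * R * (1 - t) * C * M * (S * Gp)
        + Q * S * (1 - t) * C * M * (R * Gm)"
      unfolding id SG RG by algebra
    also have "\<dots> = (1 + t^15) * (S * R * (1 - t) * C) * M + P * Gp * M * (S * R * (1 - t) * C)
        + Q * Gm * M * (S * R * (1 - t) * C)"
      by algebra
    finally show ?thesis unfolding SRC by simp
  qed
  have tz: "t ^ k \<in> weights_ge 0" "t ^ k \<in> weights_le 0" for k
    by (simp_all add: t_def)
  have tz1: "t \<in> weights_ge 0" "t \<in> weights_le 0"
    by (simp_all add: t_def)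
  have zk: "z ^ k \<in> weights_ge (int k)" "y ^ k \<in> weights_le (- int k)" for k
    unfolding zpow[symmetric] ypow[symmetric] by (rule weight_shift)+
  have zk1: "u * z ^ k \<in> weights_ge 1" if "u \<in> weights_ge 0" "k \<ge> 1" for u k
    using weights_ge_mult[OF that(1) zk(1)[of k]] that(2) by (auto simp: weights_ge_def)
  have yk1: "u * y ^ k \<in> weights_le (-1)" if "u \<in> weights_le 0" "k \<ge> 1" for u k
    using weights_le_mult[OF that(1) zk(2)[of k]] that(2) by (auto simp: weights_le_def)
  have P: "P \<in> weights_ge 1"
    unfolding P_def by (intro weights_ge_simple zk1 tz tz1 zero_weight_series) simp_all
  have Q: "Q \<in> weights_le (-1)"
    unfolding Q_def by (intro weights_le_simple yk1 tz tz1 zero_weight_series) simp_all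
  have Gp0: "Gp \<in> weights_ge 0"
    unfolding Gp_def by (rule wexps_series_weights_ge) auto
  have Gm0: "Gm \<in> weights_le 0"
    unfolding Gm_def by (rule wexps_series_weights_le) auto
  have M0: "M \<in> weights_ge 0" "M \<in> weights_le 0"
    unfolding M_def by (rule wexps_series_weights_ge wexps_series_weights_le; simp add: pos)+
  have PGM: "fls_nth (fps_nth (P * Gp * M) d) 0 = 0"
    using weights_ge_mult[OF weights_ge_mult[OF P Gp0] M0(1)] by (simp add: weights_ge_def)
  have QGM: "fls_nth (fps_nth (Q * Gm * M) d) 0 = 0"
    using weights_le_mult[OF weights_le_mult[OF Q Gm0] M0(2)] by (simp add: weights_le_def)
  have C_nth: "fls_nth (fps_nth C d) w = of_nat (card (wexps (\<lambda>_. 1) (\<lambda>j. 3 - int j) 7 d w))" for d w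
    unfolding C_def by (rule wexps_series_nth) simp
  have M_nth: "fls_nth (fps_nth M d) w = of_nat (card (wexps ?deg (\<lambda>_. 0) 4 d w))" for d w
    unfolding M_def by (rule wexps_series_nth) (rule pos)
  have "fls_nth (fps_nth ((1 - z) * C) d) 0 = fls_nth (fps_nth ((1 + t^15) * M) d) 0"
    unfolding main by (simp add: PGM QGM)
  moreover have "fls_nth (fps_nth ((1 - z) * C) d) 0 = fls_nth (fps_nth C d) 0 - fls_nth (fps_nth C d) (-1)"
    by (simp add: z_def left_diff_distrib fls_X_intpow_times_conv_shift)
  moreover have "fls_nth (fps_nth ((1 + t^15) * M) d) 0 = fls_nth (fps_nth M d) 0
      + (if 15 \<le> d then fls_nth (fps_nth M (d - 15)) 0 else 0)"
    by (simp add: t_def distrib_right fps_X_power_mult_nth)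
  ultimately have "rat_of_int (int (card (wexps (\<lambda>_. 1) (\<lambda>j. 3 - int j) 7 d 0)) - int (card (wexps (\<lambda>_. 1) (\<lambda>j. 3 - int j) 7 d (-1)))) =
     rat_of_int (int (card (wexps ?deg (\<lambda>_. 0) 4 d 0)) +
     (if 15 \<le> d then int (card (wexps ?deg (\<lambda>_. 0) 4 (d - 15) 0)) else 0))"
    by (simp add: C_nth M_nth split: if_splits)
  then show ?thesis by (simp only: of_int_eq_iff)
qed

section \<open>Polynomials in weight coordinates and the raising operator\<close>

definition exps_le :: "nat \<Rightarrow> nat \<Rightarrow> (nat \<Rightarrow> nat) set" where
  "exps_le n D = {\<alpha>. (\<forall>j\<ge>n. \<alpha> j = 0) \<and> (\<Sum>j<n. \<alpha> j) \<le> D}"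

definition mono_eval :: "nat \<Rightarrow> (nat \<Rightarrow> nat) \<Rightarrow> (nat \<Rightarrow> 'a::comm_semiring_1) \<Rightarrow> 'a" where
  "mono_eval n \<alpha> x = (\<Prod>j<n. x j ^ \<alpha> j)"

text \<open>A polynomial is given by a coefficient function on all exponent vectors and truncated
  only when evaluated. Operators on coefficients thus satisfy their commutation relations without
  any degree bound.\<close>

definition poly_eval :: "nat \<Rightarrow> nat \<Rightarrow> ((nat \<Rightarrow> nat) \<Rightarrow> 'a) \<Rightarrow> (nat \<Rightarrow> 'a::comm_semiring_1) \<Rightarrow> 'a" where
  "poly_eval n D \<phi> x = (\<Sum>\<alpha>\<in>exps_le n D. \<phi> \<alpha> * mono_eval n \<alpha> x)"

definition Dop :: "nat \<Rightarrow> ((nat \<Rightarrow> nat) \<Rightarrow> 'a::semiring_1) \<Rightarrow> (nat \<Rightarrow> nat) \<Rightarrow> 'a" where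
  "Dop i \<phi> \<beta> = of_nat (\<beta> i + 1) * \<phi> (\<beta>(i := \<beta> i + 1))"

definition Xop :: "nat \<Rightarrow> ((nat \<Rightarrow> nat) \<Rightarrow> 'a::semiring_1) \<Rightarrow> (nat \<Rightarrow> nat) \<Rightarrow> 'a" where
  "Xop i \<phi> \<beta> = (if \<beta> i = 0 then 0 else \<phi> (\<beta>(i := \<beta> i - 1)))"

lemma finite_exps_le: "finite (exps_le n D)"
proof (rule finite_subset)
  show "exps_le n D \<subseteq> {\<alpha>. \<forall>j. (j \<in> {..<n} \<longrightarrow> \<alpha> j \<in> {..D}) \<and> (j \<notin> {..<n} \<longrightarrow> \<alpha> j = 0)}"
  proof (clarsimp simp: exps_le_def)
    fix \<alpha> :: "nat \<Rightarrow> nat" and j assume "(\<Sum>j<n. \<alpha> j) \<le> D" "j < n"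
    with member_le_sum[of j "{..<n}" \<alpha>] show "\<alpha> j \<le> D" by simp
  qed
  show "finite {\<alpha>::nat \<Rightarrow> nat. \<forall>j. (j \<in> {..<n} \<longrightarrow> \<alpha> j \<in> {..D}) \<and> (j \<notin> {..<n} \<longrightarrow> \<alpha> j = 0)}"
    by (rule finite_set_of_finite_funs) auto
qed

lemma sum_fun_upd_nat:
  fixes \<alpha> :: "nat \<Rightarrow> 'a::comm_monoid_add"
  assumes "i < n"
  shows "(\<Sum>j<n. (\<alpha>(i := k)) j) = k + (\<Sum>j\<in>{..<n} - {i}. \<alpha> j)"
  using assms by (subst sum.remove[of _ i]) (auto intro!: sum.cong)

lemma mono_eval_fun_upd:
  fixes x :: "nat \<Rightarrow> 'a::comm_semiring_1"
  assumes "i < n"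
  shows "mono_eval n (\<alpha>(i := k)) x = x i ^ k * (\<Prod>j\<in>{..<n} - {i}. x j ^ \<alpha> j)"
  unfolding mono_eval_def using assms by (subst prod.remove[of _ i]) (auto intro!: prod.cong)

lemma exps_le_Suc_shift:
  assumes "i < n"
  shows "bij_betw (\<lambda>\<beta>. \<beta>(i := \<beta> i + 1)) (exps_le n D) {\<alpha> \<in> exps_le n (Suc D). \<alpha> i \<noteq> 0}"
proof (rule bij_betw_byWitness[where f' = "\<lambda>\<alpha>. \<alpha>(i := \<alpha> i - 1)"])
  have s: "(\<Sum>j<n. \<alpha> j) = \<alpha> i + (\<Sum>j\<in>{..<n} - {i}. \<alpha> j)" for \<alpha> :: "nat \<Rightarrow> nat"
    using assms by (simp add: sum.remove)
  show "(\<lambda>\<beta>. \<beta>(i := \<beta> i + 1)) ` exps_le n D \<subseteq> {\<alpha> \<in> exps_le n (Suc D). \<alpha> i \<noteq> 0}"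
    using assms by (auto simp: exps_le_def sum_fun_upd_nat s)
  show "(\<lambda>\<alpha>. \<alpha>(i := \<alpha> i - 1)) ` {\<alpha> \<in> exps_le n (Suc D). \<alpha> i \<noteq> 0} \<subseteq> exps_le n D"
    using assms by (auto simp: exps_le_def sum_fun_upd_nat s)
qed (auto simp: fun_eq_iff)

lemma poly_eval_Dop:
  fixes \<phi> :: "(nat \<Rightarrow> nat) \<Rightarrow> 'a::comm_semiring_1"
  assumes "i < n"
  shows "poly_eval n D (Dop i \<phi>) x = (\<Sum>\<alpha>\<in>exps_le n (Suc D). \<phi> \<alpha> * (of_nat (\<alpha> i) * mono_eval n (\<alpha>(i := \<alpha> i - 1)) x))"
proof -
  have "(\<Sum>\<alpha>\<in>exps_le n (Suc D). \<phi> \<alpha> * (of_nat (\<alpha> i) * mono_eval n (\<alpha>(i := \<alpha> i - 1)) x))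
      = (\<Sum>\<alpha>\<in>{\<alpha> \<in> exps_le n (Suc D). \<alpha> i \<noteq> 0}. \<phi> \<alpha> * (of_nat (\<alpha> i) * mono_eval n (\<alpha>(i := \<alpha> i - 1)) x))"
    by (rule sum.mono_neutral_right) (auto simp: finite_exps_le)
  also have "\<dots> = poly_eval n D (Dop i \<phi>) x"
    unfolding poly_eval_def
    by (subst sum.reindex_bij_betw[OF exps_le_Suc_shift[OF assms], symmetric])
      (auto intro!: sum.cong simp: Dop_def mult_ac)
  finally show ?thesis by simp
qed

lemma has_vector_derivative_poly_eval:
  fixes \<gamma> :: "real \<Rightarrow> nat \<Rightarrow> 'a::real_normed_field"
  assumes "\<And>j. j < n \<Longrightarrow> ((\<lambda>t. \<gamma> t j) has_vector_derivative y j) (at t)"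
  shows "((\<lambda>t. poly_eval n (Suc D) \<phi> (\<gamma> t)) has_vector_derivative
    (\<Sum>j<n. y j * poly_eval n D (Dop j \<phi>) (\<gamma> t))) (at t)"
proof -
  have pow: "((\<lambda>t. \<gamma> t j ^ k) has_derivative (\<lambda>h. h *\<^sub>R (of_nat k * y j * \<gamma> t j ^ (k - 1)))) (at t)" if "j < n" for j k
    using has_derivative_power[OF assms[OF that, unfolded has_vector_derivative_def], of k]
    by (simp add: mult_ac scaleR_conv_of_real)
  have mono: "((\<lambda>t. mono_eval n \<alpha> (\<gamma> t)) has_vector_derivative
      (\<Sum>j<n. y j * (of_nat (\<alpha> j) * mono_eval n (\<alpha>(j := \<alpha> j - 1)) (\<gamma> t)))) (at t)" for \<alpha>
    unfolding mono_eval_def[of n \<alpha>] has_vector_derivative_def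
    by (rule has_derivative_eq_rhs, rule has_derivative_prod, rule pow)
      (auto simp: fun_eq_iff scaleR_sum_right mono_eval_fun_upd mult_ac
        intro!: sum.cong)
  have "((\<lambda>t. poly_eval n (Suc D) \<phi> (\<gamma> t)) has_vector_derivative
    (\<Sum>\<alpha>\<in>exps_le n (Suc D). \<phi> \<alpha> * (\<Sum>j<n. y j * (of_nat (\<alpha> j) * mono_eval n (\<alpha>(j := \<alpha> j - 1)) (\<gamma> t))))) (at t)"
    unfolding poly_eval_def
    by (intro has_vector_derivative_sum has_vector_derivative_mult_right mono)
  also have "(\<Sum>\<alpha>\<in>exps_le n (Suc D). \<phi> \<alpha> * (\<Sum>j<n. y j * (of_nat (\<alpha> j) * mono_eval n (\<alpha>(j := \<alpha> j - 1)) (\<gamma> t))))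
      = (\<Sum>j<n. y j * poly_eval n D (Dop j \<phi>) (\<gamma> t))"
    by (simp add: poly_eval_Dop sum_distrib_left mult_ac sum.swap[of _ "{..<n}"])
  finally show ?thesis .
qed

text \<open>
  The assumption \<open>closed\<close> holds whenever the real tangent directions of \<open>R\<close> span the complex space;
  it lets a polynomial vanishing on \<open>R\<close> be differentiated down to its constant term.
\<close>

lemma poly_eval_zero_on:
  fixes \<phi> :: "(nat \<Rightarrow> nat) \<Rightarrow> 'a::field_char_0"
  assumes "R \<noteq> {}"
    and closed: "\<And>D \<phi> j x. \<lbrakk>\<And>x. x \<in> R \<Longrightarrow> poly_eval n (Suc D) \<phi> x = 0; j < n; x \<in> R\<rbrakk>
        \<Longrightarrow> poly_eval n D (Dop j \<phi>) x = 0"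
    and "\<And>x. x \<in> R \<Longrightarrow> poly_eval n D \<phi> x = 0" "\<alpha> \<in> exps_le n D"
  shows "\<phi> \<alpha> = 0"
  using assms(3,4)
proof (induction D arbitrary: \<phi> \<alpha>)
  case 0
  have "exps_le n 0 = {\<lambda>_. 0}" by (auto simp: exps_le_def fun_eq_iff) (metis lessThan_iff leI)
  with 0 assms(1) show ?case by (auto simp: poly_eval_def mono_eval_def)
next
  case (Suc D)
  have nz: "\<phi> \<alpha> = 0" if \<alpha>: "\<alpha> \<in> exps_le n (Suc D)" "\<alpha> j \<noteq> 0" for \<alpha> j
  proof -
    have "j < n"
      using \<alpha> by (metis (mono_tags, lifting) exps_le_def mem_Collect_eq not_le)
    then obtain \<beta> where \<beta>: "\<beta> \<in> exps_le n D" "\<alpha> = \<beta>(j := \<beta> j + 1)"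
      using exps_le_Suc_shift[of j n D] \<alpha> by (auto simp: bij_betw_def)
    have "Dop j \<phi> \<beta> = 0"
      by (rule Suc.IH[OF _ \<beta>(1)]) (use closed[OF Suc.prems(1) \<open>j < n\<close>] in auto)
    then show ?thesis by (simp add: Dop_def \<beta>(2) del: of_nat_Suc)
  qed
  have "\<phi> (\<lambda>_. 0) = 0"
  proof -
    obtain x where "x \<in> R" using assms(1) by blast
    have "poly_eval n (Suc D) \<phi> x = (\<Sum>\<alpha>\<in>{\<lambda>_. 0}. \<phi> \<alpha> * mono_eval n \<alpha> x)"
      unfolding poly_eval_def
    proof (rule sum.mono_neutral_right[OF finite_exps_le])
      show "{\<lambda>_. 0} \<subseteq> exps_le n (Suc D)" by (simp add: exps_le_def)
      show "\<forall>\<alpha>\<in>exps_le n (Suc D) - {\<lambda>_. 0}. \<phi> \<alpha> * mono_eval n \<alpha> x = 0"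
      proof
        fix \<alpha> assume \<alpha>: "\<alpha> \<in> exps_le n (Suc D) - {\<lambda>_. 0}"
        then obtain j where "\<alpha> j \<noteq> 0" by blast
        then have "\<phi> \<alpha> = 0" using nz \<alpha> by blast
        then show "\<phi> \<alpha> * mono_eval n \<alpha> x = 0" by simp
      qed
    qed
    with Suc.prems(1)[OF \<open>x \<in> R\<close>] show ?thesis by (simp add: mono_eval_def)
  qed
  moreover have "\<alpha> = (\<lambda>_. 0) \<or> (\<exists>j. \<alpha> j \<noteq> 0)" by auto
  ultimately show ?case using nz Suc.prems(2) by blast
qed

section \<open>Weyl algebra relations and the sl2-triple\<close>

lemma Dop_Xop: "Dop i (Xop j \<phi>) = (\<lambda>\<beta>. Xop j (Dop i \<phi>) \<beta> + (if i = j then \<phi> \<beta> else (0::'a::comm_ring_1)))"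
  by (auto simp: Dop_def Xop_def fun_eq_iff fun_upd_twist fun_upd_idem algebra_simps)

lemma Dop_commute: "Dop i (Dop j \<phi>) = Dop j (Dop i (\<phi> :: _ \<Rightarrow> 'a::comm_ring_1))"
  by (cases "i = j") (auto simp: Dop_def fun_eq_iff fun_upd_twist mult_ac)

lemma Xop_commute: "Xop i (Xop j \<phi>) = Xop j (Xop i (\<phi> :: _ \<Rightarrow> 'a::comm_ring_1))"
  by (cases "i = j") (auto simp: Xop_def fun_eq_iff fun_upd_twist)

text \<open>The operator x_a d/dx_b. These are the matrix units of gl_n acting on polynomials, with
  the familiar commutators.\<close>

definition XD :: "nat \<Rightarrow> nat \<Rightarrow> ((nat \<Rightarrow> nat) \<Rightarrow> 'a::comm_ring_1) \<Rightarrow> (nat \<Rightarrow> nat) \<Rightarrow> 'a" where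
  "XD a b \<phi> = Xop a (Dop b \<phi>)"

lemma XD_commutator:
  "XD a b (XD c d \<phi>) \<alpha> - XD c d (XD a b \<phi>) \<alpha> =
    (if b = c then XD a d \<phi> \<alpha> else 0) - (if a = d then XD c b \<phi> \<alpha> else 0)"
proof -
  have X: "Xop a (\<lambda>\<beta>. f \<beta> + g \<beta>) \<alpha> = Xop a f \<alpha> + Xop a g \<alpha>" for a and f g :: "_ \<Rightarrow> 'a"
    by (simp add: Xop_def)
  have 1: "XD a b (XD c d \<phi>) \<alpha> = Xop a (Xop c (Dop b (Dop d \<phi>))) \<alpha> + (if b = c then XD a d \<phi> \<alpha> else 0)" for a b c d
    unfolding XD_def Dop_Xop by (simp add: X) (simp add: Xop_def)
  show ?thesis
    unfolding 1 by (simp add: Xop_commute[of a c] Dop_commute[of b d])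
qed

lemma XD_linear:
  "XD a b (\<lambda>\<beta>. f \<beta> + g \<beta>) \<alpha> = XD a b f \<alpha> + XD a b g \<alpha>"
  "XD a b (\<lambda>\<beta>. c * f \<beta>) \<alpha> = c * XD a b f \<alpha>"
  "XD a b (\<lambda>\<beta>. \<Sum>k\<in>K. h k \<beta>) \<alpha> = (\<Sum>k\<in>K. XD a b (h k) \<alpha>)"
  by (auto simp: XD_def Xop_def Dop_def algebra_simps sum_distrib_left)

lemma XD_same: "XD a a \<phi> \<alpha> = of_nat (\<alpha> a) * \<phi> \<alpha>"
  by (auto simp: XD_def Xop_def Dop_def)

text \<open>The raising operator of sl2 on binary sextics with coefficients divided by binomials:
  each term replaces a factor x_j, of weight j - 3, by x_(j+1).\<close>

definition raise :: "((nat \<Rightarrow> nat) \<Rightarrow> 'a::comm_ring_1) \<Rightarrow> (nat \<Rightarrow> nat) \<Rightarrow> 'a" where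
  "raise \<phi> \<alpha> = (\<Sum>j<6. of_nat (6 - j) * XD (Suc j) j \<phi> \<alpha>)"

definition lower :: "((nat \<Rightarrow> nat) \<Rightarrow> 'a::comm_ring_1) \<Rightarrow> (nat \<Rightarrow> nat) \<Rightarrow> 'a" where
  "lower \<phi> \<alpha> = (\<Sum>j<6. of_nat (Suc j) * XD j (Suc j) \<phi> \<alpha>)"

definition weight :: "(nat \<Rightarrow> nat) \<Rightarrow> int" where
  "weight \<alpha> = (\<Sum>j<7. (int j - 3) * int (\<alpha> j))"

text \<open>The sl2 relation [E, F] = H, with H twice the weight. Only the terms b = a of the double
  sum have nonzero commutator, and collecting them multiplies \<open>\<alpha> j\<close> by j (7 - j)
  - (j + 1) (6 - j) = 2 (j - 3).\<close>

lemma raise_lower: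
  "raise (lower \<phi>) \<alpha> = lower (raise \<phi>) \<alpha> + 2 * of_int (weight \<alpha>) * (\<phi> \<alpha> :: 'a::comm_ring_1)"
proof -
  have "raise (lower \<phi>) \<alpha> - lower (raise \<phi>) \<alpha> =
    (\<Sum>a<6. \<Sum>b<6. of_nat (6 - a) * of_nat (Suc b) * (XD (Suc a) a (XD b (Suc b) \<phi>) \<alpha> - XD b (Suc b) (XD (Suc a) a \<phi>) \<alpha>))"
  proof -
    have "raise (lower \<phi>) \<alpha> = (\<Sum>a<6. \<Sum>b<6. of_nat (6 - a) * of_nat (Suc b) * XD (Suc a) a (XD b (Suc b) \<phi>) \<alpha>)"
      unfolding raise_def lower_def[abs_def] XD_linear sum_distrib_left mult.assoc ..
    moreover have "lower (raise \<phi>) \<alpha> = (\<Sum>b<6. \<Sum>a<6. of_nat (6 - a) * of_nat (Suc b) * XD b (Suc b) (XD (Suc a) a \<phi>) \<alpha>)"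
      unfolding lower_def raise_def[abs_def] XD_linear sum_distrib_left
      by (intro sum.cong refl) (simp only: mult_ac)
    ultimately show ?thesis
      by (subst (asm) (2) sum.swap) (simp only: sum_subtractf[symmetric] right_diff_distrib)
  qed
  also have "\<dots> = (\<Sum>a<6. of_nat (6 - a) * of_nat (Suc a) * (XD (Suc a) (Suc a) \<phi> \<alpha> - XD a a \<phi> \<alpha>))"
  proof (rule sum.cong[OF refl])
    fix a :: nat assume "a \<in> {..<6}"
    have "(\<Sum>b<6. of_nat (6 - a) * of_nat (Suc b) * (XD (Suc a) a (XD b (Suc b) \<phi>) \<alpha> - XD b (Suc b) (XD (Suc a) a \<phi>) \<alpha>))
      = (\<Sum>b<6. if b = a then of_nat (6 - a) * of_nat (Suc a) * (XD (Suc a) (Suc a) \<phi> \<alpha> - XD a a \<phi> \<alpha>) else (0::'a))"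
      by (intro sum.cong refl) (auto simp: XD_commutator)
    then show "(\<Sum>b<6. of_nat (6 - a) * of_nat (Suc b) * (XD (Suc a) a (XD b (Suc b) \<phi>) \<alpha> - XD b (Suc b) (XD (Suc a) a \<phi>) \<alpha>))
      = of_nat (6 - a) * of_nat (Suc a) * (XD (Suc a) (Suc a) \<phi> \<alpha> - XD a a \<phi> \<alpha>)"
      using \<open>a \<in> _\<close> by simp
  qed
  also have "\<dots> = 2 * of_int (weight \<alpha>) * \<phi> \<alpha>"
    by (simp add: XD_same weight_def lessThan_nat_numeral lessThan_Suc algebra_simps flip: numeral_2_eq_2)
  finally show ?thesis by (simp add: algebra_simps)
qed

section \<open>An inner product on forms of degree d\<close>

definition hexps :: "nat \<Rightarrow> (nat \<Rightarrow> nat) set" where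
  "hexps d = {\<alpha>. (\<forall>j\<ge>7. \<alpha> j = 0) \<and> (\<Sum>j<7. \<alpha> j) = d}"

lemma finite_hexps: "finite (hexps d)"
  by (rule finite_subset[OF _ finite_exps_le[of 7 d]]) (auto simp: hexps_def exps_le_def)

text \<open>
  With these weights the monomials are orthogonal for an inner product that makes \<^const>\<open>raise\<close> and
  \<^const>\<open>lower\<close> adjoint.
\<close>

definition sl2_norm :: "nat \<Rightarrow> real" where
  "sl2_norm j = fact j * fact (6 - j)"

definition monomial_norm :: "(nat \<Rightarrow> nat) \<Rightarrow> real" where
  "monomial_norm \<alpha> = (\<Prod>j<7. fact (\<alpha> j) * sl2_norm j ^ \<alpha> j)"

definition ip :: "nat \<Rightarrow> ((nat \<Rightarrow> nat) \<Rightarrow> real) \<Rightarrow> ((nat \<Rightarrow> nat) \<Rightarrow> real) \<Rightarrow> real" where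
  "ip d u v = (\<Sum>\<alpha>\<in>hexps d. monomial_norm \<alpha> * (u \<alpha> * v \<alpha>))"

lemma sl2_norm_pos [simp]: "sl2_norm j > 0"
  by (simp add: sl2_norm_def)

lemma mono_norm_pos [simp]: "monomial_norm \<alpha> > 0"
  by (simp add: monomial_norm_def prod_pos)

lemma XD_eq:
  assumes "a \<noteq> b"
  shows "XD a b \<phi> \<alpha> = (if \<alpha> a = 0 then 0 else of_nat (\<alpha> b + 1) * \<phi> (\<alpha>(a := \<alpha> a - 1, b := \<alpha> b + 1)))"
  using assms by (simp add: XD_def Xop_def Dop_def)

lemma hexps_move:
  assumes "a \<noteq> b" "a < 7" "b < 7"
  shows "bij_betw (\<lambda>\<alpha>. \<alpha>(a := \<alpha> a - 1, b := \<alpha> b + 1)) {\<alpha> \<in> hexps d. \<alpha> a \<noteq> 0} {\<beta> \<in> hexps d. \<beta> b \<noteq> 0}"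
proof -
  have s: "(\<Sum>j<7. \<alpha> j) = \<alpha> a + (\<alpha> b + (\<Sum>j\<in>{..<7} - {a} - {b}. \<alpha> j))" for \<alpha> :: "nat \<Rightarrow> nat"
    using assms by (simp add: sum.remove[of "{..<7}" a] sum.remove[of "{..<7} - {a}" b])
  have s1: "(\<Sum>j<7. (\<alpha>(a := x, b := y)) j) = x + (y + (\<Sum>j\<in>{..<7} - {a} - {b}. \<alpha> j))"
    and s2: "(\<Sum>j<7. (\<alpha>(b := y, a := x)) j) = x + (y + (\<Sum>j\<in>{..<7} - {a} - {b}. \<alpha> j))" for \<alpha> :: "nat \<Rightarrow> nat" and x y
  proof -
    have "(\<Sum>j\<in>{..<7} - {a} - {b}. (\<alpha>(a := x, b := y)) j) = (\<Sum>j\<in>{..<7} - {a} - {b}. \<alpha> j)"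
      by (rule sum.cong) auto
    then show "(\<Sum>j<7. (\<alpha>(a := x, b := y)) j) = x + (y + (\<Sum>j\<in>{..<7} - {a} - {b}. \<alpha> j))"
      using assms by (subst s) simp
    then show "(\<Sum>j<7. (\<alpha>(b := y, a := x)) j) = x + (y + (\<Sum>j\<in>{..<7} - {a} - {b}. \<alpha> j))"
      using assms by (metis fun_upd_twist)
  qed
  show ?thesis
  proof (rule bij_betw_byWitness[where f' = "\<lambda>\<alpha>. \<alpha>(b := \<alpha> b - 1, a := \<alpha> a + 1)"])
    show "(\<lambda>\<alpha>. \<alpha>(a := \<alpha> a - 1, b := \<alpha> b + 1)) ` {\<alpha> \<in> hexps d. \<alpha> a \<noteq> 0} \<subseteq> {\<beta> \<in> hexps d. \<beta> b \<noteq> 0}"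
    proof (intro subsetI, elim imageE CollectE conjE, intro CollectI conjI)
      fix \<alpha> \<beta> assume \<alpha>: "\<alpha> \<in> hexps d" "\<alpha> a \<noteq> 0" "\<beta> = \<alpha>(a := \<alpha> a - 1, b := \<alpha> b + 1)"
      show "\<beta> \<in> hexps d"
        unfolding \<alpha>(3) hexps_def mem_Collect_eq s1 using \<alpha>(1,2) assms s[of \<alpha>] by (auto simp: hexps_def)
      show "\<beta> b \<noteq> 0" using \<alpha>(3) by simp
    qed
    show "(\<lambda>\<alpha>. \<alpha>(b := \<alpha> b - 1, a := \<alpha> a + 1)) ` {\<beta> \<in> hexps d. \<beta> b \<noteq> 0} \<subseteq> {\<alpha> \<in> hexps d. \<alpha> a \<noteq> 0}"
    proof (intro subsetI, elim imageE CollectE conjE, intro CollectI conjI)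
      fix \<alpha> \<beta> assume \<alpha>: "\<alpha> \<in> hexps d" "\<alpha> b \<noteq> 0" "\<beta> = \<alpha>(b := \<alpha> b - 1, a := \<alpha> a + 1)"
      show "\<beta> \<in> hexps d"
        unfolding \<alpha>(3) hexps_def mem_Collect_eq s2 using \<alpha>(1,2) assms s[of \<alpha>] by (auto simp: hexps_def)
      show "\<beta> a \<noteq> 0" using \<alpha>(3) by simp
    qed
  qed (use assms in \<open>auto simp: fun_eq_iff\<close>)
qed

lemma mono_norm_move:
  assumes "a \<noteq> b" "a < 7" "b < 7" "\<alpha> a \<noteq> 0"
  shows "monomial_norm \<alpha> * real (\<alpha> b + 1) * sl2_norm b =
    monomial_norm (\<alpha>(a := \<alpha> a - 1, b := \<alpha> b + 1)) * real (\<alpha> a) * sl2_norm a"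
proof -
  let ?r = "\<lambda>\<alpha>. \<Prod>j\<in>{..<7} - {a} - {b}. fact (\<alpha> j) * sl2_norm j ^ \<alpha> j"
  have s: "monomial_norm \<alpha> = fact (\<alpha> a) * sl2_norm a ^ \<alpha> a * (fact (\<alpha> b) * sl2_norm b ^ \<alpha> b * ?r \<alpha>)" for \<alpha>
    unfolding monomial_norm_def using assms
    by (simp add: prod.remove[of "{..<7}" a] prod.remove[of "{..<7} - {a}" b])
  have r: "?r (\<alpha>(a := x, b := y)) = ?r \<alpha>" for x y
    by (rule prod.cong) auto
  obtain k where k: "\<alpha> a = Suc k" using assms(4) not0_implies_Suc by blast
  show ?thesis unfolding s r using assms by (simp add: k)
qed

text \<open>Reindexing along the bijection that moves one unit of exponent from \<open>a\<close> to
  \<open>b\<close> exchanges the two operators; \<open>mono_norm_move\<close> accounts for the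
  change of \<open>monomial_norm\<close>.\<close>

lemma XD_adjoint:
  assumes "a \<noteq> b" "a < 7" "b < 7"
  shows "ip d (XD a b u) v = sl2_norm a / sl2_norm b * ip d u (XD b a v)"
proof -
  have "ip d (XD a b u) v = (\<Sum>\<alpha>\<in>{\<alpha> \<in> hexps d. \<alpha> a \<noteq> 0}. monomial_norm \<alpha> * (XD a b u \<alpha> * v \<alpha>))"
    unfolding ip_def by (rule sum.mono_neutral_right) (auto simp: finite_hexps XD_eq assms)
  also have "\<dots> = (\<Sum>\<alpha>\<in>{\<alpha> \<in> hexps d. \<alpha> a \<noteq> 0}. sl2_norm a / sl2_norm b *
      (monomial_norm (\<alpha>(a := \<alpha> a - 1, b := \<alpha> b + 1)) * (u (\<alpha>(a := \<alpha> a - 1, b := \<alpha> b + 1))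
        * XD b a v (\<alpha>(a := \<alpha> a - 1, b := \<alpha> b + 1)))))"
  proof (rule sum.cong[OF refl])
    fix \<alpha> assume \<alpha>: "\<alpha> \<in> {\<alpha> \<in> hexps d. \<alpha> a \<noteq> 0}"
    then have "XD b a v (\<alpha>(a := \<alpha> a - 1, b := \<alpha> b + 1)) = real (\<alpha> a) * v \<alpha>"
      using assms by (simp add: XD_eq fun_upd_twist fun_upd_idem)
    moreover have "monomial_norm \<alpha> * real (\<alpha> b + 1) =
        sl2_norm a / sl2_norm b * (monomial_norm (\<alpha>(a := \<alpha> a - 1, b := \<alpha> b + 1)) * real (\<alpha> a))"
      using mono_norm_move[of a b \<alpha>] assms \<alpha> less_imp_neq[OF sl2_norm_pos[of b]]
      by (simp add: divide_simps mult_ac)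
    moreover have "XD a b u \<alpha> = real (\<alpha> b + 1) * u (\<alpha>(a := \<alpha> a - 1, b := \<alpha> b + 1))"
      using \<alpha> assms by (simp add: XD_eq)
    ultimately show "monomial_norm \<alpha> * (XD a b u \<alpha> * v \<alpha>) = sl2_norm a / sl2_norm b *
      (monomial_norm (\<alpha>(a := \<alpha> a - 1, b := \<alpha> b + 1)) * (u (\<alpha>(a := \<alpha> a - 1, b := \<alpha> b + 1))
        * XD b a v (\<alpha>(a := \<alpha> a - 1, b := \<alpha> b + 1))))"
      by (simp only:) algebra
  qed
  also have "\<dots> = (\<Sum>\<beta>\<in>{\<beta> \<in> hexps d. \<beta> b \<noteq> 0}. sl2_norm a / sl2_norm b *
      (monomial_norm \<beta> * (u \<beta> * XD b a v \<beta>)))"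
    by (rule sum.reindex_bij_betw[OF hexps_move[OF assms]])
  also have "\<dots> = sl2_norm a / sl2_norm b * ip d u (XD b a v)"
    unfolding ip_def sum_distrib_left
    by (rule sum.mono_neutral_left) (use assms in \<open>auto simp: finite_hexps XD_eq\<close>)
  finally show ?thesis .
qed

lemma lower_adjoint: "ip d (lower u) v = ip d u (raise v)"
proof -
  have "ip d (lower u) v = (\<Sum>j<6. real (Suc j) * ip d (XD j (Suc j) u) v)"
    by (simp add: ip_def lower_def sum_distrib_left sum_distrib_right mult_ac sum.swap[of _ "hexps d"])
  also have "\<dots> = (\<Sum>j<6. real (6 - j) * ip d u (XD (Suc j) j v))"
  proof (rule sum.cong[OF refl])
    fix j :: nat assume j: "j \<in> {..<6}"
    then obtain k where k: "6 - j = Suc k" "6 - Suc j = k" by (cases "6 - j") auto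
    \<comment> \<open>The weights j! (6 - j)! are chosen for this ratio (6 - j)/(j + 1), which
      converts the coefficient in \<open>lower\<close> into that in \<open>raise\<close>.\<close>
    have 1: "real (Suc j) * (sl2_norm j / sl2_norm (Suc j)) = real (6 - j)"
      unfolding sl2_norm_def k fact_Suc by (simp del: of_nat_Suc)
    have 2: "ip d (XD j (Suc j) u) v = sl2_norm j / sl2_norm (Suc j) * ip d u (XD (Suc j) j v)"
      using j by (intro XD_adjoint) auto
    show "real (Suc j) * ip d (XD j (Suc j) u) v = real (6 - j) * ip d u (XD (Suc j) j v)"
      unfolding 2 1[symmetric] by (simp only: mult.assoc)
  qed
  also have "\<dots> = ip d u (raise v)"
    by (simp add: ip_def raise_def sum_distrib_left mult_ac sum.swap[of _ "hexps d"])
  finally show ?thesis .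
qed

text \<open>
  Pairing with \<open>u\<close> gives \<open>0 = \<parallel>raise u\<parallel>\<^sup>2 + 2 \<parallel>u\<parallel>\<^sup>2\<close>.
\<close>

lemma raise_lower_injective_real:
  fixes u :: "(nat \<Rightarrow> nat) \<Rightarrow> real"
  assumes "\<And>\<alpha>. \<alpha> \<in> hexps d \<Longrightarrow> u \<alpha> \<noteq> 0 \<Longrightarrow> weight \<alpha> = 1"
    and "\<And>\<alpha>. \<alpha> \<in> hexps d \<Longrightarrow> raise (lower u) \<alpha> = 0" "\<alpha> \<in> hexps d"
  shows "u \<alpha> = 0"
proof -
  have "0 = ip d (raise (lower u)) u" by (simp add: ip_def assms(2))
  also have "\<dots> = ip d (lower (raise u)) u + 2 * ip d u u"
    unfolding ip_def sum_distrib_left sum.distrib[symmetric]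
  proof (rule sum.cong[OF refl])
    fix \<alpha> assume "\<alpha> \<in> hexps d"
    show "monomial_norm \<alpha> * (raise (lower u) \<alpha> * u \<alpha>) =
        monomial_norm \<alpha> * (lower (raise u) \<alpha> * u \<alpha>) + 2 * (monomial_norm \<alpha> * (u \<alpha> * u \<alpha>))"
    proof (cases "u \<alpha> = 0")
      case False
      then have "weight \<alpha> = 1" using assms(1) \<open>\<alpha> \<in> hexps d\<close> by blast
      then have "raise (lower u) \<alpha> = lower (raise u) \<alpha> + 2 * u \<alpha>"
        using raise_lower[of u \<alpha>] by simp
      then show ?thesis by (simp add: algebra_simps)
    qed simp
  qed
  finally have "ip d (lower (raise u)) u + 2 * ip d u u = 0" by simp
  moreover have "ip d (lower (raise u)) u = ip d (raise u) (raise u)" by (rule lower_adjoint)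
  moreover have nn: "monomial_norm \<alpha> * (v \<alpha> * v \<alpha>) \<ge> 0" for \<alpha> and v :: "_ \<Rightarrow> real"
    by (intro mult_nonneg_nonneg less_imp_le[OF mono_norm_pos] zero_le_square)
  moreover have "ip d v v \<ge> 0" for v
    unfolding ip_def by (intro sum_nonneg nn)
  ultimately have "ip d u u = 0" by (smt (verit))
  then have "monomial_norm \<alpha> * (u \<alpha> * u \<alpha>) = 0"
    unfolding ip_def using sum_nonneg_0[of "hexps d" "\<lambda>\<alpha>. monomial_norm \<alpha> * (u \<alpha> * u \<alpha>)" \<alpha>] finite_hexps nn assms(3) by blast
  then show ?thesis using mono_norm_pos[of \<alpha>] by simp
qed

lemma Re_XD: "Re (XD a b \<phi> \<alpha>) = XD a b (\<lambda>\<alpha>. Re (\<phi> \<alpha>)) \<alpha>"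
  and Im_XD: "Im (XD a b \<phi> \<alpha>) = XD a b (\<lambda>\<alpha>. Im (\<phi> \<alpha>)) \<alpha>"
  by (simp_all add: XD_def Xop_def Dop_def)

lemma Re_raise_lower: "Re (raise (lower \<phi>) \<alpha>) = raise (lower (\<lambda>\<alpha>. Re (\<phi> \<alpha>))) \<alpha>"
  and Im_raise_lower: "Im (raise (lower \<phi>) \<alpha>) = raise (lower (\<lambda>\<alpha>. Im (\<phi> \<alpha>))) \<alpha>"
  by (simp_all add: raise_def lower_def[abs_def] Re_XD Im_XD del: of_nat_Suc)

text \<open>The positivity argument is over the reals; \<open>raise\<close> and \<open>lower\<close>
  have integer coefficients, so real and imaginary parts can be treated separately.\<close>

lemma raise_lower_injective:
  fixes u :: "(nat \<Rightarrow> nat) \<Rightarrow> complex"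
  assumes "\<And>\<alpha>. \<alpha> \<in> hexps d \<Longrightarrow> u \<alpha> \<noteq> 0 \<Longrightarrow> weight \<alpha> = 1"
    and "\<And>\<alpha>. \<alpha> \<in> hexps d \<Longrightarrow> raise (lower u) \<alpha> = 0" "\<alpha> \<in> hexps d"
  shows "u \<alpha> = 0"
proof (rule complex_eqI)
  show "Re (u \<alpha>) = Re 0"
    using raise_lower_injective_real[of d "\<lambda>\<alpha>. Re (u \<alpha>)" \<alpha>] assms
    by (simp add: Re_raise_lower[symmetric]) (metis zero_complex.simps(1))
  show "Im (u \<alpha>) = Im 0"
    using raise_lower_injective_real[of d "\<lambda>\<alpha>. Im (u \<alpha>)" \<alpha>] assms
    by (simp add: Im_raise_lower[symmetric]) (metis zero_complex.simps(2))
qed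

text \<open>Elimination, by induction on the equations: equation \<open>k\<close> is solved for an
  unknown \<open>i0\<close> with nonzero coefficient, so one equation and one unknown disappear and
  the inequality persists.\<close>

lemma homogeneous_system_nontrivial_solution:
  fixes a :: "'i \<Rightarrow> 'j \<Rightarrow> 'a::field"
  assumes "finite J" "finite I" "card J < card I"
  shows "\<exists>c. (\<exists>i\<in>I. c i \<noteq> 0) \<and> (\<forall>j\<in>J. (\<Sum>i\<in>I. c i * a i j) = 0)"
  using assms
proof (induction J arbitrary: I a rule: finite_induct)
  case empty
  then have "I \<noteq> {}" by auto
  then show ?case by (intro exI[of _ "\<lambda>_. 1"]) auto
next
  case (insert k J)
  show ?case
  proof (cases "\<forall>i\<in>I. a i k = 0")
    case True
    then show ?thesis using insert.IH[of I a] insert.prems insert.hyps by auto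
  next
    case False
    then obtain i0 where i0: "i0 \<in> I" "a i0 k \<noteq> 0" by blast
    let ?I = "I - {i0}"
    have "card J < card ?I" using insert.prems insert.hyps i0 by simp
    then obtain c where c: "\<exists>i\<in>?I. c i \<noteq> 0"
        "\<forall>j\<in>J. (\<Sum>i\<in>?I. c i * (a i j - a i k / a i0 k * a i0 j)) = 0"
      using insert.IH[of ?I "\<lambda>i j. a i j - a i k / a i0 k * a i0 j"] insert.prems by blast
    define c' where "c' = c(i0 := - (\<Sum>i\<in>?I. c i * a i k) / a i0 k)"
    have split: "(\<Sum>i\<in>I. c' i * a i j) = (\<Sum>i\<in>?I. c i * a i j) - (\<Sum>i\<in>?I. c i * a i k) / a i0 k * a i0 j" for j
    proof -
      have "(\<Sum>i\<in>I. c' i * a i j) = c' i0 * a i0 j + (\<Sum>i\<in>?I. c' i * a i j)"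
        using i0 insert.prems by (simp add: sum.remove)
      also have "(\<Sum>i\<in>?I. c' i * a i j) = (\<Sum>i\<in>?I. c i * a i j)"
        by (rule sum.cong) (auto simp: c'_def)
      finally show ?thesis by (simp add: c'_def)
    qed
    have "(\<Sum>i\<in>I. c' i * a i k) = 0"
      unfolding split using i0 by simp
    moreover have "(\<Sum>i\<in>I. c' i * a i j) = 0" if "j \<in> J" for j
      unfolding split using c(2) that
      by (simp add: right_diff_distrib sum_subtractf sum_divide_distrib sum_distrib_right sum_distrib_left mult_ac)
    moreover have "\<exists>i\<in>I. c' i \<noteq> 0" using c(1) by (auto simp: c'_def)
    ultimately show ?thesis by auto
  qed
qed

definition mono_indicator :: "(nat \<Rightarrow> nat) \<Rightarrow> (nat \<Rightarrow> nat) \<Rightarrow> 'a::comm_ring_1" where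
  "mono_indicator \<beta> \<alpha> = (if \<alpha> = \<beta> then 1 else 0)"

lemma raise_linear:
  "raise (\<lambda>\<alpha>. \<phi> \<alpha> + \<psi> \<alpha>) \<alpha> = raise \<phi> \<alpha> + raise \<psi> \<alpha>"
  "raise (\<lambda>\<alpha>. \<Sum>k\<in>K. c k * h k \<alpha>) \<alpha> = (\<Sum>k\<in>K. c k * raise (h k) \<alpha>)"
  unfolding raise_def XD_linear
  by (simp_all add: distrib_left sum.distrib sum_distrib_left mult_ac sum.swap[of _ K] del: of_nat_Suc)

lemma lower_linear:
  "lower (\<lambda>\<alpha>. \<Sum>k\<in>K. c k * h k \<alpha>) \<alpha> = (\<Sum>k\<in>K. c k * lower (h k) \<alpha>)"
  unfolding lower_def XD_linear
  by (simp_all add: distrib_left sum.distrib sum_distrib_left mult_ac sum.swap[of _ K] del: of_nat_Suc)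

lemma weight_move:
  assumes "j < 6" "\<alpha> j \<noteq> 0"
  shows "weight (\<alpha>(j := \<alpha> j - 1, Suc j := \<alpha> (Suc j) + 1)) = weight \<alpha> + 1"
proof -
  have s: "weight \<alpha> = (int j - 3) * int (\<alpha> j) + ((int (Suc j) - 3) * int (\<alpha> (Suc j))
      + (\<Sum>i\<in>{..<7} - {j} - {Suc j}. (int i - 3) * int (\<alpha> i)))" for \<alpha>
    unfolding weight_def using assms(1)
    by (simp add: sum.remove[of "{..<7}" j] sum.remove[of "{..<7} - {j}" "Suc j"])
  have r: "(\<Sum>i\<in>{..<7} - {j} - {Suc j}. (int i - 3) * int ((\<alpha>(j := \<alpha> j - 1, Suc j := \<alpha> (Suc j) + 1)) i))
      = (\<Sum>i\<in>{..<7} - {j} - {Suc j}. (int i - 3) * int (\<alpha> i))"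
    by (rule sum.cong) auto
  show ?thesis
    unfolding s[of "\<alpha>(j := \<alpha> j - 1, Suc j := \<alpha> (Suc j) + 1)"] r s[of \<alpha>]
    using assms(2) by (simp add: of_nat_diff algebra_simps)
qed

lemma hexps_of_move:
  assumes "j < 6" "\<alpha> j \<noteq> 0" "\<alpha>(j := \<alpha> j - 1, Suc j := \<alpha> (Suc j) + 1) \<in> hexps d"
  shows "\<alpha> \<in> hexps d"
proof -
  let ?\<beta> = "\<alpha>(j := \<alpha> j - 1, Suc j := \<alpha> (Suc j) + 1)"
  have "?\<beta>(Suc j := ?\<beta> (Suc j) - 1, j := ?\<beta> j + 1) = \<alpha>"
    using assms(2) by (auto simp: fun_eq_iff)
  moreover have "?\<beta>(Suc j := ?\<beta> (Suc j) - 1, j := ?\<beta> j + 1) \<in> hexps d"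
    using bij_betw_apply[OF hexps_move[of "Suc j" j d], of ?\<beta>] assms by simp
  ultimately show ?thesis by simp
qed

lemma lower_support:
  assumes "\<And>\<alpha>. \<phi> \<alpha> \<noteq> 0 \<Longrightarrow> \<alpha> \<in> hexps d \<and> weight \<alpha> = w" "lower \<phi> \<alpha> \<noteq> 0"
  shows "\<alpha> \<in> hexps d \<and> weight \<alpha> = w - 1"
proof -
  obtain j where j: "j < 6" "XD j (Suc j) \<phi> \<alpha> \<noteq> 0"
  proof -
    have "\<exists>j\<in>{..<6}. of_nat (Suc j) * XD j (Suc j) \<phi> \<alpha> \<noteq> 0"
      using assms(2) unfolding lower_def by (meson sum.neutral)
    then show thesis using that by (metis lessThan_iff mult_zero_right)
  qed
  then have 1: "\<alpha> j \<noteq> 0" "\<phi> (\<alpha>(j := \<alpha> j - 1, Suc j := \<alpha> (Suc j) + 1)) \<noteq> 0"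
    by (auto simp: XD_eq split: if_splits)
  let ?\<beta> = "\<alpha>(j := \<alpha> j - 1, Suc j := \<alpha> (Suc j) + 1)"
  have "?\<beta> \<in> hexps d" "weight ?\<beta> = w" using assms(1)[OF 1(2)] by blast+
  moreover have "weight ?\<beta> = weight \<alpha> + 1" by (rule weight_move[of j \<alpha>, OF j(1) 1(1)])
  moreover have "\<alpha> \<in> hexps d" if "?\<beta> \<in> hexps d" by (rule hexps_of_move[of j \<alpha> d, OF j(1) 1(1) that])
  ultimately show ?thesis by linarith
qed

text \<open>
  The images under \<^const>\<open>lower\<close> of the monomials of weight 1 are independent modulo the kernel of
  \<^const>\<open>raise\<close>, so they take up their share of the dimension of the space of weight 0.
\<close>

lemma raise_kernel_dependent:
  fixes \<psi> :: "'i \<Rightarrow> (nat \<Rightarrow> nat) \<Rightarrow> complex"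
  assumes supp: "\<And>i \<alpha>. i \<in> I \<Longrightarrow> \<psi> i \<alpha> \<noteq> 0 \<Longrightarrow> \<alpha> \<in> hexps d \<and> weight \<alpha> = 0"
    and ker: "\<And>i \<alpha>. i \<in> I \<Longrightarrow> raise (\<psi> i) \<alpha> = 0"
    and I: "finite I" "card {\<alpha> \<in> hexps d. weight \<alpha> = 0} < card I + card {\<alpha> \<in> hexps d. weight \<alpha> = 1}"
  shows "\<exists>c. (\<exists>i\<in>I. c i \<noteq> 0) \<and> (\<forall>\<alpha>. (\<Sum>i\<in>I. c i * \<psi> i \<alpha>) = 0)"
proof -
  let ?A = "{\<alpha> \<in> hexps d. weight \<alpha> = 0}" and ?B = "{\<alpha> \<in> hexps d. weight \<alpha> = 1}"
  \<comment> \<open>The unknowns are coefficients of two kinds: of the given kernel elements, and of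
    the images under \<open>lower\<close> of the monomials of weight 1.\<close>
  let ?a = "case_sum \<psi> (\<lambda>\<beta>. lower (mono_indicator \<beta>))"
  have finB: "finite ?B" by (simp add: finite_hexps)
  have "card ?A < card (I <+> ?B)"
    using I finB by (simp add: card_Plus)
  then obtain c where c: "\<exists>i\<in>I <+> ?B. c i \<noteq> 0" "\<forall>\<alpha>\<in>?A. (\<Sum>i\<in>I <+> ?B. c i * ?a i \<alpha>) = 0"
    using homogeneous_system_nontrivial_solution[of ?A "I <+> ?B" ?a] I(1) finB
    by (auto simp: finite_hexps)
  define b where "b = (\<lambda>\<alpha>. \<Sum>\<beta>\<in>?B. c (Inr \<beta>) * mono_indicator \<beta> \<alpha>)"
  have b_eq: "b \<alpha> = (if \<alpha> \<in> ?B then c (Inr \<alpha>) else 0)" for \<alpha>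
    using finB by (simp add: b_def mono_indicator_def if_distrib[of "\<lambda>x. _ * x"] cong: if_cong)
  have lowb: "lower b \<alpha> = (\<Sum>\<beta>\<in>?B. c (Inr \<beta>) * lower (mono_indicator \<beta>) \<alpha>)" for \<alpha>
    unfolding b_def by (rule lower_linear)
  have eq: "(\<Sum>i\<in>I. c (Inl i) * \<psi> i \<alpha>) + lower b \<alpha> = 0" for \<alpha>
  proof (cases "\<alpha> \<in> ?A")
    case True
    then show ?thesis
      using c(2) I(1) finB unfolding lowb by (auto simp: sum.Plus comp_def)
  next
    case False
    then have "\<psi> i \<alpha> = 0" if "i \<in> I" for i using supp that by blast
    moreover have "lower b \<alpha> = 0"
    proof (rule ccontr)
      assume "lower b \<alpha> \<noteq> 0"
      moreover have "\<beta> \<in> hexps d \<and> weight \<beta> = 1" if "b \<beta> \<noteq> 0" for \<beta>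
        using that by (auto simp: b_eq split: if_splits)
      ultimately have "\<alpha> \<in> hexps d \<and> weight \<alpha> = 1 - 1" by (intro lower_support[of b d 1 \<alpha>])
      with False show False by simp
    qed
    ultimately show ?thesis by simp
  qed
  \<comment> \<open>By \<open>eq\<close>, \<open>lower b\<close> is minus a combination of kernel
    elements, so \<open>raise\<close> kills it. Injectivity then gives \<open>b = 0\<close> in
    degree d, and the nontrivial relation involves the kernel elements alone.\<close>
  have "raise (lower b) \<alpha> = 0" for \<alpha>
  proof -
    have "0 = raise (\<lambda>\<alpha>. (\<Sum>i\<in>I. c (Inl i) * \<psi> i \<alpha>) + lower b \<alpha>) \<alpha>"
      unfolding eq using raise_linear(2)[of "\<lambda>_. 0" "\<lambda>_ _. 0" "{}" \<alpha>] by simp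
    then show ?thesis unfolding raise_linear using ker by simp
  qed
  then have b0: "b \<alpha> = 0" if "\<alpha> \<in> hexps d" for \<alpha>
  proof (intro raise_lower_injective[of d b \<alpha>] that)
    show "weight \<beta> = 1" if "b \<beta> \<noteq> 0" for \<beta> using that by (auto simp: b_eq split: if_splits)
  qed
  then have cb: "c (Inr \<beta>) = 0" if "\<beta> \<in> ?B" for \<beta>
    using that b_eq[of \<beta>] b0[of \<beta>] by simp
  then have "\<exists>i\<in>I. c (Inl i) \<noteq> 0" using c(1) by auto
  moreover have "lower b = (\<lambda>_. 0)"
    unfolding lowb using cb by auto
  ultimately show ?thesis using eq by (intro exI[of _ "\<lambda>i. c (Inl i)"]) auto
qed

section \<open>Weight coordinates on the tensor space\<close>

text \<open>
  The entries of a symmetric tensor depend only on how many indices are 1 and how many are 2; the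
  arguments of \<open>St33_of\<close> are the entries 111, 112, 113, 122, 123, 222, 223.
\<close>

definition sym_tensor :: "(nat \<Rightarrow> nat \<Rightarrow> real) \<Rightarrow> tensor333" where
  "sym_tensor h = (\<chi> i j k. h (of_bool (i = 1) + of_bool (j = 1) + of_bool (k = 1))
     (of_bool (i = 2) + of_bool (j = 2) + of_bool (k = 2)))"

definition St33_of :: "real \<Rightarrow> real \<Rightarrow> real \<Rightarrow> real \<Rightarrow> real \<Rightarrow> real \<Rightarrow> real \<Rightarrow> tensor333" where
  "St33_of a b c d e f g = sym_tensor (\<lambda>p q.
     if p = 3 then a else if p = 2 \<and> q = 1 then b else if p = 2 then c
     else if p = 1 \<and> q = 2 then d else if p = 1 \<and> q = 1 then e else if p = 1 then - a - d
     else if q = 3 then f else if q = 2 then g else if q = 1 then - b - f else - c - g)"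

lemma St33_of_nth:
  "St33_of a b c d e f g $ i $ j $ k = (let p = of_bool (i = 1) + of_bool (j = 1) + of_bool (k = 1) :: nat;
     q = of_bool (i = 2) + of_bool (j = 2) + of_bool (k = 2) :: nat in
     if p = 3 then a else if p = 2 \<and> q = 1 then b else if p = 2 then c
     else if p = 1 \<and> q = 2 then d else if p = 1 \<and> q = 1 then e else if p = 1 then - a - d
     else if q = 3 then f else if q = 2 then g else if q = 1 then - b - f else - c - g)"
  by (simp add: St33_of_def sym_tensor_def)

lemma St33_of_entries [simp]:
  "St33_of a b c d e f g $ 1 $ 1 $ 1 = a"
  "St33_of a b c d e f g $ 1 $ 1 $ 2 = b" "St33_of a b c d e f g $ 1 $ 2 $ 1 = b" "St33_of a b c d e f g $ 2 $ 1 $ 1 = b"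
  "St33_of a b c d e f g $ 1 $ 1 $ 3 = c" "St33_of a b c d e f g $ 1 $ 3 $ 1 = c" "St33_of a b c d e f g $ 3 $ 1 $ 1 = c"
  "St33_of a b c d e f g $ 1 $ 2 $ 2 = d" "St33_of a b c d e f g $ 2 $ 1 $ 2 = d" "St33_of a b c d e f g $ 2 $ 2 $ 1 = d"
  "St33_of a b c d e f g $ 1 $ 2 $ 3 = e" "St33_of a b c d e f g $ 1 $ 3 $ 2 = e" "St33_of a b c d e f g $ 2 $ 1 $ 3 = e"
  "St33_of a b c d e f g $ 2 $ 3 $ 1 = e" "St33_of a b c d e f g $ 3 $ 1 $ 2 = e" "St33_of a b c d e f g $ 3 $ 2 $ 1 = e"
  "St33_of a b c d e f g $ 1 $ 3 $ 3 = - a - d" "St33_of a b c d e f g $ 3 $ 1 $ 3 = - a - d" "St33_of a b c d e f g $ 3 $ 3 $ 1 = - a - d"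
  "St33_of a b c d e f g $ 2 $ 2 $ 2 = f"
  "St33_of a b c d e f g $ 2 $ 2 $ 3 = g" "St33_of a b c d e f g $ 2 $ 3 $ 2 = g" "St33_of a b c d e f g $ 3 $ 2 $ 2 = g"
  "St33_of a b c d e f g $ 2 $ 3 $ 3 = - b - f" "St33_of a b c d e f g $ 3 $ 2 $ 3 = - b - f" "St33_of a b c d e f g $ 3 $ 3 $ 2 = - b - f"
  "St33_of a b c d e f g $ 3 $ 3 $ 3 = - c - g"
  by (simp_all add: St33_of_nth Let_def)

lemma St33_of_in [simp]: "St33_of a b c d e f g \<in> St33"
  by (simp add: St33_def forall_3 sum_3)

lemma St33_cases:
  assumes "T \<in> St33"
  obtains a b c d e f g where "T = St33_of a b c d e f g"
proof -
  have s: "T$i$j$k = T$i$k$j" "T$i$j$k = T$j$i$k" for i j k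
    using assms by (auto simp: St33_def)
  have t: "T$1$1$j + T$2$2$j + T$3$3$j = 0" for j
    using assms unfolding St33_def sum_3 by blast
  have t': "T$1$3$3 = - T$1$1$1 - T$1$2$2" "T$2$3$3 = - T$1$1$2 - T$2$2$2" "T$3$3$3 = - T$1$1$3 - T$2$2$3"
    using t[of 1] t[of 2] t[of 3] by (simp_all add: s)
  show thesis
    by (rule that[of "T$1$1$1" "T$1$1$2" "T$1$1$3" "T$1$2$2" "T$1$2$3" "T$2$2$2" "T$2$2$3"])
      (simp add: vec_eq_iff forall_3 s t')
qed

text \<open>
  With \<open>m = e\<^sub>1 + \<i> e\<^sub>2\<close> the first four coordinates are \<open>T(m,m,m)\<close>, \<open>T(m,m,e\<^sub>3)\<close>,
  \<open>T(m,e\<^sub>3,e\<^sub>3)\<close>, \<open>T(e\<^sub>3,e\<^sub>3,e\<^sub>3)\<close>; together they are the coefficients, divided by binomials, of the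
  binary sextic obtained by restricting \<open>T\<close> to the isotropic vectors
  \<open>m + 2 s e\<^sub>3 - s\<^sup>2 cnj m\<close>. The signs and factors are those for which the rotation about the first axis
  acts as a multiple of \<^const>\<open>raise\<close> plus \<^const>\<open>lower\<close>.
\<close>

definition coord :: "tensor333 \<Rightarrow> nat \<Rightarrow> complex" where
  "coord T j = [Complex (T$1$1$1 - 3 * T$1$2$2) (3 * T$1$1$2 - T$2$2$2),
     Complex (T$1$1$3 - T$2$2$3) (2 * T$1$2$3), Complex (T$1$3$3) (T$2$3$3), Complex (T$3$3$3) 0,
     Complex (- (T$1$3$3)) (T$2$3$3), Complex (T$1$1$3 - T$2$2$3) (- 2 * T$1$2$3),
     Complex (- (T$1$1$1 - 3 * T$1$2$2)) (3 * T$1$1$2 - T$2$2$2)] ! j"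

lemma less_7_cases: "j < 7 \<longleftrightarrow> j = 0 \<or> j = 1 \<or> j = 2 \<or> j = 3 \<or> j = 4 \<or> j = 5 \<or> j = (6::nat)"
  by auto

lemma sum_lessThan_7: "(\<Sum>j<7. f j) = f 0 + f 1 + f 2 + f 3 + f 4 + f 5 + f (6::nat)"
  by (simp add: lessThan_nat_numeral lessThan_Suc ac_simps flip: numeral_2_eq_2)

lemma coord_add: "j < 7 \<Longrightarrow> coord (T + t *\<^sub>R T') j = coord T j + t *\<^sub>R coord T' j"
  by (auto simp: coord_def less_7_cases complex_eq_iff algebra_simps)

lemma coord_form:
  shows "coord T 4 = - cnj (coord T 2)" "coord T 5 = cnj (coord T 1)" "coord T 6 = - cnj (coord T 0)"
    "Im (coord T 3) = 0"
  by (auto simp: coord_def complex_eq_iff)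

text \<open>The seven tensors form the real basis dual to the real and imaginary parts of
  coordinates 0 to 2 and to the real coordinate 3.\<close>

lemma St33_basis_expansion:
  assumes "T \<in> St33"
  shows "T = Re (coord T 0) *\<^sub>R St33_of (1/4) 0 0 (-1/4) 0 0 0 + Im (coord T 0) *\<^sub>R St33_of 0 (1/4) 0 0 0 (-1/4) 0
    + Re (coord T 1) *\<^sub>R St33_of 0 0 (1/2) 0 0 0 (-1/2) + Im (coord T 1) *\<^sub>R St33_of 0 0 0 0 (1/2) 0 0
    + Re (coord T 2) *\<^sub>R St33_of (-3/4) 0 0 (-1/4) 0 0 0 + Im (coord T 2) *\<^sub>R St33_of 0 (-1/4) 0 0 0 (-3/4) 0
    + Re (coord T 3) *\<^sub>R St33_of 0 0 (-1/2) 0 0 0 (-1/2)"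
proof -
  obtain a b c d e f g where T: "T = St33_of a b c d e f g" using St33_cases[OF assms] .
  show ?thesis
    unfolding T by (simp add: vec_eq_iff forall_3 coord_def) (simp add: field_simps)
qed


text \<open>Because of \<open>coord_form\<close>, real tensors do not fill complex 7-space, but
  their directions span it over the complex numbers. So all partial derivatives of a polynomial
  vanishing on them vanish there as well.\<close>

lemma poly_eval_coord_zero:
  fixes \<phi> :: "(nat \<Rightarrow> nat) \<Rightarrow> complex"
  assumes "\<And>T. T \<in> St33 \<Longrightarrow> poly_eval 7 D \<phi> (coord T) = 0" "\<alpha> \<in> exps_le 7 D"
  shows "\<phi> \<alpha> = 0"
proof (rule poly_eval_zero_on[where R = "coord ` St33" and n = 7 and D = D and \<alpha> = \<alpha>])
  show "coord ` St33 \<noteq> {}" using subspace_0[OF subspace_St33] by blast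
  show "poly_eval 7 D \<phi> x = 0" if "x \<in> coord ` St33" for x using assms(1) that by blast
  show "\<alpha> \<in> exps_le 7 D" by fact
next
  fix D and \<phi> :: "(nat \<Rightarrow> nat) \<Rightarrow> complex" and j :: nat and x
  assume z: "\<And>x. x \<in> coord ` St33 \<Longrightarrow> poly_eval 7 (Suc D) \<phi> x = 0" and j: "j < 7" and "x \<in> coord ` St33"
  then obtain T where T: "T \<in> St33" "x = coord T" by blast
  let ?d = "\<lambda>j. poly_eval 7 D (Dop j \<phi>) x"
  have d: "(\<Sum>j<7. coord T' j * ?d j) = 0" if "T' \<in> St33" for T'
  proof -
    have "((\<lambda>t. poly_eval 7 (Suc D) \<phi> (coord (T + t *\<^sub>R T'))) has_vector_derivative
        (\<Sum>j<7. coord T' j * poly_eval 7 D (Dop j \<phi>) (coord (T + 0 *\<^sub>R T')))) (at 0)"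
    proof (rule has_vector_derivative_poly_eval[where \<gamma> = "\<lambda>t. coord (T + t *\<^sub>R T')" and y = "coord T'"])
      fix j :: nat assume "j < 7"
      then show "((\<lambda>t. coord (T + t *\<^sub>R T') j) has_vector_derivative coord T' j) (at 0)"
        unfolding coord_add[OF \<open>j < 7\<close>] by (auto intro!: derivative_eq_intros)
    qed
    moreover have "coord (T + t *\<^sub>R T') \<in> coord ` St33" for t
      using T(1) that subspace_St33 by (intro imageI subspace_add subspace_scale)
    ultimately have "((\<lambda>t::real. 0) has_vector_derivative (\<Sum>j<7. coord T' j * ?d j)) (at 0)"
      by (simp add: z T(2))
    then show ?thesis
      using has_vector_derivative_const vector_derivative_unique_at by metis
  qed
  have i: "\<i> * \<i> = -1" by simp
  \<comment> \<open>Each pair 0/6, 1/5, 2/4 of conjugate coordinates receives one equation from a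
    real and one from an imaginary direction; their relative signs differ, so both derivatives are
    0.\<close>
  have "?d 0 = ?d 6" "\<i> * ?d 0 = - \<i> * ?d 6" "?d 1 = - ?d 5" "\<i> * ?d 1 = \<i> * ?d 5"
      "?d 2 = ?d 4" "\<i> * ?d 2 = - \<i> * ?d 4" "?d 3 = 0"
    using d[of "St33_of (1/4) 0 0 (-1/4) 0 0 0"] d[of "St33_of 0 (1/4) 0 0 0 (-1/4) 0"]
      d[of "St33_of 0 0 (1/2) 0 0 0 (-1/2)"] d[of "St33_of 0 0 0 0 (1/2) 0 0"]
      d[of "St33_of (-3/4) 0 0 (-1/4) 0 0 0"] d[of "St33_of 0 (-1/4) 0 0 0 (-3/4) 0"]
      d[of "St33_of 0 0 (-1/2) 0 0 0 (-1/2)"]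
    by (simp_all add: sum_lessThan_7 coord_def Complex_eq)
  then have "?d 0 = 0" "?d 1 = 0" "?d 2 = 0" "?d 3 = 0" "?d 4 = 0" "?d 5 = 0" "?d 6 = 0"
    by (simp_all add: complex_eq_iff)
  then show "poly_eval 7 D (Dop j \<phi>) x = 0" using j by (auto simp: less_7_cases)
qed


lemma poly_eval_Xop:
  fixes \<psi> :: "(nat \<Rightarrow> nat) \<Rightarrow> 'a::comm_ring_1"
  assumes "i < n"
  shows "poly_eval n (Suc D) (Xop i \<psi>) x = x i * poly_eval n D \<psi> x"
proof -
  have "poly_eval n (Suc D) (Xop i \<psi>) x =
      (\<Sum>\<alpha>\<in>{\<alpha> \<in> exps_le n (Suc D). \<alpha> i \<noteq> 0}. Xop i \<psi> \<alpha> * mono_eval n \<alpha> x)"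
    unfolding poly_eval_def by (rule sum.mono_neutral_right) (auto simp: finite_exps_le Xop_def)
  also have "\<dots> = (\<Sum>\<beta>\<in>exps_le n D. Xop i \<psi> (\<beta>(i := \<beta> i + 1)) * mono_eval n (\<beta>(i := \<beta> i + 1)) x)"
    by (rule sum.reindex_bij_betw[OF exps_le_Suc_shift[OF assms], symmetric])
  also have "\<dots> = (\<Sum>\<beta>\<in>exps_le n D. x i * (\<psi> \<beta> * mono_eval n \<beta> x))"
  proof (rule sum.cong[OF refl])
    fix \<beta>
    have "mono_eval n (\<beta>(i := \<beta> i + 1)) x = x i * mono_eval n (\<beta>(i := \<beta> i)) x"
      unfolding mono_eval_fun_upd[OF assms] by simp
    then show "Xop i \<psi> (\<beta>(i := \<beta> i + 1)) * mono_eval n (\<beta>(i := \<beta> i + 1)) x = x i * (\<psi> \<beta> * mono_eval n \<beta> x)"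
      by (simp add: Xop_def mult_ac)
  qed
  finally show ?thesis by (simp add: poly_eval_def sum_distrib_left)
qed

lemma poly_eval_linear:
  "poly_eval n D (\<lambda>\<alpha>. f \<alpha> + g \<alpha>) x = poly_eval n D f x + poly_eval n D g x"
  "poly_eval n D (\<lambda>\<alpha>. c * f \<alpha>) x = c * poly_eval n D f x"
  "poly_eval n D (\<lambda>\<alpha>. \<Sum>k\<in>K. h k \<alpha>) x = (\<Sum>k\<in>K. poly_eval n D (h k) x)"
  by (simp_all add: poly_eval_def distrib_right sum.distrib sum_distrib_left sum_distrib_right mult.assoc
      sum.swap[of _ K])

lemma raise_support:
  assumes supp: "\<And>\<alpha>. \<phi> \<alpha> \<noteq> 0 \<Longrightarrow> \<alpha> \<in> hexps d \<and> weight \<alpha> = w" and "raise \<phi> \<alpha> \<noteq> 0"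
  shows "\<alpha> \<in> hexps d \<and> weight \<alpha> = w + 1"
proof -
  obtain j where j: "j < 6" "XD (Suc j) j \<phi> \<alpha> \<noteq> 0"
  proof -
    have "\<exists>j\<in>{..<6}. of_nat (6 - j) * XD (Suc j) j \<phi> \<alpha> \<noteq> 0"
      using assms(2) unfolding raise_def by (meson sum.neutral)
    then show thesis using that by (metis lessThan_iff mult_zero_right)
  qed
  define \<beta> where "\<beta> = \<alpha>(Suc j := \<alpha> (Suc j) - 1, j := \<alpha> j + 1)"
  have "\<alpha> (Suc j) \<noteq> 0" "\<phi> \<beta> \<noteq> 0"
    using j(2) by (auto simp: XD_eq \<beta>_def split: if_splits)
  then have \<beta>: "\<beta> \<in> hexps d" "weight \<beta> = w" "\<beta> j \<noteq> 0" "\<alpha> = \<beta>(j := \<beta> j - 1, Suc j := \<beta> (Suc j) + 1)"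
    using supp[of \<beta>] by (auto simp: \<beta>_def fun_eq_iff)
  have "\<alpha> \<in> hexps d"
    unfolding \<beta>(4) using bij_betw_apply[OF hexps_move[of j "Suc j" d], of \<beta>] \<beta>(1,3) j(1) by simp
  moreover have "weight \<alpha> = w + 1"
    unfolding \<beta>(4) \<beta>(2)[symmetric] by (rule weight_move[of j \<beta>, OF j(1) \<beta>(3)])
  ultimately show ?thesis ..
qed

section \<open>Infinitesimal rotations in weight coordinates\<close>

lemma tensor_act_mat_1 [simp]: "tensor_act (mat 1) T = T"
  by (simp add: tensor_act_def vec_eq_iff mat_def if_distrib[of "\<lambda>x. x * _"] if_distrib[of "\<lambda>x. _ * x"] cong: if_cong)

lemma sum_of_bool_mult_3: "(\<Sum>c\<in>UNIV. of_bool (k = c) * F c) = F k" for k :: 3 and F :: "3 \<Rightarrow> real"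
  using exhaust_3[of k] by (elim disjE) (simp_all add: sum_3)

lemma has_real_derivative_sum:
  assumes "\<And>n. ((\<lambda>t. f t n) has_real_derivative g n) F"
  shows "((\<lambda>t. \<Sum>n\<in>S. f t n) has_real_derivative (\<Sum>n\<in>S. g n)) F"
  using assms by (intro DERIV_sum)

lemma tensor_act_has_derivative:
  assumes "\<And>i a. ((\<lambda>t. R t $ i $ a) has_real_derivative N $ i $ a) (at 0)" "R 0 = mat 1"
  shows "((\<lambda>t. tensor_act (R t) T $ i $ j $ k) has_real_derivative
    (\<Sum>a\<in>UNIV. N$i$a * T$a$j$k + N$j$a * T$i$a$k + N$k$a * T$i$j$a)) (at 0)"
proof -
  have R0: "R 0 $ i $ a = of_bool (i = a)" for i a
    using assms(2) by (simp add: mat_def)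
  have p: "((\<lambda>t. R t $ i $ a * R t $ j $ b * R t $ k $ c * T $ a $ b $ c) has_real_derivative
     (N$i$a * of_bool (j = b) * of_bool (k = c) + of_bool (i = a) * N$j$b * of_bool (k = c)
      + of_bool (i = a) * of_bool (j = b) * N$k$c) * T$a$b$c) (at 0)" for a b c
    by (rule DERIV_cong, rule DERIV_mult, rule DERIV_mult, rule DERIV_mult, rule assms(1), rule assms(1),
        rule assms(1), rule DERIV_const) (simp add: R0 algebra_simps)
  have "((\<lambda>t. tensor_act (R t) T $ i $ j $ k) has_real_derivative
    (\<Sum>a\<in>UNIV. \<Sum>b\<in>UNIV. \<Sum>c\<in>UNIV. (N$i$a * of_bool (j = b) * of_bool (k = c) + of_bool (i = a) * N$j$b * of_bool (k = c)
      + of_bool (i = a) * of_bool (j = b) * N$k$c) * T$a$b$c)) (at 0)"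
    unfolding tensor_act_def vec_lambda_beta by (intro has_real_derivative_sum p)
  moreover have "(\<Sum>a\<in>UNIV. \<Sum>b\<in>UNIV. \<Sum>c\<in>UNIV. (N$i$a * of_bool (j = b) * of_bool (k = c) + of_bool (i = a) * N$j$b * of_bool (k = c)
      + of_bool (i = a) * of_bool (j = b) * N$k$c) * T$a$b$c) =
    (\<Sum>a\<in>UNIV. N$i$a * T$a$j$k + N$j$a * T$i$a$k + N$k$a * T$i$j$a)"
  proof -
    have "(\<Sum>a\<in>UNIV. \<Sum>b\<in>UNIV. \<Sum>c\<in>UNIV. (N$i$a * of_bool (j = b) * of_bool (k = c) + of_bool (i = a) * N$j$b * of_bool (k = c)
      + of_bool (i = a) * of_bool (j = b) * N$k$c) * T$a$b$c) =
      (\<Sum>a\<in>UNIV. N$i$a * (\<Sum>b\<in>UNIV. of_bool (j = b) * (\<Sum>c\<in>UNIV. of_bool (k = c) * T$a$b$c))) +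
      (\<Sum>a\<in>UNIV. of_bool (i = a) * (\<Sum>b\<in>UNIV. N$j$b * (\<Sum>c\<in>UNIV. of_bool (k = c) * T$a$b$c))) +
      (\<Sum>a\<in>UNIV. of_bool (i = a) * (\<Sum>b\<in>UNIV. of_bool (j = b) * (\<Sum>c\<in>UNIV. N$k$c * T$a$b$c)))"
      by (simp only: distrib_right sum.distrib sum_distrib_left mult.assoc)
    then show ?thesis by (simp only: sum_of_bool_mult_3 sum.distrib)
  qed
  ultimately show ?thesis by simp
qed

definition rot_z :: "real \<Rightarrow> real^3^3" where
  "rot_z t = vector [vector [cos t, - sin t, 0], vector [sin t, cos t, 0], vector [0, 0, 1]]"

definition rot_x :: "real \<Rightarrow> real^3^3" where
  "rot_x t = vector [vector [1, 0, 0], vector [0, cos t, - sin t], vector [0, sin t, cos t]]"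

lemma rot_0: "rot_z 0 = mat 1" "rot_x 0 = mat 1"
  by (simp_all add: rot_z_def rot_x_def vec_eq_iff forall_3 vector_3 mat_def)

lemma rot_O3: "rot_z t \<in> O3" "rot_x t \<in> O3"
  by (auto simp: O3_def orthogonal_matrix rot_z_def rot_x_def vec_eq_iff forall_3 sum_3 vector_3
      matrix_matrix_mult_def transpose_def mat_def power2_eq_square[symmetric] algebra_simps)

lemma has_vector_derivative_Complex:
  assumes "(f has_real_derivative a) (at t)" "(g has_real_derivative b) (at t)"
  shows "((\<lambda>t. Complex (f t) (g t)) has_vector_derivative Complex a b) (at t)"
  using assms by (auto simp: has_real_derivative_iff_has_vector_derivative Complex_eq intro!: derivative_eq_intros)

lemma coord_has_vector_derivative:
  assumes "\<And>i j k. ((\<lambda>t. \<gamma> t $ i $ j $ k) has_real_derivative E $ i $ j $ k) (at t)" "l < 7"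
  shows "((\<lambda>t. coord (\<gamma> t) l) has_vector_derivative coord E l) (at t)"
proof -
  have d: "((\<lambda>t. Complex (f t) (g t)) has_vector_derivative z) (at t)"
    if "(f has_real_derivative Re z) (at t)" "(g has_real_derivative Im z) (at t)" for f g z
    using has_vector_derivative_Complex[OF that] by simp
  show ?thesis
    using assms(2) unfolding less_7_cases coord_def
    by (elim disjE) (auto intro!: d derivative_eq_intros assms(1))
qed

definition infinitesimal_act :: "real^3^3 \<Rightarrow> tensor333 \<Rightarrow> tensor333" where
  "infinitesimal_act N T = (\<chi> i j k. \<Sum>a\<in>UNIV. N$i$a * T$a$j$k + N$j$a * T$i$a$k + N$k$a * T$i$j$a)"

definition gen_z :: "real^3^3" where
  "gen_z = vector [vector [0, -1, 0], vector [1, 0, 0], vector [0, 0, 0]]"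

definition gen_x :: "real^3^3" where
  "gen_x = vector [vector [0, 0, 0], vector [0, 0, -1], vector [0, 1, 0]]"

lemma coord_rot_derivative:
  assumes "j < 7"
  shows "((\<lambda>t. coord (tensor_act (rot_z t) T) j) has_vector_derivative coord (infinitesimal_act gen_z T) j) (at 0)"
    and "((\<lambda>t. coord (tensor_act (rot_x t) T) j) has_vector_derivative coord (infinitesimal_act gen_x T) j) (at 0)"
proof -
  have r: "((\<lambda>t. rot_z t $ i $ a) has_real_derivative gen_z $ i $ a) (at 0)"
    "((\<lambda>t. rot_x t $ i $ a) has_real_derivative gen_x $ i $ a) (at 0)" for i a
    using exhaust_3[of i] exhaust_3[of a]
    by (elim disjE; auto simp: rot_z_def gen_z_def rot_x_def gen_x_def vector_3 intro!: derivative_eq_intros)+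
  show "((\<lambda>t. coord (tensor_act (rot_z t) T) j) has_vector_derivative coord (infinitesimal_act gen_z T) j) (at 0)"
    by (rule coord_has_vector_derivative[OF _ assms])
      (use tensor_act_has_derivative[OF r(1) rot_0(1)] in \<open>simp add: infinitesimal_act_def\<close>)
  show "((\<lambda>t. coord (tensor_act (rot_x t) T) j) has_vector_derivative coord (infinitesimal_act gen_x T) j) (at 0)"
    by (rule coord_has_vector_derivative[OF _ assms])
      (use tensor_act_has_derivative[OF r(2) rot_0(2)] in \<open>simp add: infinitesimal_act_def\<close>)
qed

text \<open>The coordinates are, up to sign, values of T on e1 + i e2, its conjugate and e3. These
  are eigenvectors of the rotations about the third axis, so the action is diagonal.\<close>

lemma coord_gen_z:
  assumes "T \<in> St33" "j < 7"
  shows "coord (infinitesimal_act gen_z T) j = - \<i> * (of_int (int j - 3) * coord T j)"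
proof -
  obtain a b c d e f g where T: "T = St33_of a b c d e f g" using St33_cases[OF assms(1)] .
  show ?thesis
    using assms(2) unfolding less_7_cases T
    by (elim disjE) (simp_all add: coord_def infinitesimal_act_def gen_z_def sum_3 vector_3 complex_eq_iff algebra_simps)
qed

lemma coord_gen_x:
  assumes "T \<in> St33" "j < 7"
  shows "coord (infinitesimal_act gen_x T) j =
    - \<i> / 2 * ((if j < 6 then of_nat (6 - j) * coord T (Suc j) else 0) + (if 0 < j then of_nat j * coord T (j - 1) else 0))"
proof -
  obtain a b c d e f g where T: "T = St33_of a b c d e f g" using St33_cases[OF assms(1)] .
  show ?thesis
    using assms(2) unfolding less_7_cases T
    by (elim disjE) (simp_all add: coord_def infinitesimal_act_def gen_x_def sum_3 vector_3 complex_eq_iff field_simps)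
qed

text \<open>Invariance is differentiated along two one-parameter groups. The rotations about the
  third axis multiply each coefficient by its weight, and those about the first give
  \<open>raise \<phi> + lower \<phi> = 0\<close>. The evaluation bound \<open>Suc d\<close>, one
  above the degree, lets the derivative rule apply for d = 0 too.\<close>

lemma invariant_poly_weight_zero_raise:
  fixes \<phi> :: "(nat \<Rightarrow> nat) \<Rightarrow> complex"
  assumes inv: "\<And>g T. g \<in> O3 \<Longrightarrow> T \<in> St33 \<Longrightarrow> f (tensor_act g T) = f T"
    and rep: "\<And>T. T \<in> St33 \<Longrightarrow> f T = poly_eval 7 (Suc d) \<phi> (coord T)"
    and supp: "\<And>\<alpha>. \<phi> \<alpha> \<noteq> 0 \<Longrightarrow> \<alpha> \<in> hexps d"
  shows "\<phi> \<alpha> \<noteq> 0 \<Longrightarrow> weight \<alpha> = 0" and "raise \<phi> \<alpha> = 0"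
proof -
  have hexps_le: "\<alpha> \<in> exps_le 7 (Suc d)" if "\<alpha> \<in> hexps d" for \<alpha>
    using that by (simp add: hexps_def exps_le_def)
  have inf: "(\<Sum>j<7. coord (infinitesimal_act N T) j * poly_eval 7 d (Dop j \<phi>) (coord T)) = 0"
    if T: "T \<in> St33" and R: "\<And>t. R t \<in> O3" "R 0 = mat 1"
      and N: "\<And>j. j < 7 \<Longrightarrow> ((\<lambda>t. coord (tensor_act (R t) T) j) has_vector_derivative coord (infinitesimal_act N T) j) (at 0)"
    for T N and R :: "real \<Rightarrow> real^3^3"
  proof -
    have "((\<lambda>t. poly_eval 7 (Suc d) \<phi> (coord (tensor_act (R t) T))) has_vector_derivative
        (\<Sum>j<7. coord (infinitesimal_act N T) j * poly_eval 7 d (Dop j \<phi>) (coord (tensor_act (R 0) T)))) (at 0)"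
      by (rule has_vector_derivative_poly_eval[where y = "coord (infinitesimal_act N T)"]) (rule N)
    moreover have "poly_eval 7 (Suc d) \<phi> (coord (tensor_act (R t) T)) = f T" for t
      using rep[OF tensor_act_St33[OF R(1) T]] inv[OF R(1) T] by simp
    ultimately have "((\<lambda>t::real. f T) has_vector_derivative
        (\<Sum>j<7. coord (infinitesimal_act N T) j * poly_eval 7 d (Dop j \<phi>) (coord T))) (at 0)"
      by (simp add: R(2))
    then show ?thesis
      using has_vector_derivative_const vector_derivative_unique_at by metis
  qed
  have XD_eval: "poly_eval 7 (Suc d) (XD a b \<phi>) x = x a * poly_eval 7 d (Dop b \<phi>) x" if "a < 7" for a b x
    unfolding XD_def[abs_def] using that by (rule poly_eval_Xop)
  have wt: "of_int (weight \<alpha>) * \<phi> \<alpha> = 0" for \<alpha>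
  proof (cases "\<alpha> \<in> hexps d")
    case True
    have "poly_eval 7 (Suc d) (\<lambda>\<alpha>. of_int (weight \<alpha>) * \<phi> \<alpha>) (coord T) = 0" if T: "T \<in> St33" for T
    proof -
      have "(\<lambda>\<alpha>. of_int (weight \<alpha>) * \<phi> \<alpha>) = (\<lambda>\<alpha>. \<Sum>j<7. of_int (int j - 3) * XD j j \<phi> \<alpha>)"
        by (simp add: XD_same weight_def sum_distrib_right mult.assoc fun_eq_iff)
      then have "poly_eval 7 (Suc d) (\<lambda>\<alpha>. of_int (weight \<alpha>) * \<phi> \<alpha>) (coord T) =
          (\<Sum>j<7. of_int (int j - 3) * (coord T j * poly_eval 7 d (Dop j \<phi>) (coord T)))"
        by (simp only: poly_eval_linear) (auto intro!: sum.cong simp: XD_eval)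
      moreover have "0 = - \<i> * (\<Sum>j<7. of_int (int j - 3) * (coord T j * poly_eval 7 d (Dop j \<phi>) (coord T)))"
        using inf[OF T rot_O3(1) rot_0(1) coord_rot_derivative(1)]
        by (simp add: coord_gen_z[OF T] sum_distrib_left mult.assoc)
      ultimately show ?thesis by simp
    qed
    from poly_eval_coord_zero[OF this hexps_le[OF True]] show ?thesis .
  qed (use supp in auto)
  then have w0: "weight \<alpha> = 0" if "\<phi> \<alpha> \<noteq> 0" for \<alpha>
    using that by (metis mult_eq_0_iff of_int_eq_0_iff)
  then show "weight \<alpha> = 0" if "\<phi> \<alpha> \<noteq> 0"
    using that .
  have supp0: "\<alpha> \<in> hexps d \<and> weight \<alpha> = 0" if "\<phi> \<alpha> \<noteq> 0" for \<alpha>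
    using that supp w0 by blast
  have rl: "raise \<phi> \<alpha> + lower \<phi> \<alpha> = 0" if \<alpha>: "\<alpha> \<in> hexps d" for \<alpha>
  proof -
    have "poly_eval 7 (Suc d) (\<lambda>\<alpha>. raise \<phi> \<alpha> + lower \<phi> \<alpha>) (coord T) = 0" if T: "T \<in> St33" for T
    proof -
      let ?d = "\<lambda>j. poly_eval 7 d (Dop j \<phi>) (coord T)"
      have "poly_eval 7 (Suc d) (\<lambda>\<alpha>. raise \<phi> \<alpha> + lower \<phi> \<alpha>) (coord T) =
          (\<Sum>j<6. of_nat (6 - j) * (coord T (Suc j) * ?d j)) + (\<Sum>j<6. of_nat (Suc j) * (coord T j * ?d (Suc j)))"
        unfolding raise_def lower_def poly_eval_linear
        by (intro arg_cong2[where f = "(+)"] sum.cong refl) (simp_all add: XD_eval del: of_nat_Suc)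
      moreover have "0 = - \<i> / 2 * ((\<Sum>j<6. of_nat (6 - j) * (coord T (Suc j) * ?d j)) + (\<Sum>j<6. of_nat (Suc j) * (coord T j * ?d (Suc j))))"
        using inf[OF T rot_O3(2) rot_0(2) coord_rot_derivative(2)]
        by (simp add: coord_gen_x[OF T] sum_lessThan_7 lessThan_nat_numeral lessThan_Suc algebra_simps flip: numeral_2_eq_2)
      ultimately show ?thesis by simp
    qed
    from poly_eval_coord_zero[OF this hexps_le[OF \<alpha>]] show ?thesis .
  qed
  \<comment> \<open>Only the sum with \<open>lower \<phi>\<close> is known to vanish, but the two
    summands are supported in the different weights 1 and -1.\<close>
  show "raise \<phi> \<alpha> = 0"
  proof (rule ccontr)
    assume nz: "raise \<phi> \<alpha> \<noteq> 0"
    then have 1: "\<alpha> \<in> hexps d \<and> weight \<alpha> = 0 + 1" using supp0 by (intro raise_support)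
    then have "lower \<phi> \<alpha> \<noteq> 0" using rl[of \<alpha>] nz by auto
    then have "\<alpha> \<in> hexps d \<and> weight \<alpha> = 0 - 1" using supp0 by (intro lower_support)
    with 1 show False by simp
  qed
qed

section \<open>The basic invariants of degrees 2, 4, 6 and 10\<close>

definition contract :: "tensor333 \<Rightarrow> (3 \<Rightarrow> 3 \<Rightarrow> real) \<Rightarrow> 3 \<Rightarrow> real" where
  "contract T N i = (\<Sum>j\<in>UNIV. \<Sum>k\<in>UNIV. T$i$j$k * N j k)"

definition gram :: "tensor333 \<Rightarrow> 3 \<Rightarrow> 3 \<Rightarrow> real" where
  "gram T i j = (\<Sum>k\<in>UNIV. \<Sum>l\<in>UNIV. T$i$k$l * T$j$k$l)"

text \<open>A vector v of degree 3 that is rotated along with T. It yields I6 = |v|^2 and I10 = T(v,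
  v, v), of degree 1 + 3 * 3; I2 and I4 are the squared lengths of T and of
  \<open>gram T\<close>.\<close>

definition cov3 :: "tensor333 \<Rightarrow> 3 \<Rightarrow> real" where
  "cov3 T = contract T (gram T)"

definition I2 :: "tensor333 \<Rightarrow> real" where "I2 T = (\<Sum>i\<in>UNIV. gram T i i)"
definition I4 :: "tensor333 \<Rightarrow> real" where "I4 T = (\<Sum>i\<in>UNIV. \<Sum>j\<in>UNIV. gram T i j * gram T i j)"
definition I6 :: "tensor333 \<Rightarrow> real" where "I6 T = (\<Sum>i\<in>UNIV. cov3 T i * cov3 T i)"
definition I10 :: "tensor333 \<Rightarrow> real" where
  "I10 T = (\<Sum>i\<in>UNIV. cov3 T i * contract T (\<lambda>j k. cov3 T j * cov3 T k) i)"

section \<open>Invariance of the contractions under O(3)\<close>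

lemma O3_sum:
  assumes "g \<in> O3"
  shows "(\<Sum>k\<in>UNIV. (\<Sum>b\<in>UNIV. g$k$b * x b) * (\<Sum>b\<in>UNIV. g$k$b * y b)) = (\<Sum>b\<in>UNIV. x b * y b)"
proof -
  have orth: "(\<Sum>i\<in>UNIV. g$i$a * g$i$b) = of_bool (a = b)" for a b
  proof -
    have "(transpose g ** g)$a$b = mat 1$a$b"
      using assms by (simp add: O3_def orthogonal_matrix)
    then show ?thesis by (simp add: matrix_matrix_mult_def transpose_def mat_def)
  qed
  have "(\<Sum>k\<in>UNIV. (\<Sum>b\<in>UNIV. g$k$b * x b) * (\<Sum>b\<in>UNIV. g$k$b * y b)) =
      (\<Sum>k\<in>UNIV. \<Sum>a\<in>UNIV. \<Sum>b\<in>UNIV. x a * (g$k$a * g$k$b * y b))"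
    unfolding sum_product by (simp only: mult_ac)
  also have "\<dots> = (\<Sum>a\<in>UNIV. \<Sum>k\<in>UNIV. \<Sum>b\<in>UNIV. x a * (g$k$a * g$k$b * y b))"
    by (rule sum.swap)
  also have "\<dots> = (\<Sum>a\<in>UNIV. \<Sum>b\<in>UNIV. \<Sum>k\<in>UNIV. x a * (g$k$a * g$k$b * y b))"
    by (rule sum.cong[OF refl]) (rule sum.swap)
  also have "\<dots> = (\<Sum>a\<in>UNIV. x a * (\<Sum>b\<in>UNIV. (\<Sum>k\<in>UNIV. g$k$a * g$k$b) * y b))"
    by (simp only: sum_distrib_left sum_distrib_right)
  finally show ?thesis by (simp only: orth sum_of_bool_mult_3)
qed

lemma O3_sum2:
  assumes "g \<in> O3"
  shows "(\<Sum>j\<in>UNIV. \<Sum>k\<in>UNIV. (\<Sum>b\<in>UNIV. \<Sum>c\<in>UNIV. g$j$b * g$k$c * M b c) * (\<Sum>b\<in>UNIV. \<Sum>c\<in>UNIV. g$j$b * g$k$c * N b c))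
    = (\<Sum>b\<in>UNIV. \<Sum>c\<in>UNIV. M b c * N b c)"
proof -
  have s: "(\<Sum>b\<in>UNIV. \<Sum>c\<in>UNIV. g$j$b * g$k$c * M b c) = (\<Sum>c\<in>UNIV. g$k$c * (\<Sum>b\<in>UNIV. g$j$b * M b c))" for M :: "3 \<Rightarrow> 3 \<Rightarrow> real" and j k
    by (subst sum.swap) (simp only: sum_distrib_left mult_ac)
  have "(\<Sum>j\<in>UNIV. \<Sum>k\<in>UNIV. (\<Sum>b\<in>UNIV. \<Sum>c\<in>UNIV. g$j$b * g$k$c * M b c) * (\<Sum>b\<in>UNIV. \<Sum>c\<in>UNIV. g$j$b * g$k$c * N b c))
    = (\<Sum>j\<in>UNIV. \<Sum>c\<in>UNIV. (\<Sum>b\<in>UNIV. g$j$b * M b c) * (\<Sum>b\<in>UNIV. g$j$b * N b c))"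
    by (simp only: s O3_sum[OF assms])
  also have "\<dots> = (\<Sum>c\<in>UNIV. \<Sum>j\<in>UNIV. (\<Sum>b\<in>UNIV. g$j$b * M b c) * (\<Sum>b\<in>UNIV. g$j$b * N b c))"
    by (rule sum.swap)
  also have "\<dots> = (\<Sum>c\<in>UNIV. \<Sum>b\<in>UNIV. M b c * N b c)"
    by (simp only: O3_sum[OF assms])
  also have "\<dots> = (\<Sum>b\<in>UNIV. \<Sum>c\<in>UNIV. M b c * N b c)" by (rule sum.swap)
  finally show ?thesis .
qed

text \<open>Keeping the first index apart puts the other two into the shape required by
  \<open>O3_sum2\<close>.\<close>

lemma tensor_act_slice:
  "tensor_act g T $ i $ j $ k = (\<Sum>b\<in>UNIV. \<Sum>c\<in>UNIV. g$j$b * g$k$c * (\<Sum>a\<in>UNIV. g$i$a * T$a$b$c))"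
proof -
  have "tensor_act g T $ i $ j $ k = (\<Sum>b\<in>UNIV. \<Sum>a\<in>UNIV. \<Sum>c\<in>UNIV. g$i$a * g$j$b * g$k$c * T$a$b$c)"
    unfolding tensor_act_def vec_lambda_beta by (rule sum.swap)
  also have "\<dots> = (\<Sum>b\<in>UNIV. \<Sum>c\<in>UNIV. \<Sum>a\<in>UNIV. g$i$a * g$j$b * g$k$c * T$a$b$c)"
    by (rule sum.cong[OF refl]) (rule sum.swap)
  finally show ?thesis by (simp only: sum_distrib_left mult_ac)
qed

lemma contract_act:
  assumes "g \<in> O3" "\<And>j k. N' j k = (\<Sum>b\<in>UNIV. \<Sum>c\<in>UNIV. g$j$b * g$k$c * N b c)"
  shows "contract (tensor_act g T) N' i = (\<Sum>a\<in>UNIV. g$i$a * contract T N a)"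
proof -
  have "contract (tensor_act g T) N' i = (\<Sum>b\<in>UNIV. \<Sum>c\<in>UNIV. (\<Sum>a\<in>UNIV. g$i$a * T$a$b$c) * N b c)"
    unfolding contract_def tensor_act_slice assms(2) by (rule O3_sum2[OF assms(1)])
  also have "\<dots> = (\<Sum>b\<in>UNIV. \<Sum>c\<in>UNIV. \<Sum>a\<in>UNIV. g$i$a * (T$a$b$c * N b c))"
    by (simp only: sum_distrib_right mult.assoc)
  also have "\<dots> = (\<Sum>b\<in>UNIV. \<Sum>a\<in>UNIV. \<Sum>c\<in>UNIV. g$i$a * (T$a$b$c * N b c))"
    by (rule sum.cong[OF refl]) (rule sum.swap)
  also have "\<dots> = (\<Sum>a\<in>UNIV. \<Sum>b\<in>UNIV. \<Sum>c\<in>UNIV. g$i$a * (T$a$b$c * N b c))"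
    by (rule sum.swap)
  finally show ?thesis by (simp only: contract_def sum_distrib_left)
qed

lemma gram_act:
  assumes "g \<in> O3"
  shows "gram (tensor_act g T) i j = (\<Sum>a\<in>UNIV. \<Sum>b\<in>UNIV. g$i$a * g$j$b * gram T a b)"
proof -
  have "gram (tensor_act g T) i j = (\<Sum>b\<in>UNIV. \<Sum>c\<in>UNIV. (\<Sum>a\<in>UNIV. g$i$a * T$a$b$c) * (\<Sum>a\<in>UNIV. g$j$a * T$a$b$c))"
    unfolding gram_def tensor_act_slice by (rule O3_sum2[OF assms])
  also have "\<dots> = (\<Sum>b\<in>UNIV. \<Sum>c\<in>UNIV. \<Sum>a\<in>UNIV. \<Sum>a'\<in>UNIV. g$i$a * g$j$a' * (T$a$b$c * T$a'$b$c))"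
    unfolding sum_product by (simp only: mult_ac)
  also have "\<dots> = (\<Sum>b\<in>UNIV. \<Sum>a\<in>UNIV. \<Sum>c\<in>UNIV. \<Sum>a'\<in>UNIV. g$i$a * g$j$a' * (T$a$b$c * T$a'$b$c))"
    by (rule sum.cong[OF refl]) (rule sum.swap)
  also have "\<dots> = (\<Sum>a\<in>UNIV. \<Sum>b\<in>UNIV. \<Sum>c\<in>UNIV. \<Sum>a'\<in>UNIV. g$i$a * g$j$a' * (T$a$b$c * T$a'$b$c))"
    by (rule sum.swap)
  also have "\<dots> = (\<Sum>a\<in>UNIV. \<Sum>b\<in>UNIV. \<Sum>a'\<in>UNIV. \<Sum>c\<in>UNIV. g$i$a * g$j$a' * (T$a$b$c * T$a'$b$c))"
    by (rule sum.cong[OF refl], rule sum.cong[OF refl]) (rule sum.swap)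
  also have "\<dots> = (\<Sum>a\<in>UNIV. \<Sum>a'\<in>UNIV. \<Sum>b\<in>UNIV. \<Sum>c\<in>UNIV. g$i$a * g$j$a' * (T$a$b$c * T$a'$b$c))"
    by (rule sum.cong[OF refl]) (rule sum.swap)
  finally show ?thesis by (simp only: gram_def sum_distrib_left)
qed

lemma cov3_act:
  assumes "g \<in> O3"
  shows "cov3 (tensor_act g T) i = (\<Sum>a\<in>UNIV. g$i$a * cov3 T a)"
  unfolding cov3_def using assms gram_act[OF assms] by (rule contract_act)

lemma I_invariant:
  assumes "g \<in> O3"
  shows "I2 (tensor_act g T) = I2 T" "I4 (tensor_act g T) = I4 T"
    "I6 (tensor_act g T) = I6 T" "I10 (tensor_act g T) = I10 T"
proof -
  have I2: "I2 T = (\<Sum>i\<in>UNIV. \<Sum>k\<in>UNIV. \<Sum>l\<in>UNIV. T$i$k$l * T$i$k$l)" for T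
    by (simp add: I2_def gram_def)
  show "I2 (tensor_act g T) = I2 T"
  proof -
    have "I2 (tensor_act g T) = (\<Sum>i\<in>UNIV. \<Sum>b\<in>UNIV. \<Sum>c\<in>UNIV. (\<Sum>a\<in>UNIV. g$i$a * T$a$b$c) * (\<Sum>a\<in>UNIV. g$i$a * T$a$b$c))"
      unfolding I2 tensor_act_slice by (rule sum.cong[OF refl], rule O3_sum2[OF assms])
    also have "\<dots> = (\<Sum>b\<in>UNIV. \<Sum>i\<in>UNIV. \<Sum>c\<in>UNIV. (\<Sum>a\<in>UNIV. g$i$a * T$a$b$c) * (\<Sum>a\<in>UNIV. g$i$a * T$a$b$c))"
      by (rule sum.swap)
    also have "\<dots> = (\<Sum>b\<in>UNIV. \<Sum>c\<in>UNIV. \<Sum>i\<in>UNIV. (\<Sum>a\<in>UNIV. g$i$a * T$a$b$c) * (\<Sum>a\<in>UNIV. g$i$a * T$a$b$c))"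
      by (rule sum.cong[OF refl]) (rule sum.swap)
    also have "\<dots> = (\<Sum>b\<in>UNIV. \<Sum>c\<in>UNIV. \<Sum>a\<in>UNIV. T$a$b$c * T$a$b$c)"
      by (simp only: O3_sum[OF assms])
    also have "\<dots> = (\<Sum>b\<in>UNIV. \<Sum>a\<in>UNIV. \<Sum>c\<in>UNIV. T$a$b$c * T$a$b$c)"
      by (rule sum.cong[OF refl]) (rule sum.swap)
    also have "\<dots> = I2 T" unfolding I2 by (rule sum.swap)
    finally show ?thesis .
  qed
  show "I4 (tensor_act g T) = I4 T"
    unfolding I4_def gram_act[OF assms] by (rule O3_sum2[OF assms])
  show "I6 (tensor_act g T) = I6 T"
    unfolding I6_def cov3_act[OF assms] by (rule O3_sum[OF assms])
  have "contract (tensor_act g T) (\<lambda>j k. cov3 (tensor_act g T) j * cov3 (tensor_act g T) k) i =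
      (\<Sum>a\<in>UNIV. g$i$a * contract T (\<lambda>j k. cov3 T j * cov3 T k) a)" for i
    by (rule contract_act[OF assms]) (simp only: cov3_act[OF assms] sum_product mult_ac)
  then show "I10 (tensor_act g T) = I10 T"
    unfolding I10_def cov3_act[OF assms] by (simp only: O3_sum[OF assms])
qed

section \<open>Homogeneous polynomials and their expansion in weight coordinates\<close>

lemma hom_poly_fun_zero: "hom_poly_fun d (\<lambda>x. 0)"
proof (induction d)
  case 0 show ?case by (rule hom_poly_fun.const)
next
  case (Suc d)
  show ?case using hom_poly_fun.mult[OF Suc hom_poly_fun.linear[OF bounded_linear_zero]] by simp
qed

lemma hom_poly_fun_sum:
  "(\<And>i. hom_poly_fun d (\<lambda>x. f x i)) \<Longrightarrow> hom_poly_fun d (\<lambda>x. \<Sum>i\<in>S. f x i)"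
  by (induction S rule: infinite_finite_induct) (auto intro: hom_poly_fun_zero hom_poly_fun.add)

lemma hom_poly_fun_power: "hom_poly_fun d f \<Longrightarrow> hom_poly_fun (d * n) (\<lambda>x. f x ^ n)"
proof (induction n)
  case 0 then show ?case using hom_poly_fun.const[of 1] by simp
next
  case (Suc n)
  then show ?case using hom_poly_fun.mult[of d f "d * n" "\<lambda>x. f x ^ n"] by simp
qed

lemma hom_poly_fun_entry: "hom_poly_fun 1 (\<lambda>T::tensor333. T$i$j$k)"
  by (rule hom_poly_fun.linear, rule bounded_linear_compose[OF bounded_linear_vec_nth
      bounded_linear_compose[OF bounded_linear_vec_nth bounded_linear_vec_nth]])

lemma hom_poly_fun_mult:
  "hom_poly_fun d f \<Longrightarrow> hom_poly_fun e g \<Longrightarrow> d + e = k \<Longrightarrow> hom_poly_fun k (\<lambda>x. f x * g x)"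
  using hom_poly_fun.mult by blast

lemma hom_poly_fun_gram: "hom_poly_fun 2 (\<lambda>T. gram T i j)"
  unfolding gram_def
  by (intro hom_poly_fun_sum, rule hom_poly_fun_mult[OF hom_poly_fun_entry hom_poly_fun_entry]) simp

lemma hom_poly_fun_cov3: "hom_poly_fun 3 (\<lambda>T. cov3 T i)"
  unfolding cov3_def contract_def
  by (intro hom_poly_fun_sum, rule hom_poly_fun_mult[OF hom_poly_fun_entry hom_poly_fun_gram]) simp

lemma hom_poly_fun_I:
  "hom_poly_fun 2 I2" "hom_poly_fun 4 I4" "hom_poly_fun 6 I6" "hom_poly_fun 10 I10"
proof -
  show "hom_poly_fun 2 I2"
    unfolding I2_def[abs_def] by (intro hom_poly_fun_sum hom_poly_fun_gram)
  show "hom_poly_fun 4 I4"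
    unfolding I4_def[abs_def]
    by (intro hom_poly_fun_sum, rule hom_poly_fun_mult[OF hom_poly_fun_gram hom_poly_fun_gram]) simp
  show "hom_poly_fun 6 I6"
    unfolding I6_def[abs_def]
    by (intro hom_poly_fun_sum, rule hom_poly_fun_mult[OF hom_poly_fun_cov3 hom_poly_fun_cov3]) simp
  have c: "hom_poly_fun 6 (\<lambda>T. cov3 T j * cov3 T k)" for j k
    by (rule hom_poly_fun_mult[OF hom_poly_fun_cov3 hom_poly_fun_cov3]) simp
  have "hom_poly_fun 7 (\<lambda>T. contract T (\<lambda>j k. cov3 T j * cov3 T k) i)" for i
    unfolding contract_def
    by (intro hom_poly_fun_sum, rule hom_poly_fun_mult[OF hom_poly_fun_entry c]) simp
  then show "hom_poly_fun 10 I10"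
    unfolding I10_def[abs_def]
    by (intro hom_poly_fun_sum, rule_tac hom_poly_fun_mult[OF hom_poly_fun_cov3]) simp_all
qed

definition hpoly :: "nat \<Rightarrow> (tensor333 \<Rightarrow> complex) \<Rightarrow> bool" where
  "hpoly d f \<longleftrightarrow> (\<exists>\<phi>. \<forall>T\<in>St33. f T = (\<Sum>\<alpha>\<in>hexps d. \<phi> \<alpha> * mono_eval 7 \<alpha> (coord T)))"

lemma hpoly_add: "hpoly d f \<Longrightarrow> hpoly d g \<Longrightarrow> hpoly d (\<lambda>T. f T + g T)"
  unfolding hpoly_def
proof (elim exE)
  fix \<phi> \<psi> assume "\<forall>T\<in>St33. f T = (\<Sum>\<alpha>\<in>hexps d. \<phi> \<alpha> * mono_eval 7 \<alpha> (coord T))"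
    "\<forall>T\<in>St33. g T = (\<Sum>\<alpha>\<in>hexps d. \<psi> \<alpha> * mono_eval 7 \<alpha> (coord T))"
  then show "\<exists>\<phi>. \<forall>T\<in>St33. f T + g T = (\<Sum>\<alpha>\<in>hexps d. \<phi> \<alpha> * mono_eval 7 \<alpha> (coord T))"
    by (intro exI[of _ "\<lambda>\<alpha>. \<phi> \<alpha> + \<psi> \<alpha>"]) (simp add: distrib_right sum.distrib)
qed

lemma hpoly_cmult: "hpoly d f \<Longrightarrow> hpoly d (\<lambda>T. c * f T)"
  unfolding hpoly_def
proof (elim exE)
  fix \<phi> assume "\<forall>T\<in>St33. f T = (\<Sum>\<alpha>\<in>hexps d. \<phi> \<alpha> * mono_eval 7 \<alpha> (coord T))"
  then show "\<exists>\<phi>. \<forall>T\<in>St33. c * f T = (\<Sum>\<alpha>\<in>hexps d. \<phi> \<alpha> * mono_eval 7 \<alpha> (coord T))"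
    by (intro exI[of _ "\<lambda>\<alpha>. c * \<phi> \<alpha>"]) (simp add: sum_distrib_left mult.assoc)
qed

lemma hpoly_cong: "hpoly d f \<Longrightarrow> (\<And>T. T \<in> St33 \<Longrightarrow> f T = g T) \<Longrightarrow> hpoly d g"
  unfolding hpoly_def by auto

lemma hpoly_mono: "\<alpha> \<in> hexps d \<Longrightarrow> hpoly d (\<lambda>T. mono_eval 7 \<alpha> (coord T))"
  unfolding hpoly_def
  by (intro exI[of _ "\<lambda>\<beta>. of_bool (\<beta> = \<alpha>)"]) (simp add: finite_hexps if_distrib[of "\<lambda>x. x * _"] of_bool_def cong: if_cong)

lemma hpoly_const: "hpoly 0 (\<lambda>T. c)"
proof -
  have "(\<lambda>_. 0) \<in> hexps 0" by (simp add: hexps_def)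
  from hpoly_cmult[OF hpoly_mono[OF this], of c] show ?thesis by (simp add: mono_eval_def)
qed

lemma hpoly_coord:
  assumes "j < 7"
  shows "hpoly 1 (\<lambda>T. coord T j)"
proof -
  have "(\<lambda>i. of_bool (i = j)) \<in> hexps 1"
    using assms by (auto simp: hexps_def of_bool_def)
  note hpoly_mono[OF this]
  moreover have "mono_eval 7 (\<lambda>i. of_bool (i = j)) x = x j" for x :: "nat \<Rightarrow> complex"
    using assms by (simp add: mono_eval_def of_bool_def if_distrib[of "\<lambda>k. _ ^ k"] cong: if_cong)
  ultimately show ?thesis by simp
qed

lemma hpoly_mult:
  assumes "hpoly d f" "hpoly e g"
  shows "hpoly (d + e) (\<lambda>T. f T * g T)"
proof -
  obtain \<phi> \<psi> where \<phi>: "\<And>T. T \<in> St33 \<Longrightarrow> f T = (\<Sum>\<alpha>\<in>hexps d. \<phi> \<alpha> * mono_eval 7 \<alpha> (coord T))"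
    and \<psi>: "\<And>T. T \<in> St33 \<Longrightarrow> g T = (\<Sum>\<alpha>\<in>hexps e. \<psi> \<alpha> * mono_eval 7 \<alpha> (coord T))"
    using assms unfolding hpoly_def by blast
  let ?S = "hexps d \<times> hexps e" and ?p = "\<lambda>(\<alpha>, \<beta>). (\<lambda>j. \<alpha> j + \<beta> j :: nat)"
  have "f T * g T = (\<Sum>\<gamma>\<in>hexps (d + e). (\<Sum>s\<in>{s \<in> ?S. ?p s = \<gamma>}. \<phi> (fst s) * \<psi> (snd s)) * mono_eval 7 \<gamma> (coord T))"
    if "T \<in> St33" for T
  proof -
    have m: "mono_eval 7 (\<lambda>j. \<alpha> j + \<beta> j) x = mono_eval 7 \<alpha> x * mono_eval 7 \<beta> x" for \<alpha> \<beta> and x :: "nat \<Rightarrow> complex"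
      by (simp add: mono_eval_def power_add prod.distrib)
    have "f T * g T = (\<Sum>s\<in>?S. \<phi> (fst s) * \<psi> (snd s) * mono_eval 7 (?p s) (coord T))"
      unfolding \<phi>[OF that] \<psi>[OF that] sum_product sum.cartesian_product
      by (intro sum.cong) (auto simp: m mult_ac)
    also have "\<dots> = (\<Sum>\<gamma>\<in>hexps (d + e). \<Sum>s\<in>{s \<in> ?S. ?p s = \<gamma>}. \<phi> (fst s) * \<psi> (snd s) * mono_eval 7 (?p s) (coord T))"
    proof (rule sum.group[symmetric])
      show "?p ` ?S \<subseteq> hexps (d + e)" by (auto simp: hexps_def sum.distrib)
    qed (simp_all add: finite_hexps)
    also have "\<dots> = (\<Sum>\<gamma>\<in>hexps (d + e). (\<Sum>s\<in>{s \<in> ?S. ?p s = \<gamma>}. \<phi> (fst s) * \<psi> (snd s)) * mono_eval 7 \<gamma> (coord T))"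
      by (intro sum.cong refl) (auto simp: sum_distrib_right intro!: sum.cong)
    finally show ?thesis .
  qed
  then show ?thesis
    unfolding hpoly_def
    by (intro exI[of _ "\<lambda>\<gamma>. \<Sum>s\<in>{s \<in> ?S. ?p s = \<gamma>}. \<phi> (fst s) * \<psi> (snd s)"] ballI)
qed

lemma hpoly_linear:
  assumes "bounded_linear f"
  shows "hpoly 1 (\<lambda>T. of_real (f T))"
proof -
  interpret f: bounded_linear f by fact
  have h: "hpoly 1 (\<lambda>T. c * (k * (coord T a + l * coord T b)))" if "a < 7" "b < 7" for a b c k l
    by (rule hpoly_cmult[OF hpoly_cmult[OF hpoly_add[OF hpoly_coord[OF that(1)] hpoly_cmult[OF hpoly_coord[OF that(2)]]]]])
  \<comment> \<open>The basis expansion of T, with real and imaginary parts recovered from conjugate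
    pairs: for instance x_6 = - cnj x_0 makes (x_0 - x_6)/2 the real part of x_0.\<close>
  have "of_real (f T) =
      f (St33_of (1/4) 0 0 (-1/4) 0 0 0) * (1/2 * (coord T 0 + - 1 * coord T 6))
    + f (St33_of 0 (1/4) 0 0 0 (-1/4) 0) * (- \<i>/2 * (coord T 0 + 1 * coord T 6))
    + f (St33_of 0 0 (1/2) 0 0 0 (-1/2)) * (1/2 * (coord T 1 + 1 * coord T 5))
    + f (St33_of 0 0 0 0 (1/2) 0 0) * (- \<i>/2 * (coord T 1 + - 1 * coord T 5))
    + f (St33_of (-3/4) 0 0 (-1/4) 0 0 0) * (1/2 * (coord T 2 + - 1 * coord T 4))
    + f (St33_of 0 (-1/4) 0 0 0 (-3/4) 0) * (- \<i>/2 * (coord T 2 + 1 * coord T 4))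
    + f (St33_of 0 0 (-1/2) 0 0 0 (-1/2)) * coord T 3" if T: "T \<in> St33" for T
    by (subst St33_basis_expansion[OF T]) (simp add: f.add f.scaleR coord_form complex_eq_iff)
  moreover have "hpoly 1 (\<lambda>T.
      f (St33_of (1/4) 0 0 (-1/4) 0 0 0) * (1/2 * (coord T 0 + - 1 * coord T 6))
    + f (St33_of 0 (1/4) 0 0 0 (-1/4) 0) * (- \<i>/2 * (coord T 0 + 1 * coord T 6))
    + f (St33_of 0 0 (1/2) 0 0 0 (-1/2)) * (1/2 * (coord T 1 + 1 * coord T 5))
    + f (St33_of 0 0 0 0 (1/2) 0 0) * (- \<i>/2 * (coord T 1 + - 1 * coord T 5))
    + f (St33_of (-3/4) 0 0 (-1/4) 0 0 0) * (1/2 * (coord T 2 + - 1 * coord T 4))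
    + f (St33_of 0 (-1/4) 0 0 0 (-3/4) 0) * (- \<i>/2 * (coord T 2 + 1 * coord T 4))
    + f (St33_of 0 0 (-1/2) 0 0 0 (-1/2)) * coord T 3)"
    by (rule hpoly_add, rule hpoly_add, rule hpoly_add, rule hpoly_add, rule hpoly_add, rule hpoly_add,
        (rule h, simp, simp)+, rule hpoly_cmult, rule hpoly_coord, simp)
  ultimately show ?thesis by (elim hpoly_cong) (simp only:)
qed

lemma hom_poly_fun_hpoly: "hom_poly_fun d p \<Longrightarrow> hpoly d (\<lambda>T. of_real (p T))"
  by (induction rule: hom_poly_fun.induct)
    (auto simp del: One_nat_def intro: hpoly_const hpoly_linear hpoly_add hpoly_mult)

lemma hom_poly_fun_eq_poly_eval:
  assumes "hom_poly_fun d p"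
  obtains \<phi> where "\<And>\<alpha>. \<phi> \<alpha> \<noteq> 0 \<Longrightarrow> \<alpha> \<in> hexps d"
    "\<And>T. T \<in> St33 \<Longrightarrow> of_real (p T) = poly_eval 7 (Suc d) \<phi> (coord T)"
proof -
  obtain \<phi> where \<phi>: "\<And>T. T \<in> St33 \<Longrightarrow> complex_of_real (p T) = (\<Sum>\<alpha>\<in>hexps d. \<phi> \<alpha> * mono_eval 7 \<alpha> (coord T))"
    using hom_poly_fun_hpoly[OF assms] unfolding hpoly_def by blast
  have "poly_eval 7 (Suc d) (\<lambda>\<alpha>. if \<alpha> \<in> hexps d then \<phi> \<alpha> else 0) x = (\<Sum>\<alpha>\<in>hexps d. \<phi> \<alpha> * mono_eval 7 \<alpha> x)" for x
    unfolding poly_eval_def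
  proof (rule sum.mono_neutral_cong_right[OF finite_exps_le])
    show "hexps d \<subseteq> exps_le 7 (Suc d)" by (auto simp: hexps_def exps_le_def)
  qed auto
  then show thesis using that[of "\<lambda>\<alpha>. if \<alpha> \<in> hexps d then \<phi> \<alpha> else 0"] \<phi> by (auto split: if_splits)
qed

section \<open>Algebraic independence\<close>

definition dgram :: "tensor333 \<Rightarrow> tensor333 \<Rightarrow> 3 \<Rightarrow> 3 \<Rightarrow> real" where
  "dgram T H i j = (\<Sum>k\<in>UNIV. \<Sum>l\<in>UNIV. T$i$k$l * H$j$k$l + H$i$k$l * T$j$k$l)"

definition dcov3 :: "tensor333 \<Rightarrow> tensor333 \<Rightarrow> 3 \<Rightarrow> real" where
  "dcov3 T H i = (\<Sum>j\<in>UNIV. \<Sum>k\<in>UNIV. T$i$j$k * dgram T H j k + H$i$j$k * gram T j k)"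

lemma has_derivative_entry: "((\<lambda>T::tensor333. T$i$j$k) has_derivative (\<lambda>H. H$i$j$k)) (at T)"
  by (rule bounded_linear_imp_has_derivative, rule bounded_linear_compose[OF bounded_linear_vec_nth
      bounded_linear_compose[OF bounded_linear_vec_nth bounded_linear_vec_nth]])

lemma has_derivative_gram: "((\<lambda>T. gram T i j) has_derivative (\<lambda>H. dgram T H i j)) (at T)"
  unfolding gram_def dgram_def
  by (intro has_derivative_sum has_derivative_mult has_derivative_entry)

lemma has_derivative_cov3: "((\<lambda>T. cov3 T i) has_derivative (\<lambda>H. dcov3 T H i)) (at T)"
  unfolding cov3_def contract_def dcov3_def
  by (intro has_derivative_sum has_derivative_mult has_derivative_entry has_derivative_gram)

definition Itup :: "tensor333 \<Rightarrow> real \<times> real \<times> real \<times> real" where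
  "Itup T = (I2 T, I4 T, I6 T, I10 T)"

lemma has_derivative_Itup:
  "(Itup has_derivative (\<lambda>H.
    (\<Sum>i\<in>UNIV. dgram T H i i,
     \<Sum>i\<in>UNIV. \<Sum>j\<in>UNIV. gram T i j * dgram T H i j + dgram T H i j * gram T i j,
     \<Sum>i\<in>UNIV. cov3 T i * dcov3 T H i + dcov3 T H i * cov3 T i,
     \<Sum>i\<in>UNIV. cov3 T i * (\<Sum>j\<in>UNIV. \<Sum>k\<in>UNIV. T$i$j$k * (cov3 T j * dcov3 T H k + dcov3 T H j * cov3 T k)
        + H$i$j$k * (cov3 T j * cov3 T k)) + dcov3 T H i * (\<Sum>j\<in>UNIV. \<Sum>k\<in>UNIV. T$i$j$k * (cov3 T j * cov3 T k))))) (at T)"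
  unfolding Itup_def[abs_def] I2_def I4_def I6_def I10_def contract_def
  by (intro has_derivative_Pair has_derivative_sum has_derivative_mult has_derivative_entry
      has_derivative_gram has_derivative_cov3)

text \<open>
  The differential at the chosen tensor is invertible in the directions of the entries 111, 112, 113
  and 222; \<open>g\<close> is its inverse.
\<close>

lemma interior_Itup_image: "interior (Itup ` St33) \<noteq> {}"
proof -
  \<comment> \<open>Any tensor at which the differential has rank 4 would serve; at this one
    \<open>gram\<close> and \<open>cov3\<close> are small integers and the matrix \<open>?f'\<close>
    is explicit.\<close>
  let ?T = "St33_of (-1) 0 0 0 (-1) 0 (-1)"
  define L where "L = (\<lambda>(h1, h2, h3, h4). St33_of h1 h2 h3 0 0 h4 0)"
  define g :: "real \<times> real \<times> real \<times> real \<Rightarrow> real \<times> real \<times> real \<times> real"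
    where "g = (\<lambda>(y1, y2, y3, y4). ((445/1089) * y1 + (-89/4356) * y2 + (-13/726) * y3 + (1/1936) * y4, (2020/1089) * y1 + (-101/1089) * y2 + (-65/1452) * y3 + (5/3872) * y4, (-4649/2178) * y1 + (89/1089) * y2 + (26/363) * y3 + (-1/484) * y4, (-90/121) * y1 + (9/242) * y2 + (3/968) * y3 + (-5/3872) * y4))"
  have L: "bounded_linear L"
    unfolding linear_conv_bounded_linear[symmetric]
    by (rule linearI) (auto simp: L_def vec_eq_iff forall_3 algebra_simps)
  have gl: "bounded_linear g"
    unfolding linear_conv_bounded_linear[symmetric]
    by (rule linearI) (auto simp: g_def add_divide_distrib algebra_simps)
  have gram: "gram ?T 1 1 = 4" "gram ?T 1 2 = 2" "gram ?T 1 3 = 1" "gram ?T 2 1 = 2" "gram ?T 2 2 = 4" "gram ?T 2 3 = -2" "gram ?T 3 1 = 1" "gram ?T 3 2 = -2" "gram ?T 3 3 = 6"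
    by (simp_all add: gram_def sum_3)
  have cov3: "cov3 ?T 1 = 6" "cov3 ?T 2 = 2" "cov3 ?T 3 = 0"
    by (simp_all add: cov3_def contract_def sum_3 gram)
  have dgram: "dgram ?T (L (h1, h2, h3, h4)) 1 1 = (-4) * h1"
    "dgram ?T (L (h1, h2, h3, h4)) 1 2 = (-2) * h2 + (-2) * h3 + (-1) * h4"
    "dgram ?T (L (h1, h2, h3, h4)) 1 3 = (-1) * h1 + (2) * h4"
    "dgram ?T (L (h1, h2, h3, h4)) 2 1 = (-2) * h2 + (-2) * h3 + (-1) * h4"
    "dgram ?T (L (h1, h2, h3, h4)) 2 2 = 0"
    "dgram ?T (L (h1, h2, h3, h4)) 2 3 = (2) * h1 + (1) * h2"
    "dgram ?T (L (h1, h2, h3, h4)) 3 1 = (-1) * h1 + (2) * h4"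
    "dgram ?T (L (h1, h2, h3, h4)) 3 2 = (2) * h1 + (1) * h2"
    "dgram ?T (L (h1, h2, h3, h4)) 3 3 = (-4) * h1 + (-2) * h3" for h1 h2 h3 h4
    by (simp_all add: dgram_def sum_3 L_def)
  have dcov3: "dcov3 ?T (L (h1, h2, h3, h4)) 1 = (-6) * h1 + (2) * h2"
    "dcov3 ?T (L (h1, h2, h3, h4)) 2 = (-2) * h1 + (-4) * h2 + (-6) * h4"
    "dcov3 ?T (L (h1, h2, h3, h4)) 3 = (-8) * h1 + (8) * h2 + (10) * h4" for h1 h2 h3 h4
    unfolding dcov3_def sum_3 dgram gram by (simp_all add: L_def)
  let ?f = "\<lambda>h. Itup (?T + L h)"
  let ?f' = "\<lambda>(h1, h2, h3, h4). ((-8) * h1 + (-2) * h3, (-100) * h1 + (-24) * h2 + (-40) * h3, (-80) * h1 + (8) * h2 + (-24) * h4, (1536) * h1 + (-672) * h2 + (-832) * h4)"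
  have d: "(?f has_derivative ?f') (at 0)"
  proof -
    have "((\<lambda>h. ?T + L h) has_derivative L) (at 0)"
      using bounded_linear_imp_has_derivative[OF L] by (auto intro!: derivative_eq_intros)
    moreover have "?T + L 0 = ?T" by (simp add: linear_0[OF bounded_linear.linear[OF L]])
    ultimately have "(?f has_derivative (\<lambda>h.
    (\<Sum>i\<in>UNIV. dgram ?T (L h) i i,
     \<Sum>i\<in>UNIV. \<Sum>j\<in>UNIV. gram ?T i j * dgram ?T (L h) i j + dgram ?T (L h) i j * gram ?T i j,
     \<Sum>i\<in>UNIV. cov3 ?T i * dcov3 ?T (L h) i + dcov3 ?T (L h) i * cov3 ?T i,
     \<Sum>i\<in>UNIV. cov3 ?T i * (\<Sum>j\<in>UNIV. \<Sum>k\<in>UNIV. ?T$i$j$k * (cov3 ?T j * dcov3 ?T (L h) k + dcov3 ?T (L h) j * cov3 ?T k)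
        + L h$i$j$k * (cov3 ?T j * cov3 ?T k)) + dcov3 ?T (L h) i * (\<Sum>j\<in>UNIV. \<Sum>k\<in>UNIV. ?T$i$j$k * (cov3 ?T j * cov3 ?T k))))) (at 0)"
      using has_derivative_compose[of "\<lambda>h. ?T + L h" L 0 UNIV Itup] has_derivative_Itup[of ?T] by simp
    moreover have "(\<lambda>h.
    (\<Sum>i\<in>UNIV. dgram ?T (L h) i i,
     \<Sum>i\<in>UNIV. \<Sum>j\<in>UNIV. gram ?T i j * dgram ?T (L h) i j + dgram ?T (L h) i j * gram ?T i j,
     \<Sum>i\<in>UNIV. cov3 ?T i * dcov3 ?T (L h) i + dcov3 ?T (L h) i * cov3 ?T i,
     \<Sum>i\<in>UNIV. cov3 ?T i * (\<Sum>j\<in>UNIV. \<Sum>k\<in>UNIV. ?T$i$j$k * (cov3 ?T j * dcov3 ?T (L h) k + dcov3 ?T (L h) j * cov3 ?T k)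
        + L h$i$j$k * (cov3 ?T j * cov3 ?T k)) + dcov3 ?T (L h) i * (\<Sum>j\<in>UNIV. \<Sum>k\<in>UNIV. ?T$i$j$k * (cov3 ?T j * cov3 ?T k)))) = ?f'" (is "?F = _")
    proof (rule ext)
      fix h :: "real \<times> real \<times> real \<times> real"
      obtain h1 h2 h3 h4 where h: "h = (h1, h2, h3, h4)" by (cases h)
      show "?F h = ?f' h"
        unfolding h sum_3 dgram gram dcov3 cov3 by (simp add: L_def)
    qed
    ultimately show ?thesis by (simp only:)
  qed
  have "?f 0 \<in> interior (?f ` UNIV)"
  \<comment> \<open>This form of the open mapping theorem asks for continuity and for a right
    inverse of the differential at the single point 0.\<close>
  proof (rule sussmann_open_mapping[OF open_UNIV _ _ d gl _ subset_UNIV])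
    have "continuous_on UNIV Itup"
      using has_derivative_Itup has_derivative_continuous continuous_at_imp_continuous_on by blast
    then show "continuous_on UNIV ?f"
      using continuous_on_compose2[of UNIV Itup UNIV "\<lambda>h. ?T + L h"] linear_continuous_on[OF L, of UNIV]
      by (simp add: continuous_on_add)
    show "?f' \<circ> g = id" by (auto simp: g_def fun_eq_iff field_simps)
  qed auto
  moreover have "range ?f \<subseteq> Itup ` St33"
    using subspace_add[OF subspace_St33] by (auto simp: L_def)
  ultimately show ?thesis using interior_mono by blast
qed


definition Ivec :: "tensor333 \<Rightarrow> nat \<Rightarrow> real" where
  "Ivec T j = [I2 T, I4 T, I6 T, I10 T] ! j"

definition Iexps :: "nat \<Rightarrow> (nat \<Rightarrow> nat) set" where
  "Iexps d = {m. (\<forall>j\<ge>4. m j = 0) \<and> (\<Sum>j<4. [2,4,6,10] ! j * m j) = d}"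

lemma sum_lessThan_4: "(\<Sum>j<4. f j) = f 0 + f 1 + f 2 + f (3::nat)"
  by (simp add: lessThan_nat_numeral lessThan_Suc ac_simps flip: numeral_2_eq_2)

lemma prod_lessThan_4: "(\<Prod>j<4. f j) = f 0 * f 1 * f 2 * f (3::nat)"
  by (simp add: lessThan_nat_numeral lessThan_Suc ac_simps flip: numeral_2_eq_2)

lemma Iexps_le: "Iexps d \<subseteq> exps_le 4 d"
  by (auto simp: Iexps_def exps_le_def sum_lessThan_4)

lemma finite_Iexps: "finite (Iexps d)"
  using finite_subset[OF Iexps_le finite_exps_le] .

text \<open>A relation is a polynomial in four variables vanishing on the open part of the image of
  \<open>Itup\<close>. Short moves along the coordinate axes stay in that part, so
  \<open>poly_eval_zero_on\<close> applies. Complex coefficients are allowed because the dimension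
  count yields complex relations.\<close>

lemma Ivec_monomials_independent:
  fixes c :: "(nat \<Rightarrow> nat) \<Rightarrow> complex"
  assumes "\<And>T. T \<in> St33 \<Longrightarrow> (\<Sum>m\<in>Iexps d. c m * of_real (mono_eval 4 m (Ivec T))) = 0"
    and "m \<in> Iexps d"
  shows "c m = 0"
proof -
  let ?U = "interior (Itup ` St33)"
  define X :: "real \<times> real \<times> real \<times> real \<Rightarrow> nat \<Rightarrow> complex"
    where "X = (\<lambda>(a, b, p, q) j. of_real ([a, b, p, q] ! j))"
  let ?\<phi> = "\<lambda>m. if m \<in> Iexps d then c m else 0"
  have "?\<phi> m = 0"
  proof (rule poly_eval_zero_on[where R = "X ` ?U" and n = 4 and D = d and \<alpha> = m])
    show "X ` ?U \<noteq> {}" using interior_Itup_image by simp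
    show "m \<in> exps_le 4 d" using assms(2) Iexps_le by blast
    fix x assume "x \<in> X ` ?U"
    then obtain T where T: "T \<in> St33" "x = X (Itup T)"
      using interior_subset by blast
    have "mono_eval 4 m x = of_real (mono_eval 4 m (Ivec T))" for m
      by (simp add: mono_eval_def prod_lessThan_4 T(2) X_def Itup_def Ivec_def)
    moreover have "poly_eval 4 d ?\<phi> x = (\<Sum>m\<in>Iexps d. c m * mono_eval 4 m x)"
      unfolding poly_eval_def
      by (rule sum.mono_neutral_cong_right[OF finite_exps_le Iexps_le]) auto
    ultimately show "poly_eval 4 d ?\<phi> x = 0" using assms(1)[OF T(1)] by simp
  next
    fix D and \<phi> :: "(nat \<Rightarrow> nat) \<Rightarrow> complex" and j :: nat and x
    assume z: "\<And>x. x \<in> X ` ?U \<Longrightarrow> poly_eval 4 (Suc D) \<phi> x = 0" and j: "j < 4" and "x \<in> X ` ?U"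
    then obtain u where u: "u \<in> ?U" "x = X u" by blast
    define e :: "real \<times> real \<times> real \<times> real" where "e = (of_bool (j = 0), of_bool (j = 1), of_bool (j = 2), of_bool (j = 3))"
    have Xe: "X (u + t *\<^sub>R e) i = X u i + of_real t * of_bool (i = j)" if "i < 4" for t i
      using that j by (cases u) (auto simp: X_def e_def less_Suc_eq numeral_eq_Suc)
    have "((\<lambda>t. poly_eval 4 (Suc D) \<phi> (X (u + t *\<^sub>R e))) has_vector_derivative
        (\<Sum>i<4. of_bool (i = j) * poly_eval 4 D (Dop i \<phi>) (X (u + 0 *\<^sub>R e)))) (at 0)"
    proof (rule has_vector_derivative_poly_eval)
      fix i :: nat assume "i < 4"
      then show "((\<lambda>t. X (u + t *\<^sub>R e) i) has_vector_derivative of_bool (i = j)) (at 0)"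
        unfolding Xe[OF \<open>i < 4\<close>] has_vector_derivative_def
        by (auto intro!: derivative_eq_intros simp: scaleR_conv_of_real)
    qed
    moreover have "(\<Sum>i<4. of_bool (i = j) * poly_eval 4 D (Dop i \<phi>) (X (u + 0 *\<^sub>R e))) = poly_eval 4 D (Dop j \<phi>) x"
      using j by (simp add: u(2) of_bool_def if_distrib[of "\<lambda>x. x * _"] cong: if_cong)
    ultimately have d: "((\<lambda>t. poly_eval 4 (Suc D) \<phi> (X (u + t *\<^sub>R e))) has_vector_derivative
        poly_eval 4 D (Dop j \<phi>) x) (at 0)" by simp
    have "open ((\<lambda>t. u + t *\<^sub>R e) -` ?U)"
      by (rule open_vimage) (auto intro!: continuous_intros)
    from has_vector_derivative_transform_within_open[OF d this, of "\<lambda>_. 0"] u z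
    have "((\<lambda>t::real. 0) has_vector_derivative poly_eval 4 D (Dop j \<phi>) x) (at 0)"
      by auto
    then show "poly_eval 4 D (Dop j \<phi>) x = 0"
      using has_vector_derivative_const vector_derivative_unique_at by metis
  qed
  then show ?thesis using assms(2) by simp
qed

lemma hom_poly_fun_scale: "hom_poly_fun d p \<Longrightarrow> p (s *\<^sub>R x) = s ^ d * p x"
proof (induction rule: hom_poly_fun.induct)
  case (linear f)
  then interpret bounded_linear f .
  show ?case by (simp add: scaleR)
qed (auto simp: distrib_left power_add mult_ac)

lemma hom_poly_fun_Ivec_monomial:
  assumes "m \<in> Iexps d"
  shows "hom_poly_fun d (\<lambda>T. mono_eval 4 m (Ivec T))"
proof -
  have "hom_poly_fun (2 * m 0 + 4 * m 1 + 6 * m 2 + 10 * m 3) (\<lambda>T. I2 T ^ m 0 * I4 T ^ m 1 * I6 T ^ m 2 * I10 T ^ m 3)"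
    by (intro hom_poly_fun.mult hom_poly_fun_power hom_poly_fun_I)
  then show ?thesis
    using assms by (simp add: mono_eval_def prod_lessThan_4 Ivec_def Iexps_def sum_lessThan_4)
qed

section \<open>Generation of the invariant ring\<close>

lemma Iexps_odd: "odd d \<Longrightarrow> Iexps d = {}"
  by (auto simp: Iexps_def sum_lessThan_4)

lemma wexps_eq_Iexps: "wexps (\<lambda>j. [2,4,6,10] ! j) (\<lambda>_. 0) 4 d 0 = Iexps d"
  by (auto simp: wexps_def Iexps_def)

text \<open>The generating function gives x_j the weight 3 - j, the operators give it j - 3; hence
  the coefficient at -1 counts the monomials of weight 1.\<close>

lemma wexps_eq_hexps: "wexps (\<lambda>_. 1) (\<lambda>j. 3 - int j) 7 d (- w) = {\<alpha> \<in> hexps d. weight \<alpha> = w}"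
proof -
  have "(\<Sum>j<7. (3 - int j) * int (\<alpha> j)) = - weight \<alpha>" for \<alpha>
    by (simp add: weight_def flip: sum_negf) (simp add: algebra_simps)
  then show ?thesis by (auto simp: wexps_def hexps_def)
qed

text \<open>The term shifted by 15 counts monomials of the odd degree d - 15 in generators of even
  degree, of which there are none.\<close>

lemma card_weights_even:
  assumes "even d"
  shows "card {\<alpha> \<in> hexps d. weight \<alpha> = 0} = card {\<alpha> \<in> hexps d. weight \<alpha> = 1} + card (Iexps d)"
proof -
  have "15 \<le> d \<Longrightarrow> Iexps (d - 15) = {}" using assms by (intro Iexps_odd) auto
  then show ?thesis
    using card_invariant_weights[of d] wexps_eq_hexps[of d 0] wexps_eq_hexps[of d 1]
    unfolding wexps_eq_Iexps by (auto split: if_splits)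
qed

lemma hom_invariant_weight_zero_raise:
  assumes "hom_poly_fun d p" "\<And>g T. g \<in> O3 \<Longrightarrow> T \<in> St33 \<Longrightarrow> p (tensor_act g T) = p T"
  obtains \<phi> :: "(nat \<Rightarrow> nat) \<Rightarrow> complex" where "\<And>\<alpha>. \<phi> \<alpha> \<noteq> 0 \<Longrightarrow> \<alpha> \<in> hexps d \<and> weight \<alpha> = 0" "\<And>\<alpha>. raise \<phi> \<alpha> = 0"
    "\<And>T. T \<in> St33 \<Longrightarrow> of_real (p T) = poly_eval 7 (Suc d) \<phi> (coord T)"
proof -
  obtain \<phi> where \<phi>: "\<And>\<alpha>. \<phi> \<alpha> \<noteq> 0 \<Longrightarrow> \<alpha> \<in> hexps d"
    "\<And>T. T \<in> St33 \<Longrightarrow> complex_of_real (p T) = poly_eval 7 (Suc d) \<phi> (coord T)"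
    using hom_poly_fun_eq_poly_eval[OF assms(1)] by blast
  have inv: "complex_of_real (p (tensor_act g T)) = complex_of_real (p T)" if "g \<in> O3" "T \<in> St33" for g T
    using assms(2)[OF that] by simp
  note r = invariant_poly_weight_zero_raise[where f = "\<lambda>T. complex_of_real (p T)" and d = d and \<phi> = \<phi>, OF inv \<phi>(2) \<phi>(1)]
  show thesis
    by (rule that[of \<phi>]) (use r \<phi> in blast)+
qed

theorem hom_invariant_generated:
  assumes p: "hom_poly_fun d p" and inv: "\<And>g T. g \<in> O3 \<Longrightarrow> T \<in> St33 \<Longrightarrow> p (tensor_act g T) = p T"
  shows "\<exists>c. \<forall>T\<in>St33. p T = (\<Sum>m\<in>Iexps d. c m * mono_eval 4 m (Ivec T))"
proof (cases "even d")
  case False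
  have "p T = 0" if T: "T \<in> St33" for T
  proof -
    have "- mat 1 \<in> O3"
      by (auto simp: O3_def orthogonal_matrix matrix_matrix_mult_def transpose_def mat_def vec_eq_iff forall_3 sum_3)
    moreover have "tensor_act (- mat 1) T = (-1) *\<^sub>R T"
      by (auto simp: tensor_act_def mat_def vec_eq_iff forall_3 sum_3)
    ultimately have "p ((-1) *\<^sub>R T) = p T" using inv[OF _ T] by metis
    then show ?thesis unfolding hom_poly_fun_scale[OF p] using False by simp
  qed
  then show ?thesis unfolding Iexps_odd[OF False] by simp
next
  case True
  let ?P = "\<lambda>m T. mono_eval 4 m (Ivec T)"
  have "\<exists>\<psi>. (\<forall>\<alpha>. \<psi> \<alpha> \<noteq> 0 \<longrightarrow> \<alpha> \<in> hexps d \<and> weight \<alpha> = 0) \<and> (\<forall>\<alpha>. raise \<psi> \<alpha> = 0) \<and>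
      (\<forall>T\<in>St33. complex_of_real (?P m T) = poly_eval 7 (Suc d) \<psi> (coord T))" if "m \<in> Iexps d" for m
  proof -
    have "?P m (tensor_act g T) = ?P m T" if "g \<in> O3" for g T
      by (simp add: mono_eval_def Ivec_def I_invariant[OF that])
    from hom_invariant_weight_zero_raise[OF hom_poly_fun_Ivec_monomial[OF that] this]
    show ?thesis by metis
  qed
  then obtain \<psi> where \<psi>: "\<And>m \<alpha>. m \<in> Iexps d \<Longrightarrow> \<psi> m \<alpha> \<noteq> 0 \<Longrightarrow> \<alpha> \<in> hexps d \<and> weight \<alpha> = 0"
    "\<And>m \<alpha>. m \<in> Iexps d \<Longrightarrow> raise (\<psi> m) \<alpha> = 0"
    "\<And>m T. m \<in> Iexps d \<Longrightarrow> T \<in> St33 \<Longrightarrow> complex_of_real (?P m T) = poly_eval 7 (Suc d) (\<psi> m) (coord T)"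
    by metis
  obtain \<phi> where \<phi>: "\<And>\<alpha>. \<phi> \<alpha> \<noteq> 0 \<Longrightarrow> \<alpha> \<in> hexps d \<and> weight \<alpha> = 0" "\<And>\<alpha>. raise \<phi> \<alpha> = 0"
    "\<And>T. T \<in> St33 \<Longrightarrow> complex_of_real (p T) = poly_eval 7 (Suc d) \<phi> (coord T)"
    using hom_invariant_weight_zero_raise[OF p inv] by blast
  \<comment> \<open>The invariant p, indexed by \<open>None\<close>, joins the monomials in the
    basic invariants. That is one element more than the kernel of \<open>raise\<close> can hold
    independently, by \<open>card_weights_even\<close>.\<close>
  let ?I = "insert None (Some ` Iexps d)" and ?\<psi> = "case_option \<phi> \<psi>"
  have "\<exists>c. (\<exists>i\<in>?I. c i \<noteq> 0) \<and> (\<forall>\<alpha>. (\<Sum>i\<in>?I. c i * ?\<psi> i \<alpha>) = 0)"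
  proof (rule raise_kernel_dependent[where d = d])
    show "card {\<alpha> \<in> hexps d. weight \<alpha> = 0} < card ?I + card {\<alpha> \<in> hexps d. weight \<alpha> = 1}"
      unfolding card_weights_even[OF True] by (simp add: finite_Iexps card_image)
  qed (use \<phi> \<psi> in \<open>auto simp: finite_Iexps split: option.splits\<close>)
  then obtain c where c: "\<exists>i\<in>?I. c i \<noteq> 0" "\<And>\<alpha>. (\<Sum>i\<in>?I. c i * ?\<psi> i \<alpha>) = 0" by blast
  have sum_I: "(\<Sum>i\<in>?I. f i) = f None + (\<Sum>m\<in>Iexps d. f (Some m))" for f :: "_ \<Rightarrow> complex"
    by (simp add: finite_Iexps sum.reindex)
  have rel: "c None * of_real (p T) + (\<Sum>m\<in>Iexps d. c (Some m) * of_real (?P m T)) = 0" if T: "T \<in> St33" for T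
  proof -
    have "c None * of_real (p T) + (\<Sum>m\<in>Iexps d. c (Some m) * of_real (?P m T)) =
        poly_eval 7 (Suc d) (\<lambda>\<alpha>. c None * \<phi> \<alpha> + (\<Sum>m\<in>Iexps d. c (Some m) * \<psi> m \<alpha>)) (coord T)"
      unfolding poly_eval_linear using \<phi>(3)[OF T] \<psi>(3)[OF _ T] by (auto intro!: sum.cong)
    also have "(\<lambda>\<alpha>. c None * \<phi> \<alpha> + (\<Sum>m\<in>Iexps d. c (Some m) * \<psi> m \<alpha>)) = (\<lambda>_. 0)"
      using c(2) unfolding sum_I by simp
    finally show ?thesis by (simp add: poly_eval_def)
  qed
  \<comment> \<open>Otherwise the relation would be among the monomials alone, which are
    independent.\<close>
  have "c None \<noteq> 0"
  proof
    assume "c None = 0"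
    then have "c (Some m) = 0" if "m \<in> Iexps d" for m
      using Ivec_monomials_independent[where d = d and c = "\<lambda>m. c (Some m)" and m = m] rel that by simp
    then show False using c(1) \<open>c None = 0\<close> by auto
  qed
  \<comment> \<open>p and the monomials take real values, so real parts of the complex coefficients
    still express p.\<close>
  have "p T = (\<Sum>m\<in>Iexps d. Re (- c (Some m) / c None) * ?P m T)" if T: "T \<in> St33" for T
  proof -
    have "of_real (p T) = - (\<Sum>m\<in>Iexps d. c (Some m) * of_real (?P m T)) / c None"
      using rel[OF T] \<open>c None \<noteq> 0\<close> by (simp add: field_simps eq_neg_iff_add_eq_0)
    also have "\<dots> = (\<Sum>m\<in>Iexps d. (- c (Some m) / c None) * of_real (?P m T))"
      by (simp add: sum_divide_distrib flip: sum_negf)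
    finally have "Re (of_real (p T)) = Re (\<Sum>m\<in>Iexps d. (- c (Some m) / c None) * of_real (?P m T))"
      by (rule arg_cong)
    moreover have "Re (z * of_real r) = Re z * r" for z r by simp
    ultimately show ?thesis by (simp only: Re_sum Re_complex_of_real)
  qed
  then show ?thesis by (intro exI ballI)
qed

section \<open>Minimal integrity bases\<close>

text \<open>On the line from \<open>u\<close> to \<open>x\<close> the function is a polynomial in
  one variable with infinitely many zeros near \<open>u\<close>.\<close>

lemma real_polynomial_function_eq_0:
  fixes D :: "'a::real_normed_vector \<Rightarrow> real"
  assumes D: "real_polynomial_function D" and U: "open U" "u \<in> U" and z: "\<And>y. y \<in> U \<Longrightarrow> D y = 0"
  shows "D x = 0"
proof -
  let ?l = "\<lambda>t. u + t *\<^sub>R (x - u)"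
  have "polynomial_function ?l"
    by (intro polynomial_function_add polynomial_function_const polynomial_function_bounded_linear
        bounded_linear_scaleR_left)
  then have "real_polynomial_function (D \<circ> ?l)"
    using D by (rule real_polynomial_function_compose)
  then obtain a n where a: "D \<circ> ?l = (\<lambda>t. \<Sum>i\<le>n. a i * t ^ i)"
    unfolding real_polynomial_function_iff_sum by blast
  have "open (?l -` U)"
    by (rule open_vimage[OF U(1)]) (intro continuous_intros)
  moreover have "0 \<in> ?l -` U" using U(2) by simp
  ultimately obtain e where e: "e > 0" "ball 0 e \<subseteq> ?l -` U"
    unfolding open_contains_ball by blast
  have "infinite (ball (0::real) e)"
    using e(1) by (simp add: ball_eq_greaterThanLessThan)
  moreover have "ball 0 e \<subseteq> {t. (\<Sum>i\<le>n. a i * t ^ i) = 0}"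
  proof
    fix t :: real assume "t \<in> ball 0 e"
    then have "D (?l t) = 0" using e(2) by (intro z) auto
    then show "t \<in> {t. (\<Sum>i\<le>n. a i * t ^ i) = 0}" using fun_cong[OF a, of t] by simp
  qed
  ultimately have "infinite {t. (\<Sum>i\<le>n. a i * t ^ i) = 0}"
    using finite_subset by blast
  then have "\<forall>i\<le>n. a i = 0"
    unfolding polyfun_finite_roots by blast
  then have "(D \<circ> ?l) 1 = 0" unfolding a by simp
  then show ?thesis by simp
qed

definition tup :: "real \<times> real \<times> real \<times> real \<Rightarrow> nat \<Rightarrow> real" where
  "tup = (\<lambda>(a, b, p, q) j. [a, b, p, q] ! j)"

definition tup_of :: "(nat \<Rightarrow> real) \<Rightarrow> real \<times> real \<times> real \<times> real" where
  "tup_of y = (y 0, y 1, y 2, y 3)"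

lemma less_4_cases: "j < 4 \<longleftrightarrow> j = 0 \<or> j = 1 \<or> j = 2 \<or> j = (3::nat)"
  by auto

lemma tup_of_tup [simp]: "j < 4 \<Longrightarrow> tup (tup_of y) j = y j"
  by (auto simp: tup_def tup_of_def less_4_cases)

lemma tup_of_Ivec [simp]: "tup_of (Ivec T) = Itup T"
  by (simp add: tup_of_def Ivec_def Itup_def)

lemma mono_eval_tup_of: "mono_eval 4 m (tup (tup_of y)) = mono_eval 4 m y"
  by (simp add: mono_eval_def)

lemma real_polynomial_function_tup: "j < 4 \<Longrightarrow> real_polynomial_function (\<lambda>y. tup y j)"
proof -
  assume "j < 4"
  have "tup y j = [fst y, fst (snd y), fst (snd (snd y)), snd (snd (snd y))] ! j" for y
    by (cases y) (simp add: tup_def)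
  with \<open>j < 4\<close> show ?thesis
    unfolding less_4_cases
    by (auto intro!: real_polynomial_function.intros(1) bounded_linear_intros)
qed

definition unit_exp :: "nat \<Rightarrow> nat \<Rightarrow> nat" where
  "unit_exp k j = of_bool (j = k)"

text \<open>On the k-th axis such a monomial either contains another variable and is identically 0,
  or is a power of t with exponent different from 1.\<close>

lemma mono_eval_line_derivative:
  assumes k: "k < 4" and m: "m \<in> Iexps d" "m \<noteq> unit_exp k"
  shows "((\<lambda>t. mono_eval 4 m (\<lambda>j. t * of_bool (j = k))) has_real_derivative 0) (at 0)"
proof (cases "\<exists>j<4. j \<noteq> k \<and> m j \<noteq> 0")
  case True
  then obtain j where "j < 4" "j \<noteq> k" "m j \<noteq> 0" by blast
  then have "mono_eval 4 m (\<lambda>j. t * of_bool (j = k)) = 0" for t :: real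
    unfolding mono_eval_def by (intro prod_zero bexI[of _ j]) auto
  then show ?thesis by simp
next
  case False
  have "m k \<noteq> 1"
  proof
    assume "m k = 1"
    then have "m j = unit_exp k j" for j
      using False m(1) k by (cases "j < 4") (auto simp: unit_exp_def Iexps_def)
    then show False using m(2) by auto
  qed
  have "mono_eval 4 m (\<lambda>j. t * of_bool (j = k)) = t ^ m k" for t :: real
  proof -
    have "mono_eval 4 m (\<lambda>j. t * of_bool (j = k)) = (\<Prod>j\<in>{k}. (t * of_bool (j = k)) ^ m j)"
      unfolding mono_eval_def using k False by (intro prod.mono_neutral_right) auto
    then show ?thesis by simp
  qed
  moreover have "((\<lambda>t::real. t ^ m k) has_real_derivative of_nat (m k) * 0 ^ (m k - 1)) (at 0)"
    by (auto intro!: derivative_eq_intros)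
  moreover have "of_nat (m k) * 0 ^ (m k - 1) = (0::real)" using \<open>m k \<noteq> 1\<close> by (cases "m k") auto
  ultimately show ?thesis by (simp only:)
qed

section \<open>Closure properties of the generated algebra\<close>

abbreviation "genalg \<equiv> generated_algebra St33"

lemma genalg_add:
  assumes "(\<lambda>T\<in>St33. f T) \<in> genalg B" "(\<lambda>T\<in>St33. g T) \<in> genalg B"
  shows "(\<lambda>T\<in>St33. f T + g T) \<in> genalg B"
proof -
  have "(\<lambda>T\<in>St33. (\<lambda>T\<in>St33. f T) T + (\<lambda>T\<in>St33. g T) T) = (\<lambda>T\<in>St33. f T + g T)"
    by (rule restrict_ext) simp
  with generated_algebra.add[OF assms] show ?thesis by metis
qed

lemma genalg_mult:
  assumes "(\<lambda>T\<in>St33. f T) \<in> genalg B" "(\<lambda>T\<in>St33. g T) \<in> genalg B"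
  shows "(\<lambda>T\<in>St33. f T * g T) \<in> genalg B"
proof -
  have "(\<lambda>T\<in>St33. (\<lambda>T\<in>St33. f T) T * (\<lambda>T\<in>St33. g T) T) = (\<lambda>T\<in>St33. f T * g T)"
    by (rule restrict_ext) simp
  with generated_algebra.mult[OF assms] show ?thesis by metis
qed

lemma genalg_sum:
  assumes "\<And>i. i \<in> S \<Longrightarrow> (\<lambda>T\<in>St33. f i T) \<in> genalg B"
  shows "(\<lambda>T\<in>St33. \<Sum>i\<in>S. f i T) \<in> genalg B"
  using assms
proof (induction S rule: infinite_finite_induct)
  case (insert x F)
  then have "(\<lambda>T\<in>St33. f x T + (\<Sum>i\<in>F. f i T)) \<in> genalg B" by (intro genalg_add) blast+
  then show ?case unfolding sum.insert[OF insert.hyps] .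
next
  case (infinite S)
  show ?case unfolding sum.infinite[OF infinite(1)] by (rule generated_algebra.const)
next
  case empty
  show ?case unfolding sum.empty by (rule generated_algebra.const)
qed

lemma genalg_prod:
  assumes "\<And>i. i \<in> S \<Longrightarrow> (\<lambda>T\<in>St33. f i T) \<in> genalg B"
  shows "(\<lambda>T\<in>St33. \<Prod>i\<in>S. f i T) \<in> genalg B"
  using assms
proof (induction S rule: infinite_finite_induct)
  case (insert x F)
  then have "(\<lambda>T\<in>St33. f x T * (\<Prod>i\<in>F. f i T)) \<in> genalg B" by (intro genalg_mult) blast+
  then show ?case unfolding prod.insert[OF insert.hyps] .
next
  case (infinite S)
  show ?case unfolding prod.infinite[OF infinite(1)] by (rule generated_algebra.const)
next
  case empty
  show ?case unfolding prod.empty by (rule generated_algebra.const)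
qed

lemma genalg_power:
  assumes "(\<lambda>T\<in>St33. f T) \<in> genalg B"
  shows "(\<lambda>T\<in>St33. f T ^ n) \<in> genalg B"
  using genalg_prod[of "{..<n}" "\<lambda>_. f" B] assms by simp

lemma genalg_cmult:
  assumes "(\<lambda>T\<in>St33. f T) \<in> genalg B"
  shows "(\<lambda>T\<in>St33. c * f T) \<in> genalg B"
  by (rule genalg_mult[OF generated_algebra.const assms])

lemma genalg_mono:
  assumes "f \<in> genalg A" "A \<subseteq> B"
  shows "f \<in> genalg B"
  using assms by (induction rule: generated_algebra.induct) (auto intro: generated_algebra.intros)

definition Ideg :: "nat \<Rightarrow> nat" where "Ideg k = [2, 4, 6, 10] ! k"

lemma hom_poly_fun_real_polynomial_function: "hom_poly_fun d p \<Longrightarrow> real_polynomial_function p"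
  by (induction rule: hom_poly_fun.induct) auto

lemma Ivec_hom: "k < 4 \<Longrightarrow> hom_poly_fun (Ideg k) (\<lambda>T. Ivec T k)"
  using hom_poly_fun_I by (auto simp: less_4_cases Ideg_def Ivec_def)

lemma Ivec_invariant: "g \<in> O3 \<Longrightarrow> Ivec (tensor_act g T) = Ivec T"
  by (simp add: Ivec_def[abs_def] I_invariant)

lemma Ivec_polynomial_invariant:
  assumes "k < 4"
  shows "(\<lambda>T\<in>St33. Ivec T k) \<in> polynomial_invariants St33 O3 tensor_act"
  unfolding polynomial_invariants_def poly_fun_on_def
  using hom_poly_fun_real_polynomial_function[OF Ivec_hom[OF assms]] tensor_act_St33
  by (auto simp: Ivec_invariant)

lemma unit_exp_Iexps: "k < 4 \<Longrightarrow> unit_exp k \<in> Iexps d \<longleftrightarrow> d = Ideg k"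
  by (auto simp: Iexps_def unit_exp_def sum_lessThan_4 less_4_cases Ideg_def)

text \<open>The degrees 2 < 4 < 6 < 10 increase strictly: a later generator does not fit into degree
  \<open>Ideg k\<close>, and the k-th one already exhausts it. This makes the change of generators
  triangular.\<close>

lemma Iexps_Ideg_lower:
  assumes "k < 4" "m \<in> Iexps (Ideg k)" "m \<noteq> unit_exp k" "k \<le> j"
  shows "m j = 0"
proof (cases "j < 4")
  case True
  have "2 * m 0 + 4 * m 1 + 6 * m 2 + 10 * m 3 = Ideg k" and z: "\<And>j. j \<ge> 4 \<Longrightarrow> m j = 0"
    using assms(2) by (auto simp: Iexps_def sum_lessThan_4)
  then have "m j = 0 \<or> (j = k \<and> m j = 1 \<and> (\<forall>i<4. i \<noteq> k \<longrightarrow> m i = 0))"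
    using True assms(1,4) by (auto simp: less_4_cases Ideg_def)
  moreover have "m = unit_exp k" if "m k = 1" "\<forall>i<4. i \<noteq> k \<longrightarrow> m i = 0"
    using that z assms(1) by (auto simp: fun_eq_iff unit_exp_def) (metis leI)
  ultimately show ?thesis using assms(3) by blast
qed (use assms(2) in \<open>auto simp: Iexps_def\<close>)


lemma minimal_basis_member_form:
  assumes B: "minimal_integrity_basis St33 O3 tensor_act B" and b: "b \<in> B"
  obtains d c where "b = (\<lambda>T\<in>St33. \<Sum>m\<in>Iexps d. c m * mono_eval 4 m (Ivec T))"
proof -
  obtain d p where p: "hom_poly_fun d p" "b = restrict p St33"
    using B b unfolding minimal_integrity_basis_def homogeneous_on_def by blast
  have bP: "b \<in> polynomial_invariants St33 O3 tensor_act"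
    using B b unfolding minimal_integrity_basis_def integrity_basis_def by blast
  have "p (tensor_act g T) = p T" if "g \<in> O3" "T \<in> St33" for g T
  proof -
    have "b (tensor_act g T) = b T" using bP that unfolding polynomial_invariants_def by blast
    then show ?thesis using that(2) tensor_act_St33[OF that] by (simp add: p(2))
  qed
  from hom_invariant_generated[OF p(1) this] obtain c
    where "\<And>T. T \<in> St33 \<Longrightarrow> p T = (\<Sum>m\<in>Iexps d. c m * mono_eval 4 m (Ivec T))" by blast
  then show thesis using that[where d = d and c = c] p(2) by (simp cong: restrict_cong)
qed

text \<open>
  Otherwise the derivative at 0 in the direction of the \<open>k\<close>-th basic invariant vanishes on the
  members of \<open>B\<close>, hence on all that they generate, but it is 1 on that invariant itself.
\<close>

lemma minimal_basis_linear_member: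
  assumes B: "minimal_integrity_basis St33 O3 tensor_act B" and k: "k < 4"
  shows "\<exists>b c. b \<in> B \<and> b = (\<lambda>T\<in>St33. \<Sum>m\<in>Iexps (Ideg k). c m * mono_eval 4 m (Ivec T)) \<and> c (unit_exp k) \<noteq> 0"
proof (rule ccontr)
  assume no: "\<not> ?thesis"
  let ?e = "\<lambda>t::real. tup_of (\<lambda>j. t * of_bool (j = k))"
  \<comment> \<open>\<open>Q f\<close>: on the tensor space f is a polynomial in the basic
    invariants whose derivative at 0 along the k-th axis vanishes. The clause \<open>D = 0\<close>
    is kept separate so that the sum and product rules apply in unsimplified form.\<close>
  define Q where "Q f \<longleftrightarrow> (\<exists>P D. real_polynomial_function P \<and> (\<forall>T\<in>St33. f T = P (Itup T)) \<and>
      ((\<lambda>t. P (?e t)) has_real_derivative D) (at 0) \<and> D = 0)" for f :: "tensor333 \<Rightarrow> real"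
  have QB: "Q b" if b: "b \<in> B" for b
  proof -
    obtain d c where bdc: "b = (\<lambda>T\<in>St33. \<Sum>m\<in>Iexps d. c m * mono_eval 4 m (Ivec T))"
      using minimal_basis_member_form[OF B b] .
    let ?P = "\<lambda>y. \<Sum>m\<in>Iexps d. c m * mono_eval 4 m (tup y)"
    have "((\<lambda>t. c m * mono_eval 4 m (tup (?e t))) has_real_derivative 0) (at 0)" if m: "m \<in> Iexps d" for m
    proof (cases "m = unit_exp k")
      case True
      then have "d = Ideg k" using m unit_exp_Iexps[OF k] by simp
      then have "c m = 0" using no b bdc True by blast
      then show ?thesis by simp
    next
      case False
      then show ?thesis
        unfolding mono_eval_tup_of using DERIV_cmult[OF mono_eval_line_derivative[OF k m False], of "c m"] by simp
    qed
    then have "((\<lambda>t. ?P (?e t)) has_real_derivative (\<Sum>m\<in>Iexps d. 0)) (at 0)"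
      by (intro DERIV_sum)
    moreover have "real_polynomial_function ?P"
      unfolding mono_eval_def
      by (intro real_polynomial_function_sum real_polynomial_function_prod real_polynomial_function.intros(4)
          real_polynomial_function.intros(2) real_polynomial_function_power real_polynomial_function_tup finite_Iexps) auto
    moreover have "b T = ?P (Itup T)" if "T \<in> St33" for T
      using that mono_eval_tup_of[of _ "Ivec T"] by (simp add: bdc)
    ultimately show ?thesis unfolding Q_def by (intro exI[of _ ?P] exI[of _ "\<Sum>m\<in>Iexps d. 0"]) simp
  qed
  have "Q f" if "f \<in> genalg B" for f
    using that
  proof (induction rule: generated_algebra.induct)
    case (const c)
    show ?case unfolding Q_def by (intro exI[of _ "\<lambda>_. c"] exI[of _ 0]) auto
  next
    case (add f g)
    then obtain P R where "real_polynomial_function P" "\<forall>T\<in>St33. f T = P (Itup T)"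
      "((\<lambda>t. P (?e t)) has_real_derivative 0) (at 0)" "real_polynomial_function R" "\<forall>T\<in>St33. g T = R (Itup T)"
      "((\<lambda>t. R (?e t)) has_real_derivative 0) (at 0)" unfolding Q_def by blast
    then show ?case unfolding Q_def
      by (intro exI[of _ "\<lambda>y. P y + R y"] exI[of _ "0 + 0"] conjI DERIV_add real_polynomial_function.intros(3)) auto
  next
    case (mult f g)
    then obtain P R where "real_polynomial_function P" "\<forall>T\<in>St33. f T = P (Itup T)"
      "((\<lambda>t. P (?e t)) has_real_derivative 0) (at 0)" "real_polynomial_function R" "\<forall>T\<in>St33. g T = R (Itup T)"
      "((\<lambda>t. R (?e t)) has_real_derivative 0) (at 0)" unfolding Q_def by blast
    then show ?case unfolding Q_def
      by (intro exI[of _ "\<lambda>y. P y * R y"] exI[of _ "0 * R (?e 0) + 0 * P (?e 0)"] conjI DERIV_mult real_polynomial_function.intros(4)) auto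
  qed (use QB in auto)
  moreover have "(\<lambda>T\<in>St33. Ivec T k) \<in> genalg B"
    using B Ivec_polynomial_invariant[OF k] unfolding minimal_integrity_basis_def integrity_basis_def by simp
  ultimately have "Q (\<lambda>T\<in>St33. Ivec T k)" by blast
  then obtain P where P: "real_polynomial_function P" "\<And>T. T \<in> St33 \<Longrightarrow> Ivec T k = P (Itup T)"
      "((\<lambda>t. P (?e t)) has_real_derivative 0) (at 0)" unfolding Q_def by auto
  obtain u where u: "u \<in> interior (Itup ` St33)" using interior_Itup_image by blast
  \<comment> \<open>P is known to equal the k-th coordinate only on the image, and 0 is not interior
    to it since I2 is nonnegative. The identity is therefore carried from the open part to all of
    4-space before it is used at 0.\<close>
  have "P y + (-1) * tup y k = 0" for y
  proof (rule real_polynomial_function_eq_0[where U = "interior (Itup ` St33)"])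
    show "real_polynomial_function (\<lambda>y. P y + (-1) * tup y k)"
      by (intro real_polynomial_function.intros P(1) real_polynomial_function_tup[OF k])
    show "P y + (-1) * tup y k = 0" if y: "y \<in> interior (Itup ` St33)" for y
    proof -
      obtain T where "T \<in> St33" "y = Itup T" using subsetD[OF interior_subset y] by blast
      then show ?thesis using P(2)[of T] tup_of_tup[OF k, of "Ivec T"] by simp
    qed
  qed (use u in auto)
  then have "P (?e t) = t" for t using tup_of_tup[OF k, of "\<lambda>j. t * of_bool (j = k)"] by (simp add: algebra_simps)
  with P(3) have "((\<lambda>t. t) has_real_derivative 0) (at (0::real))" by simp
  from DERIV_unique[OF this DERIV_ident] show False by simp
qed

text \<open>The map with components c_j y_j + q_j(y) is triangular, so its equations can be solved
  one coordinate after another. Y is the preimage of a line parallel to the k-th axis; its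
  continuity will keep it inside the open part of the image for small t.\<close>

lemma triangular_path:
  fixes c :: "nat \<Rightarrow> real" and q :: "nat \<Rightarrow> (nat \<Rightarrow> real) \<Rightarrow> real"
  assumes c: "\<And>j. j < n \<Longrightarrow> c j \<noteq> 0"
    and cong: "\<And>j x y. j < n \<Longrightarrow> (\<And>i. i < j \<Longrightarrow> x i = y i) \<Longrightarrow> q j x = q j y"
    and cont: "\<And>j Y. j < n \<Longrightarrow> (\<And>i. i < j \<Longrightarrow> continuous_on UNIV (\<lambda>t::real. Y t i)) \<Longrightarrow> continuous_on UNIV (\<lambda>t. q j (Y t))"
  shows "\<exists>Y. (\<forall>j<n. continuous_on UNIV (\<lambda>t::real. Y t j) \<and> Y 0 j = y j \<and>
    (\<forall>t. c j * Y t j + q j (Y t) = c j * y j + q j y + t * of_bool (j = k)))"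
  using assms
proof (induction n)
  case (Suc n)
  have "\<exists>Y. (\<forall>j<n. continuous_on UNIV (\<lambda>t::real. Y t j) \<and> Y 0 j = y j \<and>
    (\<forall>t. c j * Y t j + q j (Y t) = c j * y j + q j y + t * of_bool (j = k)))"
  proof (rule Suc.IH)
    show "c j \<noteq> 0" if "j < n" for j
      using Suc.prems(1) less_SucI[OF that] .
    show "q j x = q j y" if "j < n" "\<And>i. i < j \<Longrightarrow> x i = y i" for j x y
      using Suc.prems(2)[OF less_SucI[OF that(1)] that(2)] .
    show "continuous_on UNIV (\<lambda>t. q j (Y t))" if "j < n" "\<And>i. i < j \<Longrightarrow> continuous_on UNIV (\<lambda>t::real. Y t i)" for j Y
      using Suc.prems(3)[OF less_SucI[OF that(1)] that(2)] .
  qed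
  then obtain Y where Y: "\<And>j. j < n \<Longrightarrow> continuous_on UNIV (\<lambda>t::real. Y t j)" "\<And>j. j < n \<Longrightarrow> Y 0 j = y j"
    "\<And>j t. j < n \<Longrightarrow> c j * Y t j + q j (Y t) = c j * y j + q j y + t * of_bool (j = k)"
    by blast
  define Z where "Z t = (Y t)(n := (c n * y n + q n y + t * of_bool (n = k) - q n (Y t)) / c n)" for t
  have qZ: "q j (Z t) = q j (Y t)" if "j \<le> n" for j t
    using that by (intro Suc.prems(2)) (auto simp: Z_def)
  have q0: "q n (Y 0) = q n y" by (intro Suc.prems(2)) (auto simp: Y(2))
  have "c n \<noteq> 0" using Suc.prems(1) by simp
  have "continuous_on UNIV (\<lambda>t. Z t j) \<and> Z 0 j = y j \<and>
      (\<forall>t. c j * Z t j + q j (Z t) = c j * y j + q j y + t * of_bool (j = k))" if "j < Suc n" for j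
  proof (cases "j = n")
    case True
    have "continuous_on UNIV (\<lambda>t. q n (Y t))" by (intro Suc.prems(3) Y(1)) auto
    then have "continuous_on UNIV (\<lambda>t. Z t n)"
      using \<open>c n \<noteq> 0\<close> by (auto simp: Z_def intro!: continuous_intros)
    then show ?thesis
      using \<open>c n \<noteq> 0\<close> unfolding True qZ[OF order_refl] by (simp add: Z_def q0)
  next
    case False
    with that have "j < n" by simp
    then show ?thesis
      using Y[OF \<open>j < n\<close>] qZ[of j] by (simp add: Z_def)
  qed
  then show ?case by blast
qed auto

text \<open>One member of each degree with nonzero linear coefficient is available. Solving upwards
  in k recovers every basic invariant from these four, so they generate, and minimality leaves room
  for no further member.\<close>

lemma minimal_basis_structure:
  assumes B: "minimal_integrity_basis St33 O3 tensor_act B"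
  obtains f c q where "B = f ` {..<4}" "\<And>k T. k < 4 \<Longrightarrow> T \<in> St33 \<Longrightarrow> f k T = c k * Ivec T k + q k (Ivec T)"
    "\<And>k. k < 4 \<Longrightarrow> c k \<noteq> (0::real)"
    "\<And>j x y. j < 4 \<Longrightarrow> (\<And>i. i < j \<Longrightarrow> x i = y i) \<Longrightarrow> q j x = q j y"
    "\<And>j Y. j < 4 \<Longrightarrow> (\<And>i. i < j \<Longrightarrow> continuous_on UNIV (\<lambda>t::real. Y t i)) \<Longrightarrow> continuous_on UNIV (\<lambda>t. q j (Y t))"
proof -
  obtain f a where f: "\<And>k. k < 4 \<Longrightarrow> f k \<in> B"
    "\<And>k. k < 4 \<Longrightarrow> f k = (\<lambda>T\<in>St33. \<Sum>m\<in>Iexps (Ideg k). a k m * mono_eval 4 m (Ivec T))"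
    "\<And>k. k < 4 \<Longrightarrow> a k (unit_exp k) \<noteq> 0"
  proof -
    have "\<forall>k. \<exists>b c. k < 4 \<longrightarrow> b \<in> B \<and> b = (\<lambda>T\<in>St33. \<Sum>m\<in>Iexps (Ideg k). c m * mono_eval 4 m (Ivec T)) \<and> c (unit_exp k) \<noteq> 0"
      using minimal_basis_linear_member[OF B] by blast
    from choice[OF this] obtain f where
      "\<forall>k. \<exists>c. k < 4 \<longrightarrow> f k \<in> B \<and> f k = (\<lambda>T\<in>St33. \<Sum>m\<in>Iexps (Ideg k). c m * mono_eval 4 m (Ivec T)) \<and> c (unit_exp k) \<noteq> 0" ..
    from choice[OF this] obtain a where
      "\<forall>k. k < 4 \<longrightarrow> f k \<in> B \<and> f k = (\<lambda>T\<in>St33. \<Sum>m\<in>Iexps (Ideg k). a k m * mono_eval 4 m (Ivec T)) \<and> a k (unit_exp k) \<noteq> 0" ..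
    then show thesis using that[of f a] by blast
  qed
  let ?M = "\<lambda>k. Iexps (Ideg k) - {unit_exp k}"
  define c where "c k = a k (unit_exp k)" for k
  \<comment> \<open>The product runs over j < k only, so that dependence on earlier coordinates and
    continuity are visible for arbitrary arguments, not just for values of the invariants.\<close>
  define q where "q k y = (\<Sum>m\<in>?M k. a k m * (\<Prod>j<k. y j ^ m j))" for k and y :: "nat \<Rightarrow> real"
  have lower: "mono_eval 4 m y = (\<Prod>j<k. y j ^ m j)" if "k < 4" "m \<in> ?M k" for k m and y :: "nat \<Rightarrow> real"
    unfolding mono_eval_def using that Iexps_Ideg_lower[of k m] by (intro prod.mono_neutral_right) auto
  have fk: "f k T = c k * Ivec T k + q k (Ivec T)" if k: "k < 4" and T: "T \<in> St33" for k T
  proof -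
    have "unit_exp k \<in> Iexps (Ideg k)" using unit_exp_Iexps[OF k] by simp
    then have "f k T = a k (unit_exp k) * mono_eval 4 (unit_exp k) (Ivec T) + (\<Sum>m\<in>?M k. a k m * mono_eval 4 m (Ivec T))"
      using T by (simp add: f(2)[OF k] sum.remove finite_Iexps)
    moreover have "mono_eval 4 (unit_exp k) y = y k" for y :: "nat \<Rightarrow> real"
      using k by (simp add: mono_eval_def unit_exp_def of_bool_def if_distrib[of "\<lambda>k. _ ^ k"] cong: if_cong)
    moreover have "(\<Sum>m\<in>?M k. a k m * mono_eval 4 m (Ivec T)) = q k (Ivec T)"
      unfolding q_def using lower[OF k] by (intro sum.cong) auto
    ultimately show ?thesis by (simp add: c_def)
  qed
  have cnz: "c k \<noteq> 0" if "k < 4" for k using f(3)[OF that] by (simp add: c_def)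
  have Ialg: "k < 4 \<Longrightarrow> (\<lambda>T\<in>St33. Ivec T k) \<in> genalg (f ` {..<4})" for k
  proof (induction k rule: less_induct)
    case (less k)
    have "(\<lambda>T\<in>St33. q k (Ivec T)) \<in> genalg (f ` {..<4})"
      unfolding q_def
      by (intro genalg_sum genalg_cmult genalg_prod genalg_power less.IH) (use less.prems in auto)
    from genalg_cmult[OF this, of "-1"]
    have q: "(\<lambda>T\<in>St33. - q k (Ivec T)) \<in> genalg (f ` {..<4})" by simp
    have fa: "f k \<in> genalg (f ` {..<4})" using less.prems by (intro generated_algebra.gen) auto
    have "(\<lambda>T\<in>St33. f k T) = f k" using f(2)[OF less.prems] by auto
    then have "(\<lambda>T\<in>St33. 1 / c k * (f k T + - q k (Ivec T))) \<in> genalg (f ` {..<4})"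
      using fa q by (intro genalg_cmult genalg_add) metis+
    moreover have "(\<lambda>T\<in>St33. 1 / c k * (f k T + - q k (Ivec T))) = (\<lambda>T\<in>St33. Ivec T k)"
      by (rule restrict_ext) (simp add: fk[OF less.prems] cnz[OF less.prems])
    ultimately show ?case by (simp only:)
  qed
  have "B = f ` {..<4}"
  proof
    show "B \<subseteq> f ` {..<4}"
    proof
      fix b assume b: "b \<in> B"
      obtain d e where bde: "b = (\<lambda>T\<in>St33. \<Sum>m\<in>Iexps d. e m * mono_eval 4 m (Ivec T))"
        using minimal_basis_member_form[OF B b] .
      have "b \<in> genalg (f ` {..<4})"
        unfolding bde mono_eval_def by (intro genalg_sum genalg_cmult genalg_prod genalg_power Ialg) auto
      moreover have "b \<notin> genalg (B - {b})"
        using B b unfolding minimal_integrity_basis_def by blast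
      \<comment> \<open>If b were none of the four, they would lie in \<open>B - {b}\<close> and
        already generate b.\<close>
      ultimately have "\<not> f ` {..<4} \<subseteq> B - {b}" using genalg_mono by blast
      then show "b \<in> f ` {..<4}" using f(1) by auto
    qed
  qed (use f(1) in auto)
  then show thesis
  proof (rule that[OF _ fk cnz])
    show "q j x = q j y" if "\<And>i. i < j \<Longrightarrow> x i = y i" for j x y
      unfolding q_def using that by simp
    show "continuous_on UNIV (\<lambda>t. q j (Y t))" if "\<And>i. i < j \<Longrightarrow> continuous_on UNIV (\<lambda>t::real. Y t i)" for j Y
      unfolding q_def using that by (intro continuous_intros) auto
  qed
qed

theorem minimal_basis_irreducible:
  assumes B: "minimal_integrity_basis St33 O3 tensor_act B" and b: "b \<in> B"
  shows "\<not> function_of St33 (B - {b}) b"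
proof
  assume "function_of St33 (B - {b}) b"
  then obtain \<phi> where \<phi>: "\<And>v. v \<in> St33 \<Longrightarrow> b v = \<phi> (\<lambda>f\<in>B - {b}. f v)"
    unfolding function_of_def by blast
  show False
  proof (rule minimal_basis_structure[OF B])
    fix f c and q :: "nat \<Rightarrow> (nat \<Rightarrow> real) \<Rightarrow> real"
    assume f: "B = f ` {..<4}" "\<And>k T. k < 4 \<Longrightarrow> T \<in> St33 \<Longrightarrow> f k T = c k * Ivec T k + q k (Ivec T)"
      and c: "\<And>k. k < 4 \<Longrightarrow> c k \<noteq> (0::real)"
      and q: "\<And>j x y. j < 4 \<Longrightarrow> (\<And>i. i < j \<Longrightarrow> x i = y i) \<Longrightarrow> q j x = q j y"
    "\<And>j Y. j < 4 \<Longrightarrow> (\<And>i. i < j \<Longrightarrow> continuous_on UNIV (\<lambda>t::real. Y t i)) \<Longrightarrow> continuous_on UNIV (\<lambda>t. q j (Y t))"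
    obtain k where k: "k < 4" "b = f k" using b f(1) by auto
    obtain v where v: "v \<in> St33" "Itup v \<in> interior (Itup ` St33)"
      using interior_Itup_image interior_subset by blast
    obtain Y where Y: "\<And>j. j < 4 \<Longrightarrow> continuous_on UNIV (\<lambda>t::real. Y t j)" "\<And>j. j < 4 \<Longrightarrow> Y 0 j = Ivec v j"
      "\<And>j t. j < 4 \<Longrightarrow> c j * Y t j + q j (Y t) = c j * Ivec v j + q j (Ivec v) + t * of_bool (j = k)"
      using triangular_path[where n = 4 and c = c and q = q and y = "Ivec v" and k = k, OF c q] by blast
    have "open ((\<lambda>t. tup_of (Y t)) -` interior (Itup ` St33))"
      unfolding tup_of_def by (rule open_vimage) (auto intro!: continuous_on_Pair Y(1))
    moreover have "tup_of (Y 0) = Itup v"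
      unfolding tup_of_Ivec[symmetric] by (simp add: tup_of_def Y(2))
    ultimately obtain e where e: "e > 0" "ball 0 e \<subseteq> (\<lambda>t. tup_of (Y t)) -` interior (Itup ` St33)"
      using v(2) unfolding open_contains_ball by (metis vimage_eq)
    \<comment> \<open>A point of the path other than its start that still lies in the image: its
      preimage w agrees with v on all members except b, where the values differ by e / 2.\<close>
    have "tup_of (Y (e / 2)) \<in> Itup ` St33"
      using e interior_subset by (force simp: subset_iff)
    then obtain w where w: "w \<in> St33" "Itup w = tup_of (Y (e / 2))" by auto
    have wY: "Ivec w j = Y (e / 2) j" if "j < 4" for j
      using arg_cong[OF w(2), of "\<lambda>y. tup y j"] tup_of_tup[OF that, of "Ivec w"] tup_of_tup[OF that] by simp
    have fw: "f j w = f j v + e / 2 * of_bool (j = k)" if "j < 4" for j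
    proof -
      have "q j (Ivec w) = q j (Y (e / 2))" by (rule q(1)[OF that]) (use that wY in auto)
      then show ?thesis using Y(3)[OF that, of "e / 2"] f(2)[OF that] v(1) w(1) wY[OF that] by simp
    qed
    have "(\<lambda>f\<in>B - {b}. f w) = (\<lambda>f\<in>B - {b}. f v)"
    proof (rule restrict_ext)
      fix h assume "h \<in> B - {b}"
      then obtain j where "j < 4" "h = f j" "j \<noteq> k" using f(1) k(2) by auto
      then show "h w = h v" using fw by simp
    qed
    then have "b w = b v" using \<phi>[OF v(1)] \<phi>[OF w(1)] by simp
    then show False using fw[OF k(1)] k(2) e(1) by simp
  qed
qed

section \<open>Separation of orbits\<close>

lemma absolutely_integrable_continuous_compact:
  fixes f :: "'a::euclidean_space \<Rightarrow> 'b::euclidean_space"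
  assumes "compact K" "continuous_on K f"
  shows "f absolutely_integrable_on K"
proof -
  have "integrable lborel (\<lambda>x. indicator K x *\<^sub>R f x)"
    using assms by (rule borel_integrable_compact)
  then show ?thesis
    by (simp add: set_integrable_def integrable_completion borel_measurable_integrable)
qed

lemma integrable_continuous_compact:
  fixes f :: "'a::euclidean_space \<Rightarrow> 'b::euclidean_space"
  assumes "compact K" "continuous_on K f"
  shows "f integrable_on K"
  using absolutely_integrable_continuous_compact[OF assms] set_lebesgue_integral_eq_integral(1) by blast

lemma integral_pos_continuous:
  fixes f :: "'a::euclidean_space \<Rightarrow> real"
  assumes "compact K" "continuous_on K f" "\<And>x. x \<in> K \<Longrightarrow> f x \<ge> 0" "a \<in> interior K" "f a > 0"
  shows "integral K f > 0"
proof -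
  have "continuous_on (interior K) f"
    using assms(2) interior_subset by (rule continuous_on_subset)
  then have "open (interior K \<inter> f -` {f a / 2<..})"
    by (intro continuous_open_preimage) auto
  moreover have "a \<in> interior K \<inter> f -` {f a / 2<..}"
    using assms(4,5) by auto
  ultimately obtain l u where lu: "a \<in> box l u" "cbox l u \<subseteq> interior K \<inter> f -` {f a / 2<..}"
    using open_contains_cbox by metis
  have "0 < measure lborel (cbox l u)"
    using lu(1) content_pos_lt_eq[of l u] by (auto simp: box_def intro: order.strict_trans)
  then have "0 < integral (cbox l u) (\<lambda>_. f a / 2)"
    using assms(5) by simp
  also have "\<dots> \<le> integral (cbox l u) f"
    using lu(2) interior_subset[of K]
    by (intro integral_le integrable_continuous_compact continuous_on_subset[OF assms(2)]) (auto simp: subset_iff intro: less_imp_le)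
  also have "\<dots> \<le> integral K f"
    using lu(2) interior_subset[of K] assms(1,2,3)
    by (intro integral_subset_le integrable_continuous_compact continuous_on_subset[OF assms(2)]) (auto simp: subset_iff)
  finally show ?thesis .
qed

lemma integral_orthogonal_transformation:
  fixes f :: "real^'n::{finite,wellorder} \<Rightarrow> real"
  assumes K: "compact K" "continuous_on K f" and g: "orthogonal_transformation g" "g ` K = K"
  shows "integral K (\<lambda>x. f (g x)) = integral K f"
proof -
  \<comment> \<open>The linear change of variables is applied to functions into 1-space; taking
    component 1 returns to the scalar function.\<close>
  let ?F = "\<lambda>x. (\<chi> i::1. f x)"
  have lin: "linear g" using g(1) by (rule orthogonal_transformation_linear)
  have cF: "continuous_on K ?F" using K(2) by (intro continuous_intros)
  have "\<bar>det (matrix g)\<bar> = 1"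
    using det_orthogonal_matrix[of "matrix g"] g(1) by (auto simp: orthogonal_transformation_matrix)
  then have "integral K ?F = integral K (?F \<circ> g)"
    using integral_change_of_variables_linear[OF lin, where f = ?F and S = K] absolutely_integrable_continuous_compact[OF K(1) cF]
    by (simp add: g(2))
  moreover have "integral K f = integral K ?F $ 1"
    using integral_component_eq_cart[where f = ?F and s = K and k = 1] integrable_continuous_compact[OF K(1) cF] by simp
  moreover have "continuous_on K (?F \<circ> g)"
    using cF g(2) lin by (intro continuous_on_compose) (auto simp: linear_continuous_on linear_linear)
  then have "integral K (\<lambda>x. f (g x)) = integral K (?F \<circ> g) $ 1"
    using integral_component_eq_cart[where f = "?F \<circ> g" and s = K and k = 1] integrable_continuous_compact[OF K(1), of "?F \<circ> g"] by (simp add: o_def)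
  ultimately show ?thesis by simp
qed

section \<open>Matrices near the orthogonal group\<close>

lemma tensor_act_mult: "tensor_act A (tensor_act B T) = tensor_act (A ** B) T"
proof -
  have nested: "tensor_act A T $ i $ j $ k = (\<Sum>a\<in>UNIV. A$i$a * (\<Sum>b\<in>UNIV. A$j$b * (\<Sum>c\<in>UNIV. A$k$c * T$a$b$c)))" for A T i j k
    by (simp add: tensor_act_def sum_distrib_left mult.assoc)
  have push: "(\<Sum>c\<in>UNIV. P c * (\<Sum>d\<in>UNIV. Q d * Y c d)) = (\<Sum>d\<in>UNIV. Q d * (\<Sum>c\<in>UNIV. P c * Y c d))"
    for P Q :: "3 \<Rightarrow> real" and Y
    unfolding sum_distrib_left by (subst sum.swap) (simp only: mult.left_commute)
  have comp: "(\<Sum>c\<in>UNIV. A$k$c * (\<Sum>f\<in>UNIV. B$c$f * X f)) = (\<Sum>f\<in>UNIV. (A ** B)$k$f * X f)" for k X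
    unfolding sum_distrib_left matrix_matrix_mult_def vec_lambda_beta sum_distrib_right
    by (subst sum.swap) (simp only: mult.assoc)
  have "tensor_act A (tensor_act B T) $ i $ j $ k = tensor_act (A ** B) T $ i $ j $ k" for i j k
  proof -
    have "(\<Sum>c\<in>UNIV. A$k$c * tensor_act B T $ a $ b $ c) =
        (\<Sum>d\<in>UNIV. B$a$d * (\<Sum>e\<in>UNIV. B$b$e * (\<Sum>f\<in>UNIV. (A ** B)$k$f * T$d$e$f)))" for a b
      unfolding nested push[of "\<lambda>c. A$k$c"] comp ..
    then have "(\<Sum>b\<in>UNIV. A$j$b * (\<Sum>c\<in>UNIV. A$k$c * tensor_act B T $ a $ b $ c)) =
        (\<Sum>d\<in>UNIV. B$a$d * (\<Sum>e\<in>UNIV. (A ** B)$j$e * (\<Sum>f\<in>UNIV. (A ** B)$k$f * T$d$e$f)))" for a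
      by (simp only: push[of "\<lambda>b. A$j$b"] comp)
    then show ?thesis by (simp only: nested[of A "tensor_act B T"] comp nested[of "A ** B"])
  qed
  then show ?thesis by (simp add: vec_eq_iff)
qed

lemma linear_tensor_act: "linear (tensor_act A)"
  by (rule linearI) (simp_all add: tensor_act_def vec_eq_iff distrib_left sum.distrib sum_distrib_left mult_ac)

lemma continuous_tensor_act: "continuous_on S (\<lambda>A. tensor_act A T)"
  unfolding tensor_act_def by (intro continuous_intros)

lemma norm_matrix_mult_orthogonal:
  fixes A :: "real^3^3"
  assumes "orthogonal_matrix h"
  shows "norm (A ** h) = norm A"
proof -
  have "(A ** h) $ i = transpose h *v (A $ i)" for i
    by (simp add: vec_eq_iff matrix_matrix_mult_def matrix_vector_mult_def transpose_def mult.commute)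
  moreover have "norm (transpose h *v x) = norm x" for x
    using assms orthogonal_matrix_transpose orthogonal_transformation_matrix
    by (metis orthogonal_transformation_norm matrix_of_matrix_vector_mul matrix_vector_mul_linear)
  ultimately show ?thesis by (simp add: norm_vec_def)
qed

text \<open>
  Integration over this compact neighbourhood of the orthogonal group, which is stable under right
  multiplication by orthogonal matrices, replaces integration over the group.
\<close>

definition near_orthogonal :: "real \<Rightarrow> (real^3^3) set" where
  "near_orthogonal \<delta> = {A. norm (A ** transpose A - mat 1) \<le> \<delta>}"

lemma continuous_matrix_transpose: "continuous_on S (\<lambda>A::real^3^3. A ** transpose A - mat 1)"
  unfolding matrix_matrix_mult_def transpose_def by (intro continuous_intros)

lemma compact_near_orthogonal: "compact (near_orthogonal \<delta>)"
proof -
  have "near_orthogonal \<delta> = (\<lambda>A. A ** transpose A - mat 1) -` cball 0 \<delta>"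
    by (auto simp: near_orthogonal_def)
  then have "closed (near_orthogonal \<delta>)"
    using closed_vimage[OF closed_cball continuous_matrix_transpose] by simp
  moreover have "bounded (near_orthogonal \<delta>)"
    unfolding bounded_iff
  proof (intro exI ballI)
    fix A assume A: "A \<in> near_orthogonal \<delta>"
    have "norm (A $ i) \<le> 1 + \<delta>" for i
    proof -
      \<comment> \<open>The diagonal entries of A A^T are the squared row lengths; bounding them
        bounds the whole matrix.\<close>
      have "(A ** transpose A) $ i $ i = norm (A $ i) ^ 2"
        by (simp add: matrix_matrix_mult_def transpose_def power2_norm_eq_inner inner_vec_def)
      moreover have "\<bar>(A ** transpose A - mat 1) $ i $ i\<bar> \<le> \<delta>"
        using A component_le_norm_cart order_trans Finite_Cartesian_Product.norm_nth_le
        unfolding near_orthogonal_def mem_Collect_eq by (metis real_norm_def)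
      ultimately have "norm (A $ i) ^ 2 \<le> 1 + \<delta>" by (simp add: mat_def)
      moreover have "norm (A $ i) \<le> 1 \<or> norm (A $ i) \<le> norm (A $ i) ^ 2"
        using self_le_power[of "norm (A $ i)" 2] by linarith
      moreover have "\<delta> \<ge> 0" using A norm_ge_zero order_trans unfolding near_orthogonal_def by blast
      ultimately show ?thesis by linarith
    qed
    then have "(\<Sum>i\<in>UNIV. norm (A $ i)) \<le> (\<Sum>i\<in>(UNIV::3 set). 1 + \<delta>)"
      by (rule sum_mono)
    then show "norm A \<le> 3 * (1 + \<delta>)"
      using L2_set_le_sum[of UNIV "\<lambda>i. norm (A $ i)"] by (simp add: norm_vec_def)
  qed
  ultimately show ?thesis by (simp add: compact_eq_bounded_closed)
qed

lemma near_orthogonal_mult: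
  assumes "orthogonal_matrix h"
  shows "A ** h \<in> near_orthogonal \<delta> \<longleftrightarrow> A \<in> near_orthogonal \<delta>"
proof -
  have "(A ** h) ** transpose (A ** h) = A ** (h ** transpose h) ** transpose A"
    by (simp only: matrix_transpose_mul matrix_mul_assoc)
  also have "h ** transpose h = mat 1" using assms by (simp add: orthogonal_matrix_def)
  finally show ?thesis by (simp add: near_orthogonal_def)
qed

lemma near_orthogonal_0: "A \<in> near_orthogonal 0 \<longleftrightarrow> A \<in> O3"
  by (auto simp: near_orthogonal_def O3_def orthogonal_matrix_def matrix_left_right_inverse)

lemma not_in_near_orbit:
  assumes "v \<notin> (\<lambda>g. tensor_act g w) ` O3"
  obtains \<delta> where "\<delta> > 0" "v \<notin> (\<lambda>A. tensor_act A w) ` near_orthogonal \<delta>"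
proof -
  \<comment> \<open>Defect of orthogonality plus distance from v. It vanishes only at an orthogonal
    matrix carrying w to v, so its minimum on the compact set is positive; half of that minimum,
    capped at 1, is a suitable radius.\<close>
  let ?f = "\<lambda>A. norm (A ** transpose A - mat 1) + norm (tensor_act A w - v)"
  have "continuous_on (near_orthogonal 1) ?f"
    by (intro continuous_intros continuous_matrix_transpose continuous_tensor_act)
  moreover have "mat 1 \<in> near_orthogonal 1" by (simp add: near_orthogonal_def)
  ultimately obtain A0 where A0: "A0 \<in> near_orthogonal 1" "\<And>A. A \<in> near_orthogonal 1 \<Longrightarrow> ?f A0 \<le> ?f A"
    using continuous_attains_inf[OF compact_near_orthogonal[of 1], of ?f] by blast
  have "?f A0 > 0"
  proof (rule ccontr)
    assume "\<not> ?f A0 > 0"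
    moreover have "norm (A0 ** transpose A0 - mat 1) \<ge> 0" "norm (tensor_act A0 w - v) \<ge> 0" by simp_all
    ultimately have "norm (A0 ** transpose A0 - mat 1) = 0" "norm (tensor_act A0 w - v) = 0" by linarith+
    then have "A0 \<in> O3" "tensor_act A0 w = v"
      using near_orthogonal_0[of A0] by (simp_all add: near_orthogonal_def)
    then show False using assms by blast
  qed
  show thesis
  proof (rule that[of "min 1 (?f A0 / 2)"])
    show "v \<notin> (\<lambda>A. tensor_act A w) ` near_orthogonal (min 1 (?f A0 / 2))"
    proof
      assume "v \<in> (\<lambda>A. tensor_act A w) ` near_orthogonal (min 1 (?f A0 / 2))"
      then obtain A where A: "A \<in> near_orthogonal (min 1 (?f A0 / 2))" "v = tensor_act A w" by blast
      define x y where "x = ?f A0" and "y = ?f A"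
      have "x \<le> y" "y \<le> x / 2"
        using A A0(2)[of A] unfolding x_def y_def by (auto simp: near_orthogonal_def)
      moreover have "x > 0" using \<open>?f A0 > 0\<close> by (simp only: x_def)
      ultimately show False by linarith
    qed
  qed (use \<open>?f A0 > 0\<close> in simp)
qed


text \<open>Separation of variables: with the dependence on A and on T split into finitely many
  products, integrating over A leaves a polynomial in T.\<close>

lemma real_polynomial_act_expansion:
  fixes p :: "tensor333 \<Rightarrow> real"
  assumes "real_polynomial_function p"
  shows "\<exists>cs. (\<forall>(c, m)\<in>set cs. continuous_on UNIV c \<and> real_polynomial_function m) \<and>
    (\<forall>A T. p (tensor_act A T) = (\<Sum>(c, m)\<leftarrow>cs. c A * m T))"
  using assms
proof (induction rule: real_polynomial_function.induct)
  case (linear f)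
  interpret f: bounded_linear f by fact
  obtain bs :: "tensor333 list" where bs: "set bs = Basis" "distinct bs"
    using finite_distinct_list[OF finite_Basis] by blast
  have e: "f (tensor_act A T) = (\<Sum>b\<leftarrow>bs. f (tensor_act A b) * (T \<bullet> b))" for A T
  proof -
    have "f (tensor_act A T) = f (tensor_act A (\<Sum>b\<in>Basis. (T \<bullet> b) *\<^sub>R b))"
      by (simp add: euclidean_representation)
    also have "\<dots> = (\<Sum>b\<in>Basis. f (tensor_act A b) * (T \<bullet> b))"
      by (simp add: linear_sum[OF linear_tensor_act] linear_scale[OF linear_tensor_act] f.sum f.scaleR mult.commute)
    finally show ?thesis using bs by (simp add: sum_list_distinct_conv_sum_set)
  qed
  have c: "continuous_on UNIV (\<lambda>A. f (tensor_act A b))" for b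
    using continuous_on_compose2[OF linear_continuous_on[OF linear, of UNIV] continuous_tensor_act[of UNIV b]] by simp
  have m: "real_polynomial_function (\<lambda>T::tensor333. T \<bullet> b)" for b
    by (intro real_polynomial_function.intros(1) bounded_linear_inner_left)
  show ?case
  proof (intro exI[of _ "map (\<lambda>b. (\<lambda>A. f (tensor_act A b), \<lambda>T. T \<bullet> b)) bs"] conjI allI)
    fix A T
    show "f (tensor_act A T) = (\<Sum>(c, m)\<leftarrow>map (\<lambda>b. (\<lambda>A. f (tensor_act A b), \<lambda>T. T \<bullet> b)) bs. c A * m T)"
      using e[of A T] by (simp add: o_def)
  qed (use c m in auto)
next
  case (const c)
  show ?case by (intro exI[of _ "[(\<lambda>_. c, \<lambda>_. 1)]"]) auto
next
  case (add f g)
  then obtain cs ds where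
    "\<forall>(c, m)\<in>set cs. continuous_on UNIV c \<and> real_polynomial_function m" "\<forall>A T. f (tensor_act A T) = (\<Sum>(c, m)\<leftarrow>cs. c A * m T)"
    "\<forall>(c, m)\<in>set ds. continuous_on UNIV c \<and> real_polynomial_function m" "\<forall>A T. g (tensor_act A T) = (\<Sum>(c, m)\<leftarrow>ds. c A * m T)"
    by blast
  then show ?case by (intro exI[of _ "cs @ ds"]) auto
next
  case (mult f g)
  then obtain cs ds where
    cs: "\<forall>(c, m)\<in>set cs. continuous_on UNIV c \<and> real_polynomial_function m" "\<forall>A T. f (tensor_act A T) = (\<Sum>(c, m)\<leftarrow>cs. c A * m T)" and
    ds: "\<forall>(c, m)\<in>set ds. continuous_on UNIV c \<and> real_polynomial_function m" "\<forall>A T. g (tensor_act A T) = (\<Sum>(c, m)\<leftarrow>ds. c A * m T)"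
    by blast
  let ?es = "concat (map (\<lambda>(c, m). map (\<lambda>(c', m'). (\<lambda>A. c A * c' A, \<lambda>T. m T * m' T)) ds) cs)"
  have 1: "(\<Sum>(c, m)\<leftarrow>map (\<lambda>(c', m'). (\<lambda>A. c A * c' A, \<lambda>T. m T * m' T)) ds'. c A * m T)
      = c A * m T * (\<Sum>(c, m)\<leftarrow>ds'. c A * m T)" for ds' :: "((real^3^3 \<Rightarrow> real) \<times> (tensor333 \<Rightarrow> real)) list" and c m A T
    by (induction ds') (auto simp: algebra_simps)
  have "(\<Sum>(c, m)\<leftarrow>concat (map (\<lambda>(c, m). map (\<lambda>(c', m'). (\<lambda>A. c A * c' A, \<lambda>T. m T * m' T)) ds) cs'). c A * m T)
      = (\<Sum>(c, m)\<leftarrow>cs'. c A * m T) * (\<Sum>(c, m)\<leftarrow>ds. c A * m T)" for cs' :: "((real^3^3 \<Rightarrow> real) \<times> (tensor333 \<Rightarrow> real)) list" and A T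
    by (induction cs') (auto simp: 1 distrib_right simp del: map_map)
  then show ?case
    using cs ds by (intro exI[of _ ?es]) (auto intro!: continuous_intros real_polynomial_function.intros(4))
qed

lemma integral_act_polynomial:
  fixes L :: "real^9 \<Rightarrow> real^3^3"
  assumes "real_polynomial_function p" "compact K" "continuous_on UNIV L"
  shows "real_polynomial_function (\<lambda>T. integral K (\<lambda>a. p (tensor_act (L a) T)))"
proof -
  obtain cs where cs: "\<forall>(c, m)\<in>set cs. continuous_on UNIV c \<and> real_polynomial_function m"
    "\<And>A T. p (tensor_act A T) = (\<Sum>(c, m)\<leftarrow>cs. c A * m T)"
    using real_polynomial_act_expansion[OF assms(1)] by blast
  have cont: "continuous_on K (\<lambda>a. c (L a))" if "continuous_on UNIV c" for c :: "real^3^3 \<Rightarrow> real"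
    using continuous_on_compose2[OF that continuous_on_subset[OF assms(3) subset_UNIV]] by simp
  have "continuous_on K (\<lambda>a. \<Sum>(c, m)\<leftarrow>cs. c (L a) * m T) \<and>
      integral K (\<lambda>a. \<Sum>(c, m)\<leftarrow>cs. c (L a) * m T) = (\<Sum>(c, m)\<leftarrow>cs. integral K (\<lambda>a. c (L a)) * m T)" for T
    using cs(1)
  proof (induction cs)
    case (Cons x cs)
    obtain c m where x: "x = (c, m)" by (cases x)
    have c: "continuous_on K (\<lambda>a. c (L a) * m T)"
      using Cons.prems x by (intro continuous_on_mult continuous_on_const cont) auto
    have IH: "continuous_on K (\<lambda>a. \<Sum>(c, m)\<leftarrow>cs. c (L a) * m T)"
      "integral K (\<lambda>a. \<Sum>(c, m)\<leftarrow>cs. c (L a) * m T) = (\<Sum>(c, m)\<leftarrow>cs. integral K (\<lambda>a. c (L a)) * m T)"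
      using Cons by auto
    show ?case
      using continuous_on_add[OF c IH(1)] IH(2)
        integral_add[OF integrable_continuous_compact[OF assms(2) c] integrable_continuous_compact[OF assms(2) IH(1)]]
      by (simp add: x)
  qed simp
  moreover have "real_polynomial_function (\<lambda>T. \<Sum>(c, m)\<leftarrow>cs. integral K (\<lambda>a. c (L a)) * m T)"
    using cs(1)
  proof (induction cs)
    case (Cons x cs)
    obtain c m where x: "x = (c, m)" by (cases x)
    have "real_polynomial_function (\<lambda>T. integral K (\<lambda>a. c (L a)) * m T)"
      using Cons.prems by (intro real_polynomial_function.intros(4) real_polynomial_function.intros(2)) (simp add: x)
    from real_polynomial_function.intros(3)[OF this] Cons show ?case by (simp add: x)
  qed (simp add: real_polynomial_function.intros)
  ultimately show ?thesis by (simp add: cs(2))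
qed

text \<open>The distance to the compact set swept out from w is 0 at every moved copy of w but
  positive at v. A polynomial close to this distance keeps the two averages apart, and its average
  is invariant.\<close>

theorem polynomial_invariants_separate_orbits:
  assumes v: "v \<in> St33" and w: "w \<in> St33"
    and eq: "\<And>q. q \<in> polynomial_invariants St33 O3 tensor_act \<Longrightarrow> q v = q w"
  shows "\<exists>g\<in>O3. v = tensor_act g w"
proof (rule ccontr)
  assume "\<not> ?thesis"
  then have "v \<notin> (\<lambda>g. tensor_act g w) ` O3" by blast
  then obtain \<delta> where \<delta>: "\<delta> > 0" "v \<notin> (\<lambda>A. tensor_act A w) ` near_orthogonal \<delta>"
    by (rule not_in_near_orbit)
  let ?N = "near_orthogonal \<delta>"
  \<comment> \<open>An isometry between matrices and 9-space turns right multiplication by an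
    orthogonal matrix into an orthogonal transformation, under which Lebesgue integrals are
    invariant.\<close>
  obtain L :: "real^9 \<Rightarrow> real^3^3" and M where LM: "linear L" "linear M" "\<And>x. norm (L x) = norm x"
      "\<And>y. norm (M y) = norm y" "\<And>x. M (L x) = x" "\<And>y. L (M y) = y"
    by (rule isomorphisms_UNIV_UNIV[where 'M = "real^9" and 'N = "real^3^3"]) auto
  have contL: "continuous_on S L" and contM: "continuous_on T M" for S T
    using LM(1,2) by (simp_all add: linear_continuous_on linear_linear)
  define K where "K = M ` ?N"
  have K_iff: "a \<in> K \<longleftrightarrow> L a \<in> ?N" for a
    unfolding K_def by (metis LM(5,6) imageE imageI)
  have K: "compact K" unfolding K_def by (intro compact_continuous_image contM compact_near_orthogonal)
  have act: "continuous_on K (\<lambda>a. tensor_act (L a) T)" for T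
    using continuous_on_compose2[OF continuous_tensor_act[of UNIV T] contL[of K]] by simp
  let ?Kw = "(\<lambda>A. tensor_act A w) ` ?N"
  define f where "f y = infdist y ?Kw" for y
  \<comment> \<open>The approximation has to be good at all moved copies of v and w. Matrices that
    are only nearly orthogonal need not preserve tracelessness, so this set lies in the ambient
    tensor space.\<close>
  define C where "C = (\<lambda>a. tensor_act (L a) v) ` K \<union> (\<lambda>a. tensor_act (L a) w) ` K"
  have C: "compact C" unfolding C_def by (intro compact_Un compact_continuous_image act K)
  have one: "mat 1 \<in> ?N" using \<delta>(1) by (simp add: near_orthogonal_def)
  have Kw: "closed ?Kw" "?Kw \<noteq> {}"
    using one by (auto intro!: compact_imp_closed compact_continuous_image continuous_tensor_act compact_near_orthogonal)
  have contf: "continuous_on S f" for S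
    unfolding f_def by (intro continuous_intros)
  have contfv: "continuous_on K (\<lambda>a. f (tensor_act (L a) v))"
    using continuous_on_compose2[OF contf[of UNIV] act[of v]] by simp
  define c0 where "c0 = integral K (\<lambda>a. f (tensor_act (L a) v))"
  have "c0 > 0"
    unfolding c0_def
  proof (rule integral_pos_continuous[OF K contfv])
    show "f (tensor_act (L (M (mat 1))) v) > 0"
      using infdist_pos_not_in_closed[OF Kw] \<delta>(2) by (simp add: LM(6) f_def)
    let ?U = "(\<lambda>a. L a ** transpose (L a) - mat 1) -` ball 0 \<delta>"
    have "open ?U"
      using continuous_on_compose2[OF continuous_matrix_transpose[of UNIV] contL[of UNIV]]
      by (intro open_vimage) auto
    moreover have "M (mat 1) \<in> ?U" using \<delta>(1) by (simp add: LM(6))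
    moreover have "?U \<subseteq> K" by (auto simp: K_iff near_orthogonal_def)
    ultimately show "M (mat 1) \<in> interior K" by (rule interiorI)
  qed (simp add: f_def infdist_nonneg)
  define V where "V = integral K (\<lambda>_. 1::real)"
  have V: "V \<ge> 0" unfolding V_def by (intro integral_nonneg integrable_continuous_compact K) auto
  \<comment> \<open>Small enough for 2 \<epsilon> V < c0, the gap between the lower bound at v and
    the upper bound at w; the summand 1 avoids division by 0.\<close>
  define \<epsilon> where "\<epsilon> = c0 / (2 * V + 1)"
  have \<epsilon>: "\<epsilon> > 0" using \<open>c0 > 0\<close> V by (simp add: \<epsilon>_def)
  obtain p where p: "real_polynomial_function p" "\<And>y. y \<in> C \<Longrightarrow> \<bar>f y - p y\<bar> < \<epsilon>"
    using Stone_Weierstrass_real_polynomial_function[OF C contf \<epsilon>] by metis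
  have contp: "continuous_on K (\<lambda>a. p (tensor_act (L a) T))" for T
    using continuous_on_compose2[OF continuous_on_polymonial_function[of p UNIV] act[of T]] p(1)
    by (simp add: real_polynomial_function_eq)
  define R where "R T = integral K (\<lambda>a. p (tensor_act (L a) T))" for T
  have Rinv: "R (tensor_act h T) = R T" if h: "h \<in> O3" for h T
  proof -
    have oh: "orthogonal_matrix h" using h by (simp add: O3_def)
    \<comment> \<open>Acting with h before averaging amounts to the substitution A to A h, which
      maps the domain of integration onto itself.\<close>
    let ?g = "\<lambda>a. M (L a ** h)"
    have lin: "linear ?g"
    proof -
      have "linear (\<lambda>A::real^3^3. A ** h)"
        by (rule linearI) (simp_all add: matrix_matrix_mult_def vec_eq_iff distrib_right sum.distrib sum_distrib_left mult.assoc)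
      from linear_compose[OF linear_compose[OF LM(1) this] LM(2)] show ?thesis by (simp add: o_def)
    qed
    have "orthogonal_transformation ?g"
      unfolding orthogonal_transformation using lin by (simp add: LM(3,4) norm_matrix_mult_orthogonal[OF oh])
    moreover have "?g ` K = K"
    proof
      show "?g ` K \<subseteq> K" by (auto simp: K_iff LM(6) near_orthogonal_mult[OF oh])
      have oh': "orthogonal_matrix (transpose h)" using oh by (simp add: orthogonal_matrix_transpose)
      have "transpose h ** h = mat 1" using oh by (simp add: orthogonal_matrix)
      then have inv: "?g (M (L a ** transpose h)) = a" for a
        by (simp add: LM(5,6) flip: matrix_mul_assoc)
      show "K \<subseteq> ?g ` K"
      proof
        fix a assume "a \<in> K"
        then have "M (L a ** transpose h) \<in> K" by (simp add: K_iff LM(6) near_orthogonal_mult[OF oh'])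
        with inv[of a, symmetric] show "a \<in> ?g ` K" by (rule image_eqI)
      qed
    qed
    ultimately have "integral K (\<lambda>a. p (tensor_act (L (?g a)) T)) = R T"
      unfolding R_def by (rule integral_orthogonal_transformation[OF K contp])
    then show ?thesis by (simp add: R_def LM(6) tensor_act_mult)
  qed
  have "real_polynomial_function R"
    unfolding R_def using integral_act_polynomial[OF p(1) K contL] .
  then have "restrict R St33 \<in> polynomial_invariants St33 O3 tensor_act"
    unfolding polynomial_invariants_def poly_fun_on_def using Rinv tensor_act_St33 by auto
  from eq[OF this] have "R v = R w" using v w by simp
  moreover have "R v \<ge> c0 - \<epsilon> * V"
  proof -
    have "integral K (\<lambda>a. f (tensor_act (L a) v) - \<epsilon> * 1) \<le> R v"
      unfolding R_def
    proof (intro integral_le integrable_continuous_compact K contp continuous_on_diff contfv continuous_on_const)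
      fix a assume "a \<in> K"
      then have "tensor_act (L a) v \<in> C" by (simp add: C_def)
      then show "f (tensor_act (L a) v) - \<epsilon> * 1 \<le> p (tensor_act (L a) v)" using p(2) by fastforce
    qed
    moreover have "integral K (\<lambda>a. f (tensor_act (L a) v) - \<epsilon> * 1) = c0 - \<epsilon> * V"
      unfolding c0_def V_def
      by (subst integral_diff) (intro integrable_continuous_compact K contfv continuous_on_const, intro integrable_continuous_compact K contfv continuous_on_const, simp only: integral_mult_right)
    ultimately show ?thesis by simp
  qed
  moreover have "R w \<le> \<epsilon> * V"
  proof -
    have "R w \<le> integral K (\<lambda>a. \<epsilon> * 1)"
      unfolding R_def
    proof (intro integral_le integrable_continuous_compact K contp continuous_on_const)
      fix a assume "a \<in> K"
      then have "tensor_act (L a) w \<in> C" "f (tensor_act (L a) w) = 0"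
        by (auto simp: C_def f_def K_iff)
      then show "p (tensor_act (L a) w) \<le> \<epsilon> * 1" using p(2) by fastforce
    qed
    then show ?thesis unfolding V_def by (simp only: integral_mult_right)
  qed
  ultimately have "c0 \<le> 2 * \<epsilon> * V" by linarith
  moreover have "2 * \<epsilon> * V < c0"
    using \<open>c0 > 0\<close> V by (simp add: \<epsilon>_def field_simps)
  ultimately show False by linarith
qed

section \<open>Function bases\<close>

lemma generated_algebra_eqI:
  assumes "f \<in> generated_algebra V B" "u \<in> V" "v \<in> V" "\<And>b. b \<in> B \<Longrightarrow> b u = b v"
  shows "f u = f v"
  using assms by (induction rule: generated_algebra.induct) auto

text \<open>Values of the generators determine those of all polynomial invariants, hence the orbit,
  hence every invariant function.\<close>

lemma integrity_basis_function_basis: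
  assumes B: "integrity_basis St33 O3 tensor_act B"
  shows "function_basis St33 O3 tensor_act B"
  unfolding function_basis_def
proof (intro conjI ballI)
  show "B \<subseteq> function_invariants St33 O3 tensor_act"
    using B by (auto simp: integrity_basis_def polynomial_invariants_def function_invariants_def poly_fun_on_def)
  fix h assume h: "h \<in> function_invariants St33 O3 tensor_act"
  have same: "h u = h v" if uv: "u \<in> St33" "v \<in> St33" "(\<lambda>f\<in>B. f u) = (\<lambda>f\<in>B. f v)" for u v
  proof -
    have b: "b u = b v" if "b \<in> B" for b using fun_cong[OF uv(3), of b] that by simp
    have "q u = q v" if "q \<in> polynomial_invariants St33 O3 tensor_act" for q
    proof -
      have "q \<in> generated_algebra St33 B" using B that by (simp add: integrity_basis_def)
      then show ?thesis using uv(1,2) b by (rule generated_algebra_eqI)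
    qed
    then obtain g where "g \<in> O3" "u = tensor_act g v"
      using polynomial_invariants_separate_orbits[OF uv(1,2)] by blast
    then show ?thesis using h uv(2) by (auto simp: function_invariants_def)
  qed
  show "function_of St33 B h"
    unfolding function_of_def
  proof (intro exI ballI)
    fix v assume v: "v \<in> St33"
    \<comment> \<open>The required function of the tuple evaluates h at an arbitrarily chosen tensor
      with these values; \<open>same\<close> makes the choice irrelevant.\<close>
    let ?u = "SOME u. u \<in> St33 \<and> (\<lambda>f\<in>B. f u) = (\<lambda>f\<in>B. f v)"
    have "?u \<in> St33 \<and> (\<lambda>f\<in>B. f ?u) = (\<lambda>f\<in>B. f v)"
      by (rule someI[of _ v]) (use v in simp)
    then show "h v = (\<lambda>t. h (SOME u. u \<in> St33 \<and> (\<lambda>f\<in>B. f u) = t)) (\<lambda>f\<in>B. f v)"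
      using same[of ?u v] v by simp
  qed
qed

theorem proposition1:
  fixes B :: "(tensor333 \<Rightarrow> real) set"
  assumes "minimal_integrity_basis St33 O3 tensor_act B"
  shows "irreducible_function_basis St33 O3 tensor_act B"
  using assms integrity_basis_function_basis minimal_basis_irreducible
  unfolding irreducible_function_basis_def minimal_integrity_basis_def by blast

end
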